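(* Let $d=2$. The MWX element method with Nitsche's technique: find $u_h\in V_h$ such that $$\varepsilon^2\tilde a_h(u_h,v_h)+b_h(u_h,v_h)=(f,P_hv_h)\qquad\forall\,v_h\in V_h,$$ can be decoupled into one Lagrange element method of Poisson equation, two Morley element methods of Poisson equation and one nonconforming $P_1$-$P_0$ element method of Brinkman problem. That is, it is equivalent to: find $w_h\in W_h$ such that $$(\nabla w_h,\nabla\chi_h)=(f,\chi_h)\qquad\forall\,\chi_h\in W_h,$$ and then find $(z_h,\phi_h,p_h,u_h)\in V_h\times V_h^{CR}\times\mathcal Q_h\times V_h$ such that $$(\operatorname{curl}_hz_h,\operatorname{curl}_hv_h)=(\nabla w_h,\nabla_hv_h)\qquad\forall\,v_h\in V_h,$$ $$(\phi_h,\psi_h)+\varepsilon^2c_h(\phi_h,\psi_h)+(\operatorname{div}_h\psi_h,p_h)=(\operatorname{curl}_hz_h,\psi_h)\qquad\forall\,\psi_h\in V_h^{CR},$$ $$(\operatorname{div}_h\phi_h,q_h)=0\qquad\forall\,q_h\in\mathcal Q_h,$$ $$(\operatorname{curl}_hu_h,\operatorname{curl}_h\chi_h)=(\phi_h,\operatorname{curl}_h\chi_h)\qquad\forall\,\chi_h\in V_h.$$ (Equivalence means: $u_h$ solves the MWX element method with Nitsche's technique if and only if $u_h$ is the last component of a solution of the decoupled system.)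
   Context: $\Omega\subset\mathbb R^2$ is a convex bounded polygon, $f\in L^2(\Omega)$, $\varepsilon>0$, $\sigma>0$, and $\mathcal T_h$ is a (shape regular) triangulation of $\Omega$; $\mathcal F_h^\partial$ is the set of boundary edges, $h_F$ the length of $F$. $(\cdot,\cdot)$ is the $L^2(\Omega)$ inner product and $(\cdot,\cdot)_F$ that of $L^2(F)$; $n$ is the unit outward normal and $t$ the unit tangential vector on boundary edges. $\nabla_h,\nabla_h^2,\operatorname{curl}_h,\operatorname{div}_h$ are the elementwise gradient, Hessian, curl and divergence, where for scalar $v$, $\operatorname{curl}v=(\partial_{2}v,-\partial_{1}v)^{T}$. Morley (MWX) spaces: $\widetilde V_h$ is the set of piecewise quadratic functions on $\mathcal T_h$ that are continuous at all vertices and whose normal derivatives are continuous at the midpoint of each edge; $V_h:=\{v\in\widetilde V_h:v=0$ at all vertices on $\partial\Omega\}$. Lagrange space: $W_h:=\{v\in H_0^1(\Omega):v|_K\in\mathbb P_\ell(K)\ \forall K\in\mathcal T_h\}$, $\ell\in\{1,2\}$ fixed. $V_h^{CR}$ is the set of $v\in L^2(\Omega;\mathbb R^2)$ with $v|_K\in\mathbb P_1(K;\mathbb R^2)$ for each $K$, such that the jump of $v$ has zero integral on each interior edge and $\int_Fv\cdot n\,ds=0$ on each boundary edge $F$. $\mathcal Q_h$ is the space of piecewise constant functions on $\mathcal T_h$ with vanishing mean over $\Omega$. Forms: $b_h(w,v):=(\nabla_hw,\nabla_hv)$, $$\tilde a_h(w,v):=(\nabla_h^2w,\nabla_h^2v)-\sum_{F\in\mathcal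 F_h^\partial}(\partial_{nn}^2w,\partial_nv)_F-\sum_{F\in\mathcal F_h^\partial}(\partial_nw,\partial_{nn}^2v)_F+\sum_{F\in\mathcal F_h^\partial}\frac{\sigma}{h_F}(\partial_nw,\partial_nv)_F,$$ $$c_h(\phi,\psi):=(\nabla_h\phi,\nabla_h\psi)-\sum_{F\in\mathcal F_h^\partial}(\partial_n(\phi\cdot t),\psi\cdot t)_F-\sum_{F\in\mathcal F_h^\partial}(\phi\cdot t,\partial_n(\psi\cdot t))_F+\sum_{F\in\mathcal F_h^\partial}\frac{\sigma}{h_F}(\phi\cdot t,\psi\cdot t)_F.$$ $P_h$ maps piecewise $H^1$ functions to $W_h$ by $(\nabla P_hv,\nabla\chi_h)=(\nabla_hv,\nabla\chi_h)$ for all $\chi_h\in W_h$. *)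

theory Defs
  imports "HOL-Analysis.Analysis"
begin

(* Functions on the mesh are genuine functions on the plane that are prescribed on the open
   triangles only. Their values on the mesh skeleton (a null set) and outside the domain are
   irrelevant: no definition below looks at them. *)

type_synonym pt = "real^2"

(* Piecewise polynomials are smooth at every point of every open triangle, so the elementwise
   operators are the classical pointwise ones, off the null set formed by the skeleton. *)

definition dir_deriv :: "pt \<Rightarrow> (pt \<Rightarrow> real) \<Rightarrow> pt \<Rightarrow> real" where
  "dir_deriv d v x = frechet_derivative v (at x) d"

definition pderiv_at :: "2 \<Rightarrow> (pt \<Rightarrow> real) \<Rightarrow> pt \<Rightarrow> real" where
  "pderiv_at i = dir_deriv (axis i 1)"

definition grad :: "(pt \<Rightarrow> real) \<Rightarrow> pt \<Rightarrow> real^2" where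
  "grad v x = (\<chi> i. pderiv_at i v x)"

definition vgrad :: "(pt \<Rightarrow> real^2) \<Rightarrow> pt \<Rightarrow> real^2^2" where
  "vgrad \<phi> x = jacobian \<phi> (at x)"

definition hess :: "(pt \<Rightarrow> real) \<Rightarrow> pt \<Rightarrow> real^2^2" where
  "hess v = vgrad (grad v)"

definition curl :: "(pt \<Rightarrow> real) \<Rightarrow> pt \<Rightarrow> real^2" where
  "curl v x = vector [pderiv_at 2 v x, - pderiv_at 1 v x]"

definition dvg :: "(pt \<Rightarrow> real^2) \<Rightarrow> pt \<Rightarrow> real" where
  "dvg \<phi> x = pderiv_at 1 (\<lambda>y. \<phi> y $ 1) x + pderiv_at 2 (\<lambda>y. \<phi> y $ 2) x"

(* The target type covers scalar, vector and matrix fields; the inner product on matrices is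
   the Frobenius one. *)

definition L2 :: "pt set \<Rightarrow> (pt \<Rightarrow> 'b::euclidean_space) set" where
  "L2 \<Omega> = {g. g \<in> borel_measurable (lebesgue_on \<Omega>)
              \<and> integrable (lebesgue_on \<Omega>) (\<lambda>x. (norm (g x))\<^sup>2)}"

definition ip :: "pt set \<Rightarrow> (pt \<Rightarrow> 'b::euclidean_space) \<Rightarrow> (pt \<Rightarrow> 'b) \<Rightarrow> real" where
  "ip \<Omega> g h = (LINT x|lebesgue_on \<Omega>. g x \<bullet> h x)"

primrec Ck :: "nat \<Rightarrow> (pt \<Rightarrow> real) \<Rightarrow> bool" where
  "Ck 0 \<phi> \<longleftrightarrow> continuous_on UNIV \<phi>"
| "Ck (Suc k) \<phi> \<longleftrightarrow> (\<forall>x. \<phi> differentiable (at x)) \<and> (\<forall>i. Ck k (pderiv_at i \<phi>))"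

definition test_functions :: "pt set \<Rightarrow> (pt \<Rightarrow> real) set" where
  "test_functions \<Omega> = {\<phi>. (\<forall>k. Ck k \<phi>) \<and> compact (closure {x. \<phi> x \<noteq> 0})
                          \<and> closure {x. \<phi> x \<noteq> 0} \<subseteq> \<Omega>}"

definition weak_gradient :: "pt set \<Rightarrow> (pt \<Rightarrow> real) \<Rightarrow> (pt \<Rightarrow> real^2) \<Rightarrow> bool" where
  "weak_gradient \<Omega> v G \<longleftrightarrow>
     (\<forall>\<psi>\<in>test_functions \<Omega>. \<forall>i. ip \<Omega> v (pderiv_at i \<psi>) = - ip \<Omega> (\<lambda>x. G x $ i) \<psi>)"

(* The closure of the test functions in the norm of $H^1(\Omega)$. *)

definition H10 :: "pt set \<Rightarrow> (pt \<Rightarrow> real) set" where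
  "H10 \<Omega> = {v. v \<in> L2 \<Omega> \<and> (\<exists>G. G \<in> L2 \<Omega> \<and> weak_gradient \<Omega> v G \<and>
      (\<forall>e>0. \<exists>\<phi>\<in>test_functions \<Omega>.
         ip \<Omega> (\<lambda>x. v x - \<phi> x) (\<lambda>x. v x - \<phi> x)
       + ip \<Omega> (\<lambda>x. G x - grad \<phi> x) (\<lambda>x. G x - grad \<phi> x) < e\<^sup>2))}"

definition convex_polygon :: "pt set \<Rightarrow> bool" where
  "convex_polygon \<Omega> \<longleftrightarrow> open \<Omega> \<and> convex \<Omega> \<and> bounded \<Omega> \<and> \<Omega> \<noteq> {} \<and> polytope (closure \<Omega>)"

(* Elements are closed triangles; the library notion of triangulation makes two elements meet
   in a common face (possibly empty), so there are no hanging nodes. *)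

definition mesh :: "pt set \<Rightarrow> pt set set \<Rightarrow> bool" where
  "mesh \<Omega> T \<longleftrightarrow> triangulation T \<and> (\<forall>K\<in>T. 2 simplex K) \<and> \<Union>T = closure \<Omega>"

definition boundary_edges :: "pt set \<Rightarrow> pt set set \<Rightarrow> pt set set" where
  "boundary_edges \<Omega> T = {F. (\<exists>K\<in>T. F edge_of K) \<and> F \<subseteq> frontier \<Omega>}"

(* The only element having a given boundary edge. *)

definition element_at :: "pt set set \<Rightarrow> pt set \<Rightarrow> pt set" where
  "element_at T F = (THE K. K \<in> T \<and> F edge_of K)"

(* S is a convex domain or an element, F a segment of its boundary. *)

definition outward_normal :: "pt set \<Rightarrow> pt set \<Rightarrow> pt" where
  "outward_normal S F = (THE n. norm n = 1 \<and> (\<forall>x\<in>F. \<forall>y\<in>S. n \<bullet> (y - x) \<le> 0))"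

(* The outward normal turned counterclockwise by a right angle. *)

definition tangent :: "pt set \<Rightarrow> pt set \<Rightarrow> pt" where
  "tangent S F = (let n = outward_normal S F in vector [- n $ 2, n $ 1])"

(* Limit at a point of K taken from the interior of K. *)

definition elem_trace :: "pt set \<Rightarrow> (pt \<Rightarrow> 'b::euclidean_space) \<Rightarrow> pt \<Rightarrow> 'b" where
  "elem_trace K g x = Lim (at x within interior K) g"

definition bd_trace :: "pt set set \<Rightarrow> pt set \<Rightarrow> (pt \<Rightarrow> 'b::euclidean_space) \<Rightarrow> pt \<Rightarrow> 'b" where
  "bd_trace T F = elem_trace (element_at T F)"

(* Integral with respect to arc length; it does not depend on the order of the end points. *)

definition edge_integral :: "pt set \<Rightarrow> (pt \<Rightarrow> real) \<Rightarrow> real" where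
  "edge_integral F g = (let (a, b) = (SOME (a, b). F = closed_segment a b)
                        in dist a b * integral {0..1} (\<lambda>s. g (linepath a b s)))"

definition edge_ip :: "pt set \<Rightarrow> (pt \<Rightarrow> real) \<Rightarrow> (pt \<Rightarrow> real) \<Rightarrow> real" where
  "edge_ip F g h = edge_integral F (\<lambda>x. g x * h x)"

definition polys :: "nat \<Rightarrow> (pt \<Rightarrow> real) set" where
  "polys k = {p. \<exists>c :: nat \<Rightarrow> nat \<Rightarrow> real.
                 p = (\<lambda>x. \<Sum>i\<le>k. \<Sum>j\<le>k - i. c i j * (x $ 1) ^ i * (x $ 2) ^ j)}"

definition pw_polys :: "pt set set \<Rightarrow> nat \<Rightarrow> (pt \<Rightarrow> real) set" where
  "pw_polys T k = {v. \<forall>K\<in>T. \<exists>p\<in>polys k. \<forall>x\<in>interior K. v x = p x}"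

definition mwx_space :: "pt set set \<Rightarrow> (pt \<Rightarrow> real) set" where
  "mwx_space T = {v \<in> pw_polys T 2.
     (\<forall>K\<in>T. \<forall>K'\<in>T. \<forall>a. a extreme_point_of K \<and> a extreme_point_of K' \<longrightarrow>
        elem_trace K v a = elem_trace K' v a) \<and>
     (\<forall>K\<in>T. \<forall>K'\<in>T. \<forall>a b. closed_segment a b edge_of K \<and> closed_segment a b edge_of K' \<longrightarrow>
        (let n = outward_normal K (closed_segment a b) in
           elem_trace K (dir_deriv n v) (midpoint a b) =
           elem_trace K' (dir_deriv n v) (midpoint a b)))}"

definition mwx_space0 :: "pt set \<Rightarrow> pt set set \<Rightarrow> (pt \<Rightarrow> real) set" where
  "mwx_space0 \<Omega> T = {v \<in> mwx_space T.
     \<forall>K\<in>T. \<forall>a. a extreme_point_of K \<and> a \<in> frontier \<Omega> \<longrightarrow> elem_trace K v a = 0}"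

definition lagrange_space0 :: "pt set \<Rightarrow> pt set set \<Rightarrow> nat \<Rightarrow> (pt \<Rightarrow> real) set" where
  "lagrange_space0 \<Omega> T l = H10 \<Omega> \<inter> pw_polys T l"

definition cr_space :: "pt set \<Rightarrow> pt set set \<Rightarrow> (pt \<Rightarrow> real^2) set" where
  "cr_space \<Omega> T = {v. (\<forall>i. (\<lambda>x. v x $ i) \<in> pw_polys T 1) \<and>
     (\<forall>K\<in>T. \<forall>K'\<in>T. \<forall>F. K \<noteq> K' \<and> F edge_of K \<and> F edge_of K' \<longrightarrow>
        (\<forall>i. edge_integral F (\<lambda>x. (elem_trace K v x - elem_trace K' v x) $ i) = 0)) \<and>
     (\<forall>F\<in>boundary_edges \<Omega> T.
        edge_integral F (\<lambda>x. bd_trace T F v x \<bullet> outward_normal \<Omega> F) = 0)}"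

definition pw_const_space0 :: "pt set \<Rightarrow> pt set set \<Rightarrow> (pt \<Rightarrow> real) set" where
  "pw_const_space0 \<Omega> T = {q \<in> pw_polys T 0. (LINT x|lebesgue_on \<Omega>. q x) = 0}"

definition b_form :: "pt set \<Rightarrow> (pt \<Rightarrow> real) \<Rightarrow> (pt \<Rightarrow> real) \<Rightarrow> real" where
  "b_form \<Omega> w v = ip \<Omega> (grad w) (grad v)"

definition a_form :: "pt set \<Rightarrow> pt set set \<Rightarrow> real \<Rightarrow> (pt \<Rightarrow> real) \<Rightarrow> (pt \<Rightarrow> real) \<Rightarrow> real" where
  "a_form \<Omega> T \<sigma> w v =
     (let dn = (\<lambda>F. dir_deriv (outward_normal \<Omega> F)) in
        ip \<Omega> (hess w) (hess v)
      - (\<Sum>F\<in>boundary_edges \<Omega> T. edge_ip F (bd_trace T F (dn F (dn F w))) (bd_trace T F (dn F v)))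
      - (\<Sum>F\<in>boundary_edges \<Omega> T. edge_ip F (bd_trace T F (dn F w)) (bd_trace T F (dn F (dn F v))))
      + (\<Sum>F\<in>boundary_edges \<Omega> T. \<sigma> / diameter F *
           edge_ip F (bd_trace T F (dn F w)) (bd_trace T F (dn F v))))"

definition c_form :: "pt set \<Rightarrow> pt set set \<Rightarrow> real \<Rightarrow> (pt \<Rightarrow> real^2) \<Rightarrow> (pt \<Rightarrow> real^2) \<Rightarrow> real" where
  "c_form \<Omega> T \<sigma> \<phi> \<psi> =
     (let dn = (\<lambda>F. dir_deriv (outward_normal \<Omega> F));
          tg = (\<lambda>F \<theta> x. \<theta> x \<bullet> tangent \<Omega> F) in
        ip \<Omega> (vgrad \<phi>) (vgrad \<psi>)
      - (\<Sum>F\<in>boundary_edges \<Omega> T. edge_ip F (bd_trace T F (dn F (tg F \<phi>))) (bd_trace T F (tg F \<psi>)))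
      - (\<Sum>F\<in>boundary_edges \<Omega> T. edge_ip F (bd_trace T F (tg F \<phi>)) (bd_trace T F (dn F (tg F \<psi>))))
      + (\<Sum>F\<in>boundary_edges \<Omega> T. \<sigma> / diameter F *
           edge_ip F (bd_trace T F (tg F \<phi>)) (bd_trace T F (tg F \<psi>))))"

(* On the Lagrange space the weak gradient is a.e. the elementwise one. The projection is
   unique up to null sets, hence the choice. *)

definition lagrange_proj :: "pt set \<Rightarrow> pt set set \<Rightarrow> nat \<Rightarrow> (pt \<Rightarrow> real) \<Rightarrow> pt \<Rightarrow> real" where
  "lagrange_proj \<Omega> T l v = (SOME p. p \<in> lagrange_space0 \<Omega> T l \<and>
     (\<forall>\<eta>\<in>lagrange_space0 \<Omega> T l. ip \<Omega> (grad p) (grad \<eta>) = ip \<Omega> (grad v) (grad \<eta>)))"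

definition mwx_nitsche_solution ::
  "pt set \<Rightarrow> pt set set \<Rightarrow> nat \<Rightarrow> real \<Rightarrow> real \<Rightarrow> (pt \<Rightarrow> real) \<Rightarrow> (pt \<Rightarrow> real) \<Rightarrow> bool" where
  "mwx_nitsche_solution \<Omega> T l \<epsilon> \<sigma> f u \<longleftrightarrow> u \<in> mwx_space0 \<Omega> T \<and>
     (\<forall>v\<in>mwx_space0 \<Omega> T.
        \<epsilon>\<^sup>2 * a_form \<Omega> T \<sigma> u v + b_form \<Omega> u v = ip \<Omega> f (lagrange_proj \<Omega> T l v))"

definition decoupled_solution ::
  "pt set \<Rightarrow> pt set set \<Rightarrow> nat \<Rightarrow> real \<Rightarrow> real \<Rightarrow> (pt \<Rightarrow> real) \<Rightarrow>
   (pt \<Rightarrow> real) \<Rightarrow> (pt \<Rightarrow> real) \<Rightarrow> (pt \<Rightarrow> real^2) \<Rightarrow> (pt \<Rightarrow> real) \<Rightarrow> (pt \<Rightarrow> real) \<Rightarrow> bool" where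
  "decoupled_solution \<Omega> T l \<epsilon> \<sigma> f w z \<phi> p u \<longleftrightarrow>
     w \<in> lagrange_space0 \<Omega> T l \<and> z \<in> mwx_space0 \<Omega> T \<and> \<phi> \<in> cr_space \<Omega> T \<and>
     p \<in> pw_const_space0 \<Omega> T \<and> u \<in> mwx_space0 \<Omega> T \<and>
     (\<forall>\<eta>\<in>lagrange_space0 \<Omega> T l. ip \<Omega> (grad w) (grad \<eta>) = ip \<Omega> f \<eta>) \<and>
     (\<forall>v\<in>mwx_space0 \<Omega> T. ip \<Omega> (curl z) (curl v) = ip \<Omega> (grad w) (grad v)) \<and>
     (\<forall>\<psi>\<in>cr_space \<Omega> T.
        ip \<Omega> \<phi> \<psi> + \<epsilon>\<^sup>2 * c_form \<Omega> T \<sigma> \<phi> \<psi> + ip \<Omega> (dvg \<psi>) p = ip \<Omega> (curl z) \<psi>) \<and>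
     (\<forall>q\<in>pw_const_space0 \<Omega> T. ip \<Omega> (dvg \<phi>) q = 0) \<and>
     (\<forall>\<eta>\<in>mwx_space0 \<Omega> T. ip \<Omega> (curl u) (curl \<eta>) = ip \<Omega> \<phi> (curl \<eta>))"

end

theory Submission
  imports Defs
begin

text \<open>
  The curl maps the Morley space into the divergence-free fields of the Crouzeix-Raviart space and
  turns the normal derivative into the negative tangential component, so the form c of two curls is
  the form a of the stream functions. Conversely every discretely divergence-free field is a curl:
  its elementwise stream functions glue because the domain is convex, and they are constant on the
  frontier because the frontier is connected. Hence testing the Brinkman problem with curls gives
  the original method, and the pressure is a Riesz representative of the remaining functional on the
  divergences, which have zero mean by the divergence theorem on the triangles. Solvability of the
  Lagrange problem reduces to the fact that a piecewise constant function in the closure of the test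
  functions vanishes.
\<close>

section \<open>Two existence principles\<close>

text \<open>Mesh functions are prescribed on open triangles only. Their spaces therefore contain
  arbitrary values on the skeleton, the gradient and divergence products are merely semidefinite on
  them, and equality can be expected only up to \<open>interior_eq\<close>. Hence the existence
  principle: finitely many separating functionals stand in for finite dimension, and the right-hand
  side has to vanish on null vectors. Since \<open>\<sigma>\<close> is merely positive, coercivity
  of \<open>c_form\<close> is not at hand, so the Brinkman step is not solved abstractly: its
  velocity is read off from \<open>u\<close>, and its pressure is sought in the range of the
  divergence, where vanishing on divergence-free fields replaces an inf-sup condition. Gluing stream
  functions needs a form of simple connectedness; on a convex set a potential can be summed along
  straight segments from one centre. \<open>H10\<close> offers approximants but no traces. A nonzero
  piecewise constant limit is excluded by scaling: a jump makes squared translation differences of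
  order t, while approximation by test functions makes them of order t squared.\<close>

text \<open>Induction on the number of separating functionals: split off one functional, solve on its
  kernel, and correct along a vector that is orthogonal to the kernel.\<close>

lemma semidefinite_riesz:
  fixes V :: "('x \<Rightarrow> 'b::real_vector) set" and B :: "('x \<Rightarrow> 'b) \<Rightarrow> ('x \<Rightarrow> 'b) \<Rightarrow> real"
    and L :: "('x \<Rightarrow> 'b) \<Rightarrow> real" and \<Lambda> :: "'i \<Rightarrow> ('x \<Rightarrow> 'b) \<Rightarrow> real"
  assumes "finite I"
    and ne: "V \<noteq> {}"
    and closed: "\<And>u v r s. u \<in> V \<Longrightarrow> v \<in> V \<Longrightarrow> (\<lambda>x. r *\<^sub>R u x + s *\<^sub>R v x) \<in> V"
    and Blin: "\<And>u v w r s. u \<in> V \<Longrightarrow> v \<in> V \<Longrightarrow> w \<in> V \<Longrightarrow>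
      B (\<lambda>x. r *\<^sub>R u x + s *\<^sub>R v x) w = r * B u w + s * B v w"
    and Bsym: "\<And>u v. u \<in> V \<Longrightarrow> v \<in> V \<Longrightarrow> B u v = B v u"
    and Bpos: "\<And>v. v \<in> V \<Longrightarrow> B v v \<ge> 0"
    and Llin: "\<And>u v r s. u \<in> V \<Longrightarrow> v \<in> V \<Longrightarrow> L (\<lambda>x. r *\<^sub>R u x + s *\<^sub>R v x) = r * L u + s * L v"
    and \<Lambda>lin: "\<And>i u v r s. i \<in> I \<Longrightarrow> u \<in> V \<Longrightarrow> v \<in> V \<Longrightarrow>
      \<Lambda> i (\<lambda>x. r *\<^sub>R u x + s *\<^sub>R v x) = r * \<Lambda> i u + s * \<Lambda> i v"
    and sep: "\<And>v. v \<in> V \<Longrightarrow> (\<And>i. i \<in> I \<Longrightarrow> \<Lambda> i v = 0) \<Longrightarrow> B v v = 0"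
    and ker: "\<And>v. v \<in> V \<Longrightarrow> B v v = 0 \<Longrightarrow> L v = 0"
  shows "\<exists>u\<in>V. \<forall>v\<in>V. B u v = L v"
  using assms
proof (induction I arbitrary: V L rule: finite_induct)
  case empty
  note ne = empty.prems(1) and closed = empty.prems(2) and Blin = empty.prems(3)
    and Bsym = empty.prems(4)
  have B0: "B v v = 0" if "v \<in> V" for v using empty.prems(8) that by blast
  obtain u where u: "u \<in> V" using ne by auto
  \<comment> \<open>Without functionals \<open>B v v\<close> vanishes on all of \<open>V\<close>;
    polarization makes \<open>B\<close> vanish and \<open>ker\<close> makes \<open>L\<close> vanish,
    so every element of \<open>V\<close> is a solution.\<close>
  have "B u v = L v" if v: "v \<in> V" for v
  proof -
    let ?w = "\<lambda>x. 1 *\<^sub>R u x + 1 *\<^sub>R v x"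
    have w: "?w \<in> V" using closed[OF u v] .
    have "B ?w ?w = 1 * B u ?w + 1 * B v ?w" using Blin[OF u v w] .
    also have "\<dots> = B ?w u + B ?w v" using Bsym[OF u w] Bsym[OF v w] by simp
    also have "B ?w u = 1 * B u u + 1 * B v u" using Blin[OF u v u] .
    also have "B ?w v = 1 * B u v + 1 * B v v" using Blin[OF u v v] .
    finally have "B u v = 0" using B0 u v w Bsym[OF u v] by simp
    moreover have "L v = 0" using empty.prems(9) B0 v by blast
    ultimately show ?thesis by simp
  qed
  then show ?case using u by blast
next
  case (insert j J)
  note ne = insert.prems(1) and closed = insert.prems(2) and Blin = insert.prems(3)
    and Bsym = insert.prems(4) and Bpos = insert.prems(5) and Llin = insert.prems(6)
    and \<Lambda>lin = insert.prems(7) and sep = insert.prems(8) and ker = insert.prems(9)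
  define W where "W = {v \<in> V. \<Lambda> j v = 0}"
  have WV: "W \<subseteq> V" by (auto simp: W_def)
  have zero: "(\<lambda>x. 0) \<in> V" using closed[of _ _ 0 0] ne by auto
  have \<Lambda>0: "\<Lambda> j (\<lambda>x. 0) = 0" using \<Lambda>lin[of j "\<lambda>x. 0" "\<lambda>x. 0" 0 0] zero by auto
  \<comment> \<open>The functional stays arbitrary because two are needed: \<open>L\<close> itself,
    and \<open>B e\<close>, whose representative is the projection of \<open>e\<close> onto
    \<open>W\<close>.\<close>
  have solve: "\<exists>u\<in>W. \<forall>v\<in>W. B u v = M v"
    if Mlin: "\<And>u v r s. u \<in> V \<Longrightarrow> v \<in> V \<Longrightarrow> M (\<lambda>x. r *\<^sub>R u x + s *\<^sub>R v x) = r * M u + s * M v"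
      and Mker: "\<And>v. v \<in> V \<Longrightarrow> B v v = 0 \<Longrightarrow> M v = 0" for M
  proof (rule insert.IH)
    show "W \<noteq> {}" using zero \<Lambda>0 by (auto simp: W_def)
    show "(\<lambda>x. r *\<^sub>R u x + s *\<^sub>R v x) \<in> W" if "u \<in> W" "v \<in> W" for u v r s
      using that closed[of u v r s] \<Lambda>lin[of j u v r s] by (auto simp: W_def)
    show "B v v = 0" if "v \<in> W" "\<And>i. i \<in> J \<Longrightarrow> \<Lambda> i v = 0" for v
      using sep[of v] that by (auto simp: W_def)
    show "\<Lambda> i (\<lambda>x. r *\<^sub>R u x + s *\<^sub>R v x) = r * \<Lambda> i u + s * \<Lambda> i v"
      if "i \<in> J" "u \<in> W" "v \<in> W" for i u v r s
      using that \<Lambda>lin[of i u v r s] by (auto simp: W_def)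
    show "B (\<lambda>x. r *\<^sub>R u x + s *\<^sub>R v x) w = r * B u w + s * B v w"
      if "u \<in> W" "v \<in> W" "w \<in> W" for u v w r s
      using that WV by (intro Blin) auto
    show "B u v = B v u" if "u \<in> W" "v \<in> W" for u v using that WV Bsym by auto
    show "B v v \<ge> 0" if "v \<in> W" for v using that WV Bpos by auto
    show "M (\<lambda>x. r *\<^sub>R u x + s *\<^sub>R v x) = r * M u + s * M v"
      if "u \<in> W" "v \<in> W" for u v r s
      using that WV by (intro Mlin) auto
    show "M v = 0" if "v \<in> W" "B v v = 0" for v using that WV Mker by auto
  qed
  obtain u0 where u0: "u0 \<in> W" "\<And>v. v \<in> W \<Longrightarrow> B u0 v = L v"
    using solve[of L, OF Llin ker] by blast
  show ?case
  proof (cases "V \<subseteq> W")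
    case True
    then show ?thesis using u0 WV by blast
  next
    case False
    then obtain e where e: "e \<in> V" "\<Lambda> j e \<noteq> 0" by (auto simp: W_def)
    \<comment> \<open>A null vector of a semidefinite form is orthogonal to everything: otherwise
      \<open>B\<close> would take the value -1 at \<open>e + t v\<close> for the \<open>t\<close>
      chosen here.\<close>
    have "B e v = 0" if v: "v \<in> V" "B v v = 0" for v
    proof (rule ccontr)
      assume nz: "B e v \<noteq> 0"
      define t where "t = - (B e e + 1) / (2 * B e v)"
      let ?w = "\<lambda>x. 1 *\<^sub>R e x + t *\<^sub>R v x"
      have w: "?w \<in> V" using closed[OF e(1) v(1)] .
      have "B ?w ?w = 1 * B e ?w + t * B v ?w" using Blin[OF e(1) v(1) w] .
      also have "\<dots> = B ?w e + t * B ?w v" using Bsym[OF e(1) w] Bsym[OF v(1) w] by simp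
      also have "B ?w e = 1 * B e e + t * B v e" using Blin[OF e(1) v(1) e(1)] .
      also have "B ?w v = 1 * B e v + t * B v v" using Blin[OF e(1) v(1) v(1)] .
      finally have "B ?w ?w = B e e + 2 * t * B e v" using v Bsym[OF e(1) v(1)] by simp
      also have "2 * t * B e v = - (B e e + 1)" using nz by (simp add: t_def)
      finally show False using Bpos[OF w] by simp
    qed
    moreover have "B e (\<lambda>x. r *\<^sub>R u x + s *\<^sub>R v x) = r * B e u + s * B e v"
      if "u \<in> V" "v \<in> V" for u v r s
      using Blin[OF that e(1), of r s] Bsym[OF e(1)] closed[OF that, of r s] that by simp
    ultimately obtain e' where e': "e' \<in> W" "\<And>v. v \<in> W \<Longrightarrow> B e' v = B e v"
      using solve[of "B e"] by blast
    have e'V: "e' \<in> V" using e' WV by auto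
    \<comment> \<open>The component of \<open>e\<close> orthogonal to \<open>W\<close>; it still has
      a nonzero value under \<open>\<Lambda> j\<close>, so it spans a complement of
      \<open>W\<close>.\<close>
    define d where "d = (\<lambda>x. 1 *\<^sub>R e x + (-1) *\<^sub>R e' x)"
    have d: "d \<in> V" unfolding d_def using closed[OF e(1) e'V] .
    have dW: "B d v = 0" if "v \<in> W" for v
      using Blin[OF e(1) e'V, of v 1 "-1"] e'(2)[OF that] that WV by (auto simp: d_def)
    have \<Lambda>d: "\<Lambda> j d = \<Lambda> j e"
      using \<Lambda>lin[of j e e' 1 "-1"] e(1) e' by (auto simp: d_def W_def)
    have Bdu: "B d u0 = 0" using dW u0 by blast
    have u0V: "u0 \<in> V" using u0 WV by auto
    \<comment> \<open>If \<open>d\<close> is a null vector then \<open>ker\<close> gives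
      \<open>L d = 0\<close>, so the default value 0 satisfies \<open>\<beta> * B d d = L d\<close>
      as well.\<close>
    define \<beta> where "\<beta> = (if B d d = 0 then 0 else L d / B d d)"
    have \<beta>: "\<beta> * B d d = L d" using ker[OF d] by (auto simp: \<beta>_def)
    define u where "u = (\<lambda>x. 1 *\<^sub>R u0 x + \<beta> *\<^sub>R d x)"
    have uV: "u \<in> V" unfolding u_def using closed[OF u0V d] .
    have uw: "B u v = B u0 v + \<beta> * B d v" if "v \<in> V" for v
      using Blin[OF u0V d that, of 1 \<beta>] by (simp add: u_def)
    have "B u v = L v" if v: "v \<in> V" for v
    proof -
      \<comment> \<open>Chosen so that \<open>v - s d\<close> is annihilated by
        \<open>\<Lambda> j\<close> and thus lies in \<open>W\<close>.\<close>
      define s where "s = \<Lambda> j v / \<Lambda> j d"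
      define w where "w = (\<lambda>x. 1 *\<^sub>R v x + (-s) *\<^sub>R d x)"
      have wV: "w \<in> V" unfolding w_def using closed[OF v d] .
      have "\<Lambda> j w = 0" using \<Lambda>lin[of j v d 1 "-s"] v d e \<Lambda>d by (simp add: w_def s_def)
      then have w: "w \<in> W" using wV by (simp add: W_def)
      have v_eq: "v = (\<lambda>x. 1 *\<^sub>R w x + s *\<^sub>R d x)" by (simp add: w_def)
      have Bv: "B g v = B g w + s * B g d" if "g \<in> V" for g
        using Blin[OF wV d that, of 1 s] Bsym[OF that wV] Bsym[OF that d] Bsym[OF that v] v_eq
        by simp
      have "B u v = B u w + s * B u d" using Bv[OF uV] .
      also have "\<dots> = L w + s * (\<beta> * B d d)"
        using uw[OF wV] uw[OF d] u0(2)[OF w] dW[OF w] Bdu Bsym[OF u0V d] by simp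
      also have "\<dots> = L v" using \<beta> Llin[OF wV d, of 1 s] v_eq by simp
      finally show ?thesis .
    qed
    then show ?thesis using uV by blast
  qed
qed

text \<open>The potential sums the increments along the straight segment from a fixed centre; comparing
  the segments to two nearby points rung by rung makes the difference telescope.\<close>

lemma convex_local_cocycle_potential:
  fixes S :: "'a::real_normed_vector set" and D :: "'a \<Rightarrow> 'a \<Rightarrow> real"
  assumes S: "convex S" "bounded S" and "\<delta> > 0"
    and D: "\<And>x y z. x \<in> S \<Longrightarrow> y \<in> S \<Longrightarrow> z \<in> S \<Longrightarrow> dist x y < \<delta> \<Longrightarrow> dist y z < \<delta> \<Longrightarrow> dist x z < \<delta> \<Longrightarrow>
      D x y + D y z = D x z"
  shows "\<exists>g. \<forall>x\<in>S. \<forall>y\<in>S. dist x y < \<delta> / 2 \<longrightarrow> g y - g x = D x y"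
proof (cases "S = {}")
  case False
  then obtain c where c: "c \<in> S" by auto
  obtain R where R: "\<And>x. x \<in> S \<Longrightarrow> dist c x < R"
    using S(2) bounded_any_center[of S c] by (meson gt_ex le_less_trans)
  then have "R > 0" using c by force
  \<comment> \<open>With \<open>N\<close> rungs, neighbouring points on any segment from the centre
    are less than \<open>\<delta> / 2\<close> apart.\<close>
  obtain N :: nat where N: "2 * R / \<delta> < real N" using reals_Archimedean2 by blast
  then have N0: "N > 0" using \<open>R > 0\<close> \<open>\<delta> > 0\<close> by (cases N) (auto simp: field_simps)
  have RN: "R / N < \<delta> / 2" using N N0 \<open>\<delta> > 0\<close> by (simp add: field_simps)
  define P where "P x i = c + (real i / N) *\<^sub>R (x - c)" for x i
  have PS: "P x i \<in> S" if "x \<in> S" "i \<le> N" for x i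
  proof -
    have "P x i = (1 - real i / N) *\<^sub>R c + (real i / N) *\<^sub>R x" by (simp add: P_def algebra_simps)
    then show ?thesis using S(1) c that N0 by (auto simp: convex_alt)
  qed
  have step: "dist (P x i) (P x (Suc i)) < \<delta> / 2" if "x \<in> S" for x i
  proof -
    have "P x i - P x (Suc i) = (- 1 / N) *\<^sub>R (x - c)"
      unfolding P_def by (simp add: algebra_simps add_divide_distrib)
    then have "dist (P x i) (P x (Suc i)) = dist c x / N"
      using N0 by (simp add: dist_norm norm_minus_commute)
    also have "\<dots> \<le> R / N" using R[OF that] by (simp add: divide_right_mono)
    finally show ?thesis using RN by linarith
  qed
  have side: "dist (P x i) (P y i) \<le> dist x y" if "i \<le> N" for x y i
  proof -
    have "P x i - P y i = (real i / N) *\<^sub>R (x - y)" by (simp add: P_def algebra_simps)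
    then have "dist (P x i) (P y i) = real i / N * dist x y" by (simp add: dist_norm)
    also have "\<dots> \<le> 1 * dist x y" using that N0 by (intro mult_right_mono) auto
    finally show ?thesis by simp
  qed
  define g where "g x = (\<Sum>i<N. D (P x i) (P x (Suc i)))" for x
  have "g y - g x = D x y" if x: "x \<in> S" and y: "y \<in> S" and xy: "dist x y < \<delta> / 2" for x y
  proof -
    have "D (P y i) (P y (Suc i)) - D (P x i) (P x (Suc i)) =
        D (P x (Suc i)) (P y (Suc i)) - D (P x i) (P y i)" if "i < N" for i
    proof -
      have d: "dist (P x i) (P y i) < \<delta> / 2" "dist (P x (Suc i)) (P y (Suc i)) < \<delta> / 2"
        using side[of i x y] side[of "Suc i" x y] that xy by auto
      \<comment> \<open>Each cell of the ladder is cut by this diagonal into two triangles to which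
        the cocycle identity applies. Its length is bounded by a side plus a step, which is why the
        conclusion is restricted to \<open>\<delta> / 2\<close>.\<close>
      have diag: "dist (P x i) (P y (Suc i)) < \<delta>"
        using dist_triangle[of "P x i" "P y (Suc i)" "P x (Suc i)"] step[OF x, of i] d
        by linarith
      have "D (P x i) (P x (Suc i)) + D (P x (Suc i)) (P y (Suc i)) = D (P x i) (P y (Suc i))"
        using PS x y that d step[OF x, of i] diag \<open>\<delta> > 0\<close> by (intro D) auto
      moreover have "D (P x i) (P y i) + D (P y i) (P y (Suc i)) = D (P x i) (P y (Suc i))"
        using PS x y that d step[OF y, of i] diag \<open>\<delta> > 0\<close> by (intro D) auto
      ultimately show ?thesis by simp
    qed
    then have "g y - g x = (\<Sum>i<N. D (P x (Suc i)) (P y (Suc i)) - D (P x i) (P y i))"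
      unfolding g_def sum_subtractf[symmetric] by (intro sum.cong) auto
    also have "\<dots> = D (P x N) (P y N) - D (P x 0) (P y 0)"
      by (rule sum_lessThan_telescope)
    also have "\<dots> = D x y - D c c" using N0 by (simp add: P_def)
    also have "D c c = 0" using D[of c c c] c \<open>\<delta> > 0\<close> by simp
    finally show ?thesis by simp
  qed
  then show ?thesis by blast
qed simp

text \<open>By the Lebesgue number lemma the cells meeting a small set share a point, and increments between
  points of different cells are measured through that point.\<close>

lemma convex_cover_potential:
  fixes T :: "'a::euclidean_space set set" and h :: "'a set \<Rightarrow> 'a \<Rightarrow> real"
  assumes T: "finite T" "\<And>K. K \<in> T \<Longrightarrow> closed K" "\<And>K. K \<in> T \<Longrightarrow> convex K"
    and S: "\<Union>T = S" "convex S" "compact S"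
    and compat: "\<And>K K' a b. K \<in> T \<Longrightarrow> K' \<in> T \<Longrightarrow> a \<in> K \<inter> K' \<Longrightarrow> b \<in> K \<inter> K' \<Longrightarrow>
      h K b - h K a = h K' b - h K' a"
  shows "\<exists>g. \<forall>K\<in>T. \<forall>a\<in>K. \<forall>b\<in>K. g b - g a = h K b - h K a"
proof (cases "S = {}")
  case True
  then show ?thesis using S(1) by auto
next
  case False
  \<comment> \<open>The open set \<open>U x\<close> avoids all cells that miss \<open>x\<close>;
    every cell meeting a subset of \<open>U x\<close> therefore contains \<open>x\<close>.\<close>
  define U where "U x = - \<Union>{K \<in> T. x \<notin> K}" for x
  have "open (U x)" for x using T unfolding U_def by (intro open_Compl closed_Union) auto
  moreover have "S \<subseteq> \<Union>(U ` S)" by (auto simp: U_def)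
  ultimately obtain \<delta> where \<delta>: "\<delta> > 0" "\<And>A. A \<subseteq> S \<Longrightarrow> diameter A < \<delta> \<Longrightarrow> \<exists>B\<in>U ` S. A \<subseteq> B"
    using False by (auto intro: Lebesgue_number_lemma[OF S(3), of "U ` S"])
  have near: "\<exists>p\<in>S. \<forall>K\<in>T. x \<in> K \<or> y \<in> K \<or> z \<in> K \<longrightarrow> p \<in> K"
    if "x \<in> S" "y \<in> S" "z \<in> S" "dist x y < \<delta> / 2" "dist y z < \<delta> / 2" "dist x z < \<delta> / 2" for x y z
  proof -
    have "diameter {x, y, z} \<le> \<delta> / 2"
      using that \<delta>(1) by (intro diameter_le) (auto simp: dist_norm norm_minus_commute)
    then have "diameter {x, y, z} < \<delta>" using \<delta>(1) by linarith
    then have "\<exists>B\<in>U ` S. {x, y, z} \<subseteq> B" using that(1-3) by (intro \<delta>(2)) auto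
    then obtain p where p: "p \<in> S" "{x, y, z} \<subseteq> U p" by blast
    then show ?thesis by (intro bexI[of _ p]) (auto simp: U_def)
  qed
  define good where "good x y p \<longleftrightarrow> (\<forall>K\<in>T. x \<in> K \<or> y \<in> K \<longrightarrow> p \<in> K)" for x y p
  define E where "E x = (SOME K. K \<in> T \<and> x \<in> K)" for x
  have E: "E x \<in> T" "x \<in> E x" if "x \<in> S" for x
    using someI_ex[of "\<lambda>K. K \<in> T \<and> x \<in> K"] that S(1) unfolding E_def by auto
  \<comment> \<open>Travel from \<open>x\<close> to the common point inside one cell and on to
    \<open>y\<close> inside another. The cells and the point are arbitrary choices, and
    \<open>D_eq\<close> shows that they do not matter.\<close>
  define D where "D x y = (let p = SOME p. good x y p in
      (h (E y) y - h (E y) p) - (h (E x) x - h (E x) p))" for x y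
  have D_eq: "D x y = (h K' y - h K' p) - (h K x - h K p)"
    if p: "good x y p" and K: "K \<in> T" "x \<in> K" and K': "K' \<in> T" "y \<in> K'" for x y p K K'
  proof -
    define q where "q = (SOME p. good x y p)"
    have q: "good x y q" unfolding q_def using p by (rule someI)
    have x: "x \<in> S" "y \<in> S" using K K' S(1) by auto
    have "h (E y) y - h (E y) q = h K' y - h K' q"
      using q E[OF x(2)] K' by (intro compat) (auto simp: good_def)
    moreover have "h (E x) x - h (E x) q = h K x - h K q"
      using q E[OF x(1)] K by (intro compat) (auto simp: good_def)
    \<comment> \<open>Both \<open>p\<close> and \<open>q\<close> lie in every cell containing
      \<open>x\<close> or \<open>y\<close>, hence in \<open>K \<inter> K'\<close>, so one may be
      exchanged for the other.\<close>
    moreover have "h K q - h K p = h K' q - h K' p"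
      using p q K K' by (intro compat) (auto simp: good_def)
    ultimately show ?thesis unfolding D_def q_def[symmetric] Let_def by simp
  qed
  have "D x y + D y z = D x z"
    if xyz: "x \<in> S" "y \<in> S" "z \<in> S" "dist x y < \<delta> / 2" "dist y z < \<delta> / 2" "dist x z < \<delta> / 2"
    for x y z
  proof -
    obtain p where "\<forall>K\<in>T. x \<in> K \<or> y \<in> K \<or> z \<in> K \<longrightarrow> p \<in> K" using near[OF xyz] by blast
    then have "good x y p" "good y z p" "good x z p" by (auto simp: good_def)
    then show ?thesis
      using D_eq[of x y p "E x" "E y"] D_eq[of y z p "E y" "E z"] D_eq[of x z p "E x" "E z"] E xyz
      by simp
  qed
  then have "\<exists>g. \<forall>x\<in>S. \<forall>y\<in>S. dist x y < \<delta> / 2 / 2 \<longrightarrow> g y - g x = D x y"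
    using \<delta>(1) compact_imp_bounded[OF S(3)] by (intro convex_local_cocycle_potential[OF S(2)]) auto
  then obtain g where g: "\<And>x y. x \<in> S \<Longrightarrow> y \<in> S \<Longrightarrow> dist x y < \<delta> / 4 \<Longrightarrow> g y - g x = D x y"
    by auto
  have "g b - g a = h K b - h K a" if K: "K \<in> T" and ab: "a \<in> K" "b \<in> K" for K a b
  proof -
    have local: "g y - g x = h K y - h K x" if xy: "x \<in> K" "y \<in> K" "dist x y < \<delta> / 4" for x y
    proof -
      have xyS: "x \<in> S" "y \<in> S" using xy K S(1) by auto
      then obtain p where p: "\<forall>K\<in>T. x \<in> K \<or> y \<in> K \<or> y \<in> K \<longrightarrow> p \<in> K"
        using near[of x y y] xy \<delta>(1) by auto
      then show ?thesis
        using g[OF xyS xy(3)] D_eq[of x y p K K] xy K by (simp add: good_def)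
    qed
    \<comment> \<open>Increments of \<open>g\<close> are known only at distance below
      \<open>\<delta> / 4\<close>; subdividing the segment, which stays in the convex cell, reaches
      any two points of it.\<close>
    obtain N :: nat where N: "4 * dist a b / \<delta> < real N" using reals_Archimedean2 by blast
    then have N0: "N > 0" using \<delta>(1) by (cases N) (auto simp: zero_less_mult_iff divide_less_0_iff not_less)
    define P where "P i = a + (real i / N) *\<^sub>R (b - a)" for i
    have PK: "P i \<in> K" if "i \<le> N" for i
    proof -
      have "P i = (1 - real i / N) *\<^sub>R a + (real i / N) *\<^sub>R b" by (simp add: P_def algebra_simps)
      then show ?thesis using T(3)[OF K] ab that N0 by (auto simp: convex_alt)
    qed
    have step: "dist (P i) (P (Suc i)) < \<delta> / 4" for i
    proof -
      have "P i - P (Suc i) = (- 1 / N) *\<^sub>R (b - a)"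
        unfolding P_def by (simp add: algebra_simps add_divide_distrib)
      then have "dist (P i) (P (Suc i)) = dist a b / N"
        using N0 by (simp add: dist_norm norm_minus_commute)
      also have "\<dots> < \<delta> / 4" using N N0 \<delta>(1) by (simp add: field_simps)
      finally show ?thesis .
    qed
    have "g (P N) - g (P 0) = (\<Sum>i<N. g (P (Suc i)) - g (P i))"
      by (rule sum_lessThan_telescope[of "\<lambda>i. g (P i)", symmetric])
    also have "\<dots> = (\<Sum>i<N. h K (P (Suc i)) - h K (P i))"
      using PK step by (intro sum.cong local) auto
    also have "\<dots> = h K (P N) - h K (P 0)" by (rule sum_lessThan_telescope[of "\<lambda>i. h K (P i)"])
    finally show ?thesis using N0 by (simp add: P_def)
  qed
  then show ?thesis by blast
qed

section \<open>Planar linear algebra and nondegenerate triangles\<close>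

definition cross2 :: "pt \<Rightarrow> pt \<Rightarrow> real" where
  "cross2 u v = u $ 1 * v $ 2 - u $ 2 * v $ 1"

text \<open>The clockwise quarter turn, so that \<open>curl v x = rot (grad v x)\<close>, and so
  that \<open>rot (b - a)\<close> points outward along an edge traversed counterclockwise.\<close>

definition rot :: "pt \<Rightarrow> pt" where
  "rot u = vector [u $ 2, - u $ 1]"

definition tri :: "pt set \<Rightarrow> pt \<Rightarrow> pt \<Rightarrow> pt \<Rightarrow> bool" where
  "tri K a b c \<longleftrightarrow> K = convex hull {a, b, c} \<and> cross2 (b - a) (c - a) \<noteq> 0"

lemma pt_eq_iff: "(u :: pt) = v \<longleftrightarrow> u $ 1 = v $ 1 \<and> u $ 2 = v $ 2"
  by (simp add: vec_eq_iff forall_2)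

lemma inner_pt: "(u :: pt) \<bullet> v = u $ 1 * v $ 1 + u $ 2 * v $ 2"
  by (simp add: inner_vec_def sum_2)

lemma rot_nth [simp]: "rot u $ 1 = u $ 2" "rot u $ 2 = - u $ 1"
  by (simp_all add: rot_def)

lemma inner_rot_self [simp]: "rot u \<bullet> u = 0"
  by (simp add: inner_pt)

lemma norm_rot [simp]: "norm (rot u) = norm u"
  by (simp add: norm_eq_sqrt_inner inner_pt)

lemma inner_rot: "rot u \<bullet> v = - cross2 u v"
  by (simp add: inner_pt cross2_def)

text \<open>In the plane the orthogonal complement of a nonzero vector is the line of its quarter
  turn; the coefficient is the orthogonal projection onto that line.\<close>

lemma orthogonal_eq_rot:
  assumes "v \<bullet> u = 0" "u \<noteq> 0"
  shows "v = ((rot u \<bullet> v) / (norm u)\<^sup>2) *\<^sub>R rot u"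
proof -
  have n: "(norm u)\<^sup>2 = u $ 1 * u $ 1 + u $ 2 * u $ 2" "(norm u)\<^sup>2 \<noteq> 0"
    using assms(2) by (simp_all only: power2_norm_eq_inner inner_pt) (simp add: inner_pt[symmetric])
  have o: "v $ 1 * u $ 1 + v $ 2 * u $ 2 = 0" using assms(1) by (simp add: inner_pt)
  have "(norm u)\<^sup>2 * v $ 1 = (rot u \<bullet> v) * u $ 2" "(norm u)\<^sup>2 * v $ 2 = - (rot u \<bullet> v) * u $ 1"
    unfolding n(1) inner_pt rot_nth using o by algebra+
  then have "v $ 1 = (rot u \<bullet> v) * u $ 2 / (norm u)\<^sup>2" "v $ 2 = - (rot u \<bullet> v) * u $ 1 / (norm u)\<^sup>2"
    using n(2) by (simp_all only: nonzero_eq_divide_eq mult.commute not_False_eq_True)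
  then show ?thesis by (simp add: pt_eq_iff)
qed

lemma linear_orthogonal_frame:
  assumes "v \<bullet> u = 0" "v \<bullet> rot u = 0" "u \<noteq> 0"
  shows "v = 0"
  using orthogonal_eq_rot[OF assms(1,3)] assms(2) by (simp add: inner_commute)

text \<open>Cramer's rule in the plane.\<close>

lemma cross2_scale_expand:
  assumes "cross2 u v \<noteq> 0"
  shows "w = (cross2 w v / cross2 u v) *\<^sub>R u + (cross2 u w / cross2 u v) *\<^sub>R v"
proof -
  have "cross2 u v * w $ 1 = cross2 w v * u $ 1 + cross2 u w * v $ 1"
    "cross2 u v * w $ 2 = cross2 w v * u $ 2 + cross2 u w * v $ 2"
    unfolding cross2_def by algebra+
  then show ?thesis
    using assms by (simp add: pt_eq_iff nonzero_eq_divide_eq mult.commute add_divide_distrib[symmetric])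
qed

lemma triD:
  assumes "tri K a b c"
  shows "K = convex hull {a, b, c}" "cross2 (b - a) (c - a) \<noteq> 0" "a \<noteq> b" "a \<noteq> c" "b \<noteq> c"
    "\<not> affine_dependent {a, b, c}" "card {a, b, c} = 3" "convex K" "compact K" "closed K"
    "a \<in> K" "b \<in> K" "c \<in> K"
proof -
  show K: "K = convex hull {a, b, c}" and cr: "cross2 (b - a) (c - a) \<noteq> 0"
    using assms by (auto simp: tri_def)
  show ne: "a \<noteq> b" "a \<noteq> c" "b \<noteq> c" using cr by (auto simp: cross2_def)
  show "card {a, b, c} = 3" using ne by simp
  have "\<not> collinear {a, b, c}"
  proof
    assume "collinear {a, b, c}"
    then obtain u where "b = u *\<^sub>R a + (1 - u) *\<^sub>R c" using ne by (auto simp: collinear_3_expand)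
    then have "b - a = (1 - u) *\<^sub>R (c - a)" by (simp add: algebra_simps)
    then show False using cr by (simp add: cross2_def)
  qed
  then show "\<not> affine_dependent {a, b, c}" by (auto simp: collinear_3_eq_affine_dependent)
  show "convex K" "compact K" using K by (auto simp: finite_imp_compact_convex_hull)
  then show "closed K" by (simp add: compact_imp_closed)
  show "a \<in> K" "b \<in> K" "c \<in> K" unfolding K by (auto intro: hull_inc)
qed

lemma tri_rotate: "tri K a b c \<Longrightarrow> tri K b c a"
  and tri_swap: "tri K a b c \<Longrightarrow> tri K b a c"
  by (auto simp: tri_def insert_commute cross2_def algebra_simps)

lemma tri_iff_simplex: "2 simplex K \<longleftrightarrow> (\<exists>a b c. tri K a b c)"
proof
  assume "2 simplex K"
  then obtain C where C: "\<not> affine_dependent C" "int (card C) = 3" "K = convex hull C"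
    by (auto simp: simplex_def)
  then have "card C = 3" by simp
  then obtain a b c where abc: "C = {a, b, c}" "a \<noteq> b" "a \<noteq> c" "b \<noteq> c" by (auto simp: card_3_iff)
  then have nc: "\<not> collinear {a, b, c}" using C(1) collinear_3_eq_affine_dependent by auto
  have "cross2 (b - a) (c - a) \<noteq> 0"
  proof
    assume z: "cross2 (b - a) (c - a) = 0"
    have "(b - a) \<bullet> rot (c - a) = 0" using z inner_rot[of "c - a" "b - a"]
      by (simp add: cross2_def inner_commute algebra_simps)
    moreover have "rot (c - a) \<noteq> 0" using abc norm_rot[of "c - a"] by (metis eq_iff_diff_eq_0 norm_eq_zero)
    moreover have "rot (rot (c - a)) = - (c - a)" by (simp add: pt_eq_iff)
    ultimately obtain t where "b - a = t *\<^sub>R - (c - a)" using orthogonal_eq_rot by metis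
    then have "b = a + (- t) *\<^sub>R (c - a)" by (simp add: algebra_simps)
    then have "b = (1 - (- t)) *\<^sub>R a + (1 - (1 - (- t))) *\<^sub>R c" by (simp add: algebra_simps)
    then show False using nc unfolding collinear_3_expand by blast
  qed
  then show "\<exists>a b c. tri K a b c" using C(3) abc(1) by (auto simp: tri_def)
next
  assume "\<exists>a b c. tri K a b c"
  then obtain a b c where t: "tri K a b c" by auto
  show "2 simplex K" unfolding simplex_def
    using triD(1,6,7)[OF t] by (intro exI[of _ "{a, b, c}"]) auto
qed

lemma tri_interior:
  assumes "tri K a b c"
  shows "interior K = {x *\<^sub>R a + y *\<^sub>R b + z *\<^sub>R c | x y z. 0 < x \<and> 0 < y \<and> 0 < z \<and> x + y + z = 1}"
    (is "_ = ?R")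
proof -
  note t = triD[OF assms]
  have "interior K = {w. \<exists>u. (\<forall>x\<in>{a, b, c}. 0 < u x) \<and> sum u {a, b, c} = 1 \<and>
      (\<Sum>x\<in>{a, b, c}. u x *\<^sub>R x) = w}"
    unfolding t(1) interior_convex_hull_explicit_minimal[OF t(6)] using t(7) by simp
  also have "\<dots> = {w. \<exists>u. 0 < u a \<and> 0 < u b \<and> 0 < u c \<and> u a + u b + u c = 1 \<and>
      u a *\<^sub>R a + u b *\<^sub>R b + u c *\<^sub>R c = w}"
    using t(3-5) by (simp add: add.assoc)
  also have "\<dots> = ?R"
  proof (intro equalityI subsetI)
    fix w assume "w \<in> ?R"
    then obtain x y z where w: "w = x *\<^sub>R a + y *\<^sub>R b + z *\<^sub>R c" "0 < x" "0 < y" "0 < z" "x + y + z = 1"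
      by auto
    then show "w \<in> {w. \<exists>u. 0 < u a \<and> 0 < u b \<and> 0 < u c \<and> u a + u b + u c = 1 \<and>
        u a *\<^sub>R a + u b *\<^sub>R b + u c *\<^sub>R c = w}"
      using t(3-5) by (intro CollectI exI[of _ "\<lambda>p. if p = a then x else if p = b then y else z"]) auto
  qed blast
  finally show ?thesis .
qed

lemma tri_interior_nonempty:
  assumes "tri K a b c" shows "interior K \<noteq> {}"
proof -
  have "(1/3) *\<^sub>R a + (1/3) *\<^sub>R b + (1/3) *\<^sub>R c \<in> interior K"
    unfolding tri_interior[OF assms] by (intro CollectI exI[of _ "1/3"] exI conjI refl) auto
  then show ?thesis by blast
qed

lemma tri_aff_dim: "tri K a b c \<Longrightarrow> aff_dim K = 2"
  using aff_dim_simplex tri_iff_simplex by blast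

text \<open>Faces of a simplex are hulls of subsets of its vertices, and affine independence turns
  dimension one into cardinality two.\<close>

lemma tri_edge_iff:
  assumes "tri K a b c"
  shows "F edge_of K \<longleftrightarrow> F \<in> {closed_segment a b, closed_segment b c, closed_segment c a}"
proof -
  note t = triD[OF assms]
  have "F edge_of K \<longleftrightarrow> (\<exists>C. C \<subseteq> {a, b, c} \<and> F = convex hull C \<and> aff_dim F = 1)"
    unfolding edge_of_def t(1) face_of_convex_hull_affine_independent[OF t(6)] by auto
  also have "\<dots> \<longleftrightarrow> (\<exists>C. C \<subseteq> {a, b, c} \<and> F = convex hull C \<and> card C = 2)"
  proof -
    have "aff_dim (convex hull C) = 1 \<longleftrightarrow> card C = 2" if "C \<subseteq> {a, b, c}" for C
      using aff_dim_affine_independent[OF affine_independent_subset[OF t(6) that]]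
      unfolding aff_dim_convex_hull by linarith
    then show ?thesis by blast
  qed
  also have "\<dots> \<longleftrightarrow> (\<exists>C \<in> {{a, b}, {b, c}, {c, a}}. F = convex hull C)"
  proof -
    have "C \<subseteq> {a, b, c} \<and> card C = 2 \<longleftrightarrow> C \<in> {{a, b}, {b, c}, {c, a}}" for C
    proof
      assume C: "C \<subseteq> {a, b, c} \<and> card C = 2"
      then obtain p q where "C = {p, q}" "p \<noteq> q" by (auto simp: card_2_iff)
      with C show "C \<in> {{a, b}, {b, c}, {c, a}}" by auto
    qed (use t(3-5) in \<open>auto simp: card_insert_if\<close>)
    then show ?thesis by blast
  qed
  finally show ?thesis by (simp add: segment_convex_hull)
qed

lemma edge_tri:
  assumes "tri K a' b' c'" "F edge_of K"
  obtains a b c where "tri K a b c" "F = closed_segment a b"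
proof -
  have "F = closed_segment a' b' \<or> F = closed_segment b' c' \<or> F = closed_segment c' a'"
    using tri_edge_iff assms by blast
  then show ?thesis using that assms(1) tri_rotate by blast
qed

lemma tri_extreme_point: "tri K a b c \<Longrightarrow> x extreme_point_of K \<longleftrightarrow> x \<in> {a, b, c}"
  using extreme_point_of_convex_hull_affine_independent triD(1,6) by metis

lemma sum_tri_edges:
  assumes "tri K a b c"
  shows "(\<Sum>F | F edge_of K. f F) = f (closed_segment a b) + f (closed_segment b c) + f (closed_segment c a)"
proof -
  have "{F. F edge_of K} = {closed_segment a b, closed_segment b c, closed_segment c a}"
    using tri_edge_iff[OF assms] by blast
  then show ?thesis using triD(3-5)[OF assms] by (simp add: doubleton_eq_iff add.assoc)
qed

section \<open>Geometry of the mesh\<close>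

text \<open>Testing the inequality with the two end points makes \<open>n\<close> orthogonal to the
  edge, hence a multiple of \<open>rot (b - a)\<close>; unit length fixes the size of the factor and
  the point \<open>c\<close> off the line fixes its sign.\<close>

lemma outward_normal_unique:
  assumes ab: "a \<noteq> b" and c: "c \<in> S" "cross2 (b - a) (c - a) \<noteq> 0" and S: "a \<in> S" "b \<in> S"
    and n: "norm n = 1" "\<And>x y. x \<in> closed_segment a b \<Longrightarrow> y \<in> S \<Longrightarrow> n \<bullet> (y - x) \<le> 0"
  shows "n = (sgn (cross2 (b - a) (c - a)) / dist a b) *\<^sub>R rot (b - a)"
proof -
  have "n \<bullet> (b - a) \<le> 0" "n \<bullet> (a - b) \<le> 0" using n(2) S by auto
  then have "n \<bullet> (b - a) = 0" by (simp add: inner_diff_right)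
  moreover have ba: "b - a \<noteq> 0" using ab by simp
  ultimately obtain k where k: "n = k *\<^sub>R rot (b - a)" using orthogonal_eq_rot by metis
  have d: "dist a b > 0" "norm (b - a) = dist a b" using ab by (auto simp: dist_norm norm_minus_commute)
  have kd: "\<bar>k\<bar> * dist a b = 1" using n(1) k d by simp
  have "k * - cross2 (b - a) (c - a) \<le> 0" using n(2)[of a c] c k by (simp add: inner_rot)
  then have "k * cross2 (b - a) (c - a) \<ge> 0" by simp
  moreover have "k \<noteq> 0" using kd by auto
  ultimately have "sgn (cross2 (b - a) (c - a)) = sgn k"
    using c(2) by (auto simp: sgn_if zero_le_mult_iff)
  moreover have "k = sgn k * (1 / dist a b)" using kd d
    by (metis abs_mult_sgn mult.commute nonzero_eq_divide_eq less_irrefl)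
  ultimately show ?thesis using k by (metis times_divide_eq_right mult_1_right)
qed

text \<open>The sign factor makes the formula independent of the orientation of the labels:
  exchanging \<open>a\<close> and \<open>b\<close> flips both the sign and the rotated edge.\<close>

lemma outward_normal_tri:
  assumes t: "tri K a b c"
  shows "outward_normal K (closed_segment a b) = (sgn (cross2 (b - a) (c - a)) / dist a b) *\<^sub>R rot (b - a)"
proof -
  note tD = triD[OF t]
  let ?s = "cross2 (b - a) (c - a)"
  let ?n = "(sgn ?s / dist a b) *\<^sub>R rot (b - a)"
  have d: "dist a b > 0" "norm (b - a) = dist a b" using tD by (auto simp: dist_norm norm_minus_commute)
  have "?n \<bullet> (y - x) \<le> 0" if x: "x \<in> closed_segment a b" and y: "y \<in> K" for x y
  proof -
    obtain u where u: "x = (1 - u) *\<^sub>R a + u *\<^sub>R b" using x by (auto simp: in_segment)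
    obtain p q r where pqr: "0 \<le> p" "0 \<le> q" "0 \<le> r" "p + q + r = 1" "y = p *\<^sub>R a + q *\<^sub>R b + r *\<^sub>R c"
      using y unfolding tD(1) convex_hull_3 by blast
    have p: "p = 1 - q - r" using pqr by simp
    have "y - x = (q - u) *\<^sub>R (b - a) + r *\<^sub>R (c - a)" unfolding u pqr(5) p by (simp add: algebra_simps)
    then have "?n \<bullet> (y - x) = sgn ?s / dist a b * (r * (rot (b - a) \<bullet> (c - a)))"
      by (simp add: inner_add_right)
    also have "\<dots> = - (\<bar>?s\<bar> / dist a b * r)" unfolding inner_rot by (simp add: abs_sgn mult.commute)
    finally show ?thesis using pqr(3) d by simp
  qed
  moreover have "norm ?n = 1" using d tD(2) by (simp add: abs_sgn_eq)
  ultimately show ?thesis unfolding outward_normal_def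
    using outward_normal_unique[OF tD(3,13,2,11,12)] by (intro the_equality) blast+
qed

lemma outward_normal_tri_props:
  assumes t: "tri K a b c"
  shows "norm (outward_normal K (closed_segment a b)) = 1"
    "outward_normal K (closed_segment a b) \<bullet> (b - a) = 0"
proof -
  have "dist a b > 0" "norm (b - a) = dist a b"
    using triD[OF t] by (auto simp: dist_norm norm_minus_commute)
  then show "norm (outward_normal K (closed_segment a b)) = 1"
    "outward_normal K (closed_segment a b) \<bullet> (b - a) = 0"
    using triD(2)[OF t] by (simp_all add: outward_normal_tri[OF t] abs_sgn_eq)
qed

locale domain_mesh =
  fixes \<Omega> :: "pt set" and T :: "pt set set"
  assumes polygon: "convex_polygon \<Omega>" and mesh: "mesh \<Omega> T"
begin

lemma domain: "open \<Omega>" "convex \<Omega>" "bounded \<Omega>" "\<Omega> \<noteq> {}"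
  using polygon by (auto simp: convex_polygon_def)

lemma finite_mesh: "finite T"
  using mesh by (auto simp: mesh_def triangulation_def)

lemma Union_mesh: "\<Union>T = closure \<Omega>"
  using mesh by (auto simp: mesh_def)

lemma mesh_tri: assumes "K \<in> T" obtains a b c where "tri K a b c"
  using mesh assms tri_iff_simplex by (auto simp: mesh_def)

lemma mesh_edge: assumes "K \<in> T" "F edge_of K" obtains a b c where "tri K a b c" "F = closed_segment a b"
  using mesh_tri[OF assms(1)] edge_tri[OF _ assms(2)] by metis

lemma mesh_Int_face: "K \<in> T \<Longrightarrow> K' \<in> T \<Longrightarrow> K \<inter> K' face_of K"
  using mesh by (auto simp: mesh_def triangulation_def)

lemma mesh_aff_dim: "K \<in> T \<Longrightarrow> aff_dim K = 2"
  using mesh_tri tri_aff_dim by metis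

lemma mesh_closed: "K \<in> T \<Longrightarrow> closed K" and mesh_convex: "K \<in> T \<Longrightarrow> convex K"
  and mesh_compact: "K \<in> T \<Longrightarrow> compact K" and mesh_interior_nonempty: "K \<in> T \<Longrightarrow> interior K \<noteq> {}"
  using mesh_tri triD tri_interior_nonempty by metis+

lemma mesh_closure_interior: "K \<in> T \<Longrightarrow> closure (interior K) = K"
  using convex_closure_interior[of K] mesh_convex mesh_interior_nonempty mesh_closed by simp

lemma mesh_subset: "K \<in> T \<Longrightarrow> K \<subseteq> closure \<Omega>"
  using Union_mesh by blast

lemma mesh_interior_subset: "K \<in> T \<Longrightarrow> interior K \<subseteq> \<Omega>"
  using mesh_subset[of K] interior_mono[of K "closure \<Omega>"] convex_interior_closure[OF domain(2)]
    interior_open[OF domain(1)] by simp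

text \<open>A proper face has smaller dimension, but all elements have dimension two.\<close>

lemma mesh_Int_eq:
  assumes K: "K \<in> T" "K' \<in> T" and sub: "K \<inter> K' = K \<or> K \<inter> K' = K'"
  shows "K = K'"
proof -
  have "L = M" if "L \<in> T" "M \<in> T" "L \<inter> M = L" for L M
    using face_of_aff_dim_lt[OF mesh_convex[OF that(2)], of L] mesh_Int_face[OF that(2,1)] that mesh_aff_dim
    by (force simp: Int_commute)
  then show ?thesis using K sub by (metis Int_commute)
qed

text \<open>The intersection is a face of \<open>K'\<close>, and a face that meets the relative
  interior contains everything.\<close>

lemma mesh_interior_disjoint:
  assumes K: "K \<in> T" "K' \<in> T" and x: "x \<in> K" "x \<in> interior K'"
  shows "K = K'"
proof -
  have "rel_interior K' = interior K'"
    using mesh_aff_dim[OF K(2)] by (simp add: interior_rel_interior)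
  then have "K' \<subseteq> K \<inter> K'"
    using subset_of_face_of[OF mesh_Int_face[OF K(2,1)], of K'] x interior_subset[of K'] by auto
  then show ?thesis using mesh_Int_eq[OF K] by blast
qed

text \<open>If the third vertices lay on the same side of the shared edge, a point slightly off the
  midpoint of the edge towards \<open>c\<close> would belong to \<open>K\<close> and to the interior
  of \<open>K'\<close>.\<close>

lemma mesh_opposite:
  assumes K: "K \<in> T" "K' \<in> T" "K \<noteq> K'" and t: "tri K a b c" "tri K' a b c'"
  shows "sgn (cross2 (b - a) (c' - a)) = - sgn (cross2 (b - a) (c - a))"
proof (rule ccontr)
  let ?s = "cross2 (b - a) (c - a)" and ?s' = "cross2 (b - a) (c' - a)"
  note n0 = triD(2)[OF t(1)] triD(2)[OF t(2)]
  assume "sgn ?s' \<noteq> - sgn ?s"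
  then have pos: "?s / ?s' > 0" using n0 by (auto simp: sgn_if zero_less_divide_iff split: if_splits)
  define \<gamma> where "\<gamma> = ?s / ?s'"
  define \<beta> where "\<beta> = cross2 (c - a) (c' - a) / ?s'"
  have "c - a = \<beta> *\<^sub>R (b - a) + \<gamma> *\<^sub>R (c' - a)"
    unfolding \<beta>_def \<gamma>_def by (rule cross2_scale_expand[OF n0(2)])
  then have c: "c = (1 - \<beta> - \<gamma>) *\<^sub>R a + \<beta> *\<^sub>R b + \<gamma> *\<^sub>R c'"
    by (simp add: algebra_simps)
  define \<alpha> where "\<alpha> = 1 - \<beta> - \<gamma>"
  \<comment> \<open>The barycentric coordinates of \<open>c\<close> with respect to
    \<open>K'\<close> are \<open>\<alpha>\<close>, \<open>\<beta>\<close> and the positive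
    \<open>\<gamma>\<close>. The step \<open>s\<close> is small enough for
    \<open>(1 - s) / 2\<close> to outweigh negative values of \<open>s * \<alpha>\<close> and
    \<open>s * \<beta>\<close>.\<close>
  define s where "s = 1 / (2 + 2 * \<bar>\<alpha>\<bar> + 2 * \<bar>\<beta>\<bar>)"
  have s: "0 < s" "s * (2 + 2 * \<bar>\<alpha>\<bar> + 2 * \<bar>\<beta>\<bar>) = 1" "s < 1"
    by (auto simp: s_def)
  have sa: "s * \<bar>\<alpha>\<bar> \<ge> 0" "s * \<bar>\<beta>\<bar> \<ge> 0" "- (s * \<bar>\<alpha>\<bar>) \<le> s * \<alpha>" "- (s * \<bar>\<beta>\<bar>) \<le> s * \<beta>"
    using s(1) by (auto simp: abs_if)
  have s1: "2 * s + 2 * (s * \<bar>\<alpha>\<bar>) + 2 * (s * \<bar>\<beta>\<bar>) = 1" using s(2) by (simp add: algebra_simps)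
  let ?m = "((1 - s) / 2) *\<^sub>R a + ((1 - s) / 2) *\<^sub>R b + s *\<^sub>R c"
  have "?m \<in> K" unfolding triD(1)[OF t(1)] convex_hull_3 using s
    by (intro CollectI exI[of _ "(1 - s) / 2"] exI[of _ s] conjI refl) auto
  moreover have "?m = ((1 - s) / 2 + s * \<alpha>) *\<^sub>R a + ((1 - s) / 2 + s * \<beta>) *\<^sub>R b + (s * \<gamma>) *\<^sub>R c'"
    unfolding c \<alpha>_def by (simp add: algebra_simps)
  moreover have "\<dots> \<in> interior K'" unfolding tri_interior[OF t(2)]
  proof (intro CollectI exI conjI)
    show "0 < (1 - s) / 2 + s * \<alpha>" using s1 sa s(1) by argo
    show "0 < (1 - s) / 2 + s * \<beta>" using s1 sa s(1) by argo
    show "0 < s * \<gamma>" using s(1) pos unfolding \<gamma>_def by (rule mult_pos_pos)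
    show "(1 - s) / 2 + s * \<alpha> + ((1 - s) / 2 + s * \<beta>) + s * \<gamma> = 1"
      unfolding \<alpha>_def by (simp add: algebra_simps add_divide_distrib diff_divide_distrib)
  qed simp
  ultimately show False using mesh_interior_disjoint[OF K(1,2)] K(3) by metis
qed

text \<open>The common face of two different elements has dimension below two, and two distinct
  points force dimension at least one.\<close>

lemma mesh_shared_edge:
  assumes K: "K \<in> T" "K' \<in> T" "K \<noteq> K'" and xy: "x \<in> K \<inter> K'" "y \<in> K \<inter> K'" "x \<noteq> y"
  shows "K \<inter> K' edge_of K" "K \<inter> K' edge_of K'"
proof -
  have f: "K \<inter> K' face_of K" "K \<inter> K' face_of K'"
    using mesh_Int_face[OF K(1,2)] mesh_Int_face[OF K(2,1)] by (auto simp: Int_commute)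
  have "aff_dim (K \<inter> K') < 2"
    using face_of_aff_dim_lt[OF mesh_convex[OF K(1)] f(1)] mesh_Int_eq[OF K(1,2)] K(3) mesh_aff_dim[OF K(1)]
    by auto
  moreover have "aff_dim {x, y} \<le> aff_dim (K \<inter> K')" using xy by (intro aff_dim_subset) auto
  ultimately have "aff_dim (K \<inter> K') = 1" using xy(3) by (simp add: aff_dim_2)
  then show "K \<inter> K' edge_of K" "K \<inter> K' edge_of K'" using f by (auto simp: edge_of_def)
qed

text \<open>Both \<open>F\<close> and the intersection have dimension one, so \<open>F\<close>
  cannot be a proper face of the intersection.\<close>

lemma mesh_edge_Int:
  assumes K: "K \<in> T" "K' \<in> T" "K \<noteq> K'" and F: "F edge_of K" "F \<subseteq> K'"
  shows "F = K \<inter> K'" "F edge_of K'"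
proof -
  obtain a b c where abc: "tri K a b c" "F = closed_segment a b" using mesh_edge[OF K(1) F(1)] .
  have sub: "F \<subseteq> K \<inter> K'" using F by (auto simp: edge_of_def dest: face_of_imp_subset)
  have e: "K \<inter> K' edge_of K" "K \<inter> K' edge_of K'"
    using mesh_shared_edge[OF K, of a b] sub abc triD(3)[OF abc(1)] by auto
  have "F face_of (K \<inter> K')" using F(1) sub by (auto simp: edge_of_def intro: face_of_subset)
  then show "F = K \<inter> K'"
    using face_of_aff_dim_lt[of "K \<inter> K'" F] e F(1) mesh_convex[OF K(1)] mesh_convex[OF K(2)]
    by (auto simp: edge_of_def convex_Int)
  then show "F edge_of K'" using e by simp
qed

text \<open>A segment determines its end points up to order, and labels may be swapped; a shared
  edge can thus be named in the same direction from both sides, as \<open>mesh_opposite\<close>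
  requires.\<close>

lemma closed_segment_tri:
  assumes K': "K' \<in> T" and ab: "a \<noteq> b" "closed_segment a b edge_of K'"
  obtains c' where "tri K' a b c'"
proof -
  obtain p q r where t: "tri K' p q r" "closed_segment a b = closed_segment p q"
    using mesh_edge[OF K' ab(2)] .
  then have "a = p \<and> b = q \<or> a = q \<and> b = p" by (auto simp: doubleton_eq_iff)
  then show ?thesis using that t(1) tri_swap by blast
qed

lemma outward_normal_opposite:
  assumes K: "K \<in> T" "K' \<in> T" "K \<noteq> K'" and F: "F edge_of K" "F edge_of K'"
  shows "outward_normal K' F = - outward_normal K F"
proof -
  obtain a b c where t: "tri K a b c" "F = closed_segment a b" using mesh_edge[OF K(1) F(1)] .
  then obtain c' where t': "tri K' a b c'" using closed_segment_tri[OF K(2)] F(2) triD(3) by metis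
  show ?thesis unfolding t(2) outward_normal_tri[OF t(1)] outward_normal_tri[OF t'] mesh_opposite[OF K t(1) t']
    by simp
qed

text \<open>Normals of different elements on a shared edge are opposite; three pairwise opposite
  vectors all vanish, which a unit vector cannot.\<close>

lemma at_most_two_elements:
  assumes K: "K \<in> T" "K' \<in> T" "K'' \<in> T" and F: "F edge_of K" "F edge_of K'" "F edge_of K''"
  shows "K = K' \<or> K = K'' \<or> K' = K''"
proof (rule ccontr)
  assume "\<not> ?thesis"
  then have ne: "K \<noteq> K'" "K \<noteq> K''" "K' \<noteq> K''" by blast+
  have "outward_normal K F = - outward_normal K F"
    using outward_normal_opposite[OF K(1,2) ne(1) F(1,2)] outward_normal_opposite[OF K(1,3) ne(2) F(1,3)]
      outward_normal_opposite[OF K(2,3) ne(3) F(2,3)] by simp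
  then have "outward_normal K F = 0" unfolding pt_eq_iff by simp
  then show False using outward_normal_tri_props(1) mesh_edge[OF K(1) F(1)] by (metis norm_zero zero_neq_one)
qed

text \<open>A supporting line at a relative interior point of a segment contains the segment.\<close>

lemma segment_in_frontier:
  assumes x: "x \<in> frontier \<Omega>" "x \<in> rel_interior F" and F: "F \<subseteq> closure \<Omega>"
  shows "F \<subseteq> frontier \<Omega>"
proof -
  have ri: "rel_interior (closure \<Omega>) = \<Omega>"
    using domain by (simp add: convex_rel_interior_closure rel_interior_open)
  have fr: "frontier \<Omega> = closure \<Omega> - \<Omega>" using domain(1) by (simp add: frontier_def interior_open)
  have "x \<in> closure \<Omega>" "x \<notin> rel_interior (closure \<Omega>)" using x(1) unfolding ri fr by auto
  then obtain v where v: "\<And>y. y \<in> closure \<Omega> \<Longrightarrow> v \<bullet> x \<le> v \<bullet> y" "\<And>y. y \<in> \<Omega> \<Longrightarrow> v \<bullet> x < v \<bullet> y"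
    using supporting_hyperplane_rel_boundary[of "closure \<Omega>" x] domain(2) ri by (metis convex_closure)
  have "(closure \<Omega> \<inter> {y. v \<bullet> y = v \<bullet> x}) face_of closure \<Omega>"
    using v(1) domain(2) by (intro face_of_Int_supporting_hyperplane_ge) auto
  then have "F \<subseteq> closure \<Omega> \<inter> {y. v \<bullet> y = v \<bullet> x}"
  proof (rule subset_of_face_of[OF _ F])
    have "x \<in> closure \<Omega>" using x(1) unfolding fr by simp
    then show "closure \<Omega> \<inter> {y. v \<bullet> y = v \<bullet> x} \<inter> rel_interior F \<noteq> {}" using x(2) by blast
  qed
  moreover have "y \<notin> \<Omega>" if "v \<bullet> y = v \<bullet> x" for y using v(2)[of y] that by auto
  ultimately show ?thesis unfolding fr by blast
qed

text \<open>Points approaching the midpoint of the edge from outside \<open>K\<close> still lie in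
  the domain, so by finiteness one closed element contains infinitely many of them and the midpoint.
  Its intersection with \<open>K\<close>, a face meeting the relative interior of the edge, then
  contains the whole edge.\<close>

lemma interior_edge_neighbour:
  assumes K: "K \<in> T" and F: "F edge_of K" "\<not> F \<subseteq> frontier \<Omega>"
  obtains K' where "K' \<in> T" "K' \<noteq> K" "F edge_of K'"
proof -
  obtain a b c where t: "tri K a b c" "F = closed_segment a b" using mesh_edge[OF K F(1)] .
  note tD = triD[OF t(1)]
  have FK: "F \<subseteq> K" using F(1) by (simp add: edge_of_imp_subset)
  define m where "m = midpoint a b"
  have mF: "m \<in> rel_interior F" using tD(3) unfolding t(2) m_def by (simp add: rel_interior_closed_segment)
  then have "m \<in> closure \<Omega>" using FK mesh_subset[OF K] rel_interior_subset[of F] by blast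
  moreover have "m \<notin> frontier \<Omega>" using segment_in_frontier mF F(2) FK mesh_subset[OF K] by blast
  ultimately have "m \<in> \<Omega>" using domain(1) by (simp add: frontier_def interior_open)
  \<comment> \<open>Steps from the midpoint away from the opposite vertex, hence to the far side of
    the edge.\<close>
  define q where "q n = m - (1 / Suc n) *\<^sub>R (c - m)" for n
  have qlim: "q \<longlonglongrightarrow> m"
  proof -
    have "(\<lambda>n. m - (1 / Suc n) *\<^sub>R (c - m)) \<longlonglongrightarrow> m - 0 *\<^sub>R (c - m)"
      by (intro tendsto_intros LIMSEQ_Suc[OF lim_1_over_n])
    then show ?thesis by (simp add: q_def[abs_def])
  qed
  have "eventually (\<lambda>n. q n \<in> \<Omega>) sequentially"
    using qlim domain(1) \<open>m \<in> \<Omega>\<close> by (rule topological_tendstoD)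
  then obtain N where N: "\<And>n. n \<ge> N \<Longrightarrow> q n \<in> \<Omega>" by (auto simp: eventually_sequentially)
  define r where "r n = (SOME K'. K' \<in> T \<and> q (n + N) \<in> K')" for n
  have r: "r n \<in> T" "q (n + N) \<in> r n" for n
  proof -
    have "q (n + N) \<in> \<Union>T" using N[of "n + N"] closure_subset Union_mesh by force
    then show "r n \<in> T" "q (n + N) \<in> r n"
      using someI_ex[of "\<lambda>K'. K' \<in> T \<and> q (n + N) \<in> K'"] by (auto simp: r_def)
  qed
  have "finite (range r)" using finite_mesh r(1) by (meson finite_subset image_subsetI)
  then obtain n0 where n0: "infinite {n. r n = r n0}"
    using pigeonhole_infinite[of UNIV r] by auto
  define K' where "K' = r n0"
  have K': "K' \<in> T" using r by (simp add: K'_def)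
  have "m \<in> K'"
  proof -
    let ?e = "enumerate {n. r n = r n0}"
    have sm: "strict_mono ?e" using n0 by (rule strict_mono_enumerate)
    have "(\<lambda>i. q (i + N)) \<longlonglongrightarrow> m" using qlim by (rule LIMSEQ_ignore_initial_segment)
    then have "((\<lambda>i. q (i + N)) \<circ> ?e) \<longlonglongrightarrow> m" using sm by (rule LIMSEQ_subseq_LIMSEQ)
    moreover have "((\<lambda>i. q (i + N)) \<circ> ?e) i \<in> K'" for i
      using r(2)[of "?e i"] enumerate_in_set[OF n0, of i] by (simp add: K'_def)
    ultimately show ?thesis using closed_sequentially[OF mesh_closed[OF K']] by blast
  qed
  moreover have "K' \<noteq> K"
  proof
    assume "K' = K"
    then have "q (n0 + N) \<in> K" using r(2)[of n0] by (simp add: K'_def)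
    then obtain x y z where xyz: "0 \<le> z" "x + y + z = 1" "q (n0 + N) = x *\<^sub>R a + y *\<^sub>R b + z *\<^sub>R c"
      unfolding tD(1) convex_hull_3 by blast
    define w where "w = 1 / real (Suc (n0 + N))"
    have w: "w > 0" by (simp add: w_def)
    have x: "x = 1 - y - z" using xyz(2) by simp
    \<comment> \<open>The cross product with the edge reads off the barycentric coordinate of
      \<open>c\<close>: nonnegative on \<open>K\<close>, but \<open>- w\<close> at the sampled
      point.\<close>
    have "cross2 (b - a) (q (n0 + N) - a) = z * cross2 (b - a) (c - a)"
      unfolding xyz(3) x cross2_def by (simp add: algebra_simps)
    moreover have "cross2 (b - a) (q (n0 + N) - a) = - w * cross2 (b - a) (c - a)"
      unfolding q_def w_def[symmetric] m_def midpoint_def cross2_def by (simp add: field_simps)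
    ultimately have "z = - w" using tD(2) by (metis mult_right_cancel)
    then show False using w xyz(1) by simp
  qed
  moreover have "F \<subseteq> K'"
  proof -
    have "F \<subseteq> K \<inter> K'"
      using mF subset_of_face_of[OF mesh_Int_face[OF K K'], of F] FK rel_interior_subset[of F] \<open>m \<in> K'\<close>
      by blast
    then show ?thesis by blast
  qed
  ultimately show ?thesis using that mesh_edge_Int(2)[OF K K' _ F(1)] K' by metis
qed

text \<open>The defining inequality passes from the domain to its closure and so to
  \<open>K\<close>, which gives uniqueness. Existence, needed because the normal is a definite
  description, comes from a supporting line at the midpoint of the edge.\<close>

lemma boundary_normal:
  assumes K: "K \<in> T" and F: "F edge_of K" "F \<subseteq> frontier \<Omega>"
  shows "outward_normal \<Omega> F = outward_normal K F"
proof -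
  obtain a b c where t: "tri K a b c" "F = closed_segment a b" using mesh_edge[OF K F(1)] .
  note tD = triD[OF t(1)]
  have uniq: "n = outward_normal K F"
    if n: "norm n = 1" "\<forall>x\<in>F. \<forall>y\<in>\<Omega>. n \<bullet> (y - x) \<le> 0" for n
  proof -
    have "n \<bullet> (y - x) \<le> 0" if x: "x \<in> F" and y: "y \<in> K" for x y
    proof -
      have "closure \<Omega> \<subseteq> {y. n \<bullet> (y - x) \<le> 0}"
        using n(2) x by (intro closure_minimal closed_Collect_le continuous_intros) auto
      then show ?thesis using y mesh_subset[OF K] by blast
    qed
    then show ?thesis
      using outward_normal_unique[OF tD(3,13,2,11,12) n(1)] t outward_normal_tri[OF t(1)] by auto
  qed
  define m where "m = midpoint a b"
  have mF: "m \<in> F" "m \<in> frontier \<Omega>" using F(2) t(2) by (auto simp: m_def)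
  have ri: "rel_interior (closure \<Omega>) = \<Omega>"
    using domain by (simp add: convex_rel_interior_closure rel_interior_open)
  have "m \<in> closure \<Omega>" "m \<notin> rel_interior (closure \<Omega>)"
    using mF(2) domain(1) unfolding ri frontier_def by (auto simp: interior_open)
  then obtain v where v: "v \<noteq> 0" "\<And>y. y \<in> closure \<Omega> \<Longrightarrow> v \<bullet> m \<le> v \<bullet> y"
    using supporting_hyperplane_rel_boundary[of "closure \<Omega>" m] domain(2) by (metis convex_closure)
  have cl: "a \<in> closure \<Omega>" "b \<in> closure \<Omega>" using tD mesh_subset[OF K] by auto
  have m: "v \<bullet> m = (v \<bullet> a + v \<bullet> b) / 2" by (simp add: m_def midpoint_def inner_add_right)
  \<comment> \<open>The value at the midpoint is the mean of two values that are both at least as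
    large, so all three agree and the supporting line contains the edge.\<close>
  have vab: "v \<bullet> a = v \<bullet> m" "v \<bullet> b = v \<bullet> m" using v(2)[OF cl(1)] v(2)[OF cl(2)] m by auto
  define n where "n = (- 1 / norm v) *\<^sub>R v"
  have "norm n = 1" using v(1) by (simp add: n_def)
  moreover have "n \<bullet> (y - x) \<le> 0" if x: "x \<in> F" and y: "y \<in> \<Omega>" for x y
  proof -
    obtain u where "x = (1 - u) *\<^sub>R a + u *\<^sub>R b" using x t(2) by (auto simp: in_segment)
    then have "v \<bullet> x = (1 - u) * (v \<bullet> a) + u * (v \<bullet> b)" by (simp add: inner_add_right)
    then have "v \<bullet> x = v \<bullet> m" unfolding vab by (simp add: algebra_simps)
    then have "v \<bullet> (y - x) \<ge> 0" using v(2)[of y] y closure_subset by (force simp: inner_diff_right)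
    then show ?thesis by (simp add: n_def zero_le_divide_iff)
  qed
  ultimately have n: "norm n = 1 \<and> (\<forall>x\<in>F. \<forall>y\<in>\<Omega>. n \<bullet> (y - x) \<le> 0)" by blast
  have "outward_normal \<Omega> F = n" unfolding outward_normal_def
  proof (rule the_equality)
    show "norm n = 1 \<and> (\<forall>x\<in>F. \<forall>y\<in>\<Omega>. n \<bullet> (y - x) \<le> 0)" by (rule n)
    fix n' assume "norm n' = 1 \<and> (\<forall>x\<in>F. \<forall>y\<in>\<Omega>. n' \<bullet> (y - x) \<le> 0)"
    then show "n' = n" using uniq[of n'] uniq[of n] n by simp
  qed
  then show ?thesis using uniq[of n] n by simp
qed

text \<open>Two elements at a boundary edge would have opposite normals, yet both equal the normal
  of the domain. This makes the definite description in \<open>element_at\<close>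
  meaningful.\<close>

lemma boundary_element_unique:
  assumes "K \<in> T" "K' \<in> T" "F edge_of K" "F edge_of K'" "F \<subseteq> frontier \<Omega>"
  shows "K = K'"
proof (rule ccontr)
  assume "K \<noteq> K'"
  then have "outward_normal K F = - outward_normal K F"
    using outward_normal_opposite[of K K' F] boundary_normal assms by metis
  then have "outward_normal K F = 0" unfolding pt_eq_iff by simp
  then show False using outward_normal_tri_props(1) mesh_edge[OF assms(1,3)]
    by (metis norm_zero zero_neq_one)
qed

lemma element_at_eq: "K \<in> T \<Longrightarrow> F edge_of K \<Longrightarrow> F \<subseteq> frontier \<Omega> \<Longrightarrow> element_at T F = K"
  unfolding element_at_def using boundary_element_unique by (intro the_equality) blast+

lemma boundary_edgeE:
  assumes "F \<in> boundary_edges \<Omega> T"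
  obtains K a b c where "K \<in> T" "F edge_of K" "F \<subseteq> frontier \<Omega>" "element_at T F = K"
    "outward_normal \<Omega> F = outward_normal K F" "tri K a b c" "F = closed_segment a b"
proof -
  obtain K where K: "K \<in> T" "F edge_of K" "F \<subseteq> frontier \<Omega>"
    using assms by (auto simp: boundary_edges_def)
  obtain a b c where "tri K a b c" "F = closed_segment a b" using mesh_edge[OF K(1,2)] .
  then show ?thesis using that K element_at_eq boundary_normal by blast
qed

end

section \<open>Elementwise calculus\<close>

definition qp :: "real \<Rightarrow> real \<Rightarrow> real \<Rightarrow> real \<Rightarrow> real \<Rightarrow> real \<Rightarrow> pt \<Rightarrow> real" where
  "qp a b c d e f x = a + b * x $ 1 + c * x $ 2 + d * (x $ 1)\<^sup>2 + e * x $ 1 * x $ 2 + f * (x $ 2)\<^sup>2"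

text \<open>The codomain is kept general so that one form serves affine functions and affine fields,
  in particular the gradients and curls of \<open>qp\<close>.\<close>

definition aff :: "'b::real_normed_vector \<Rightarrow> 'b \<Rightarrow> 'b \<Rightarrow> pt \<Rightarrow> 'b" where
  "aff p q r x = p + x $ 1 *\<^sub>R q + x $ 2 *\<^sub>R r"

lemma has_derivative_nth: "((\<lambda>x::pt. x $ i) has_derivative (\<lambda>h. h $ i)) (at x within S)"
  by (rule bounded_linear.has_derivative[OF bounded_linear_vec_nth has_derivative_ident])

lemma qp_has_derivative:
  "(qp a b c d e f has_derivative
     (\<lambda>h. h $ 1 * (b + 2 * d * x $ 1 + e * x $ 2) + h $ 2 * (c + e * x $ 1 + 2 * f * x $ 2))) (at x)"
  unfolding qp_def[abs_def]
  by (auto intro!: derivative_eq_intros has_derivative_nth ext simp: algebra_simps)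

lemma aff_has_derivative: "(aff p q r has_derivative (\<lambda>h. h $ 1 *\<^sub>R q + h $ 2 *\<^sub>R r)) (at x)"
  unfolding aff_def[abs_def]
  by (auto intro!: derivative_eq_intros has_derivative_nth ext simp: algebra_simps)

lemma continuous_on_qp [continuous_intros]: "continuous_on S (qp a b c d e f)"
  using qp_has_derivative by (meson continuous_at_imp_continuous_on has_derivative_continuous)

lemma continuous_on_aff [continuous_intros]: "continuous_on S (aff p q r)"
  using aff_has_derivative by (meson continuous_at_imp_continuous_on has_derivative_continuous)

lemma aff_comb: "r *\<^sub>R aff p q w x + s *\<^sub>R aff p' q' w' x =
    aff (r *\<^sub>R p + s *\<^sub>R p') (r *\<^sub>R q + s *\<^sub>R q') (r *\<^sub>R w + s *\<^sub>R w') x"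
  by (simp add: aff_def algebra_simps)

lemma aff_nth: "aff p q r x $ i = aff (p $ i) (q $ i) (r $ i) x"
  for p q r :: "real^2"
  by (simp add: aff_def)

lemma aff_inner: "aff p q r x \<bullet> t = aff (p \<bullet> t) (q \<bullet> t) (r \<bullet> t) x"
  for p q r :: "real^2"
  by (simp add: aff_def inner_add_left)

lemma has_derivative_cong_open:
  assumes "open U" "x \<in> U" "\<And>y. y \<in> U \<Longrightarrow> v y = w y"
  shows "(v has_derivative f') (at x) \<longleftrightarrow> (w has_derivative f') (at x)"
proof
  show "(w has_derivative f') (at x)" if "(v has_derivative f') (at x)"
    by (rule has_derivative_transform_within_open[OF that assms])
  show "(v has_derivative f') (at x)" if "(w has_derivative f') (at x)"
    by (rule has_derivative_transform_within_open[OF that assms(1,2)]) (rule assms(3)[symmetric])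
qed

text \<open>The derivative is chosen from the set of all derivatives at the point, and this set
  depends only on the germ of the function; the equality therefore covers nondifferentiable
  functions too.\<close>

lemma frechet_derivative_cong:
  assumes "open U" "x \<in> U" "\<And>y. y \<in> U \<Longrightarrow> v y = w y"
  shows "frechet_derivative v (at x) = frechet_derivative w (at x)"
  by (simp only: frechet_derivative_def has_derivative_cong_open[of U x v w, OF assms])

context
  fixes U :: "pt set" and x :: pt
  assumes U: "open U" "x \<in> U"
begin

lemma dir_deriv_cong: "(\<And>y. y \<in> U \<Longrightarrow> v y = w y) \<Longrightarrow> dir_deriv d v x = dir_deriv d w x"
  unfolding dir_deriv_def by (rule arg_cong[OF frechet_derivative_cong[OF U]])

lemma pderiv_at_cong: "(\<And>y. y \<in> U \<Longrightarrow> v y = w y) \<Longrightarrow> pderiv_at i v x = pderiv_at i w x"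
  unfolding pderiv_at_def by (rule dir_deriv_cong)

lemma grad_cong: "(\<And>y. y \<in> U \<Longrightarrow> v y = w y) \<Longrightarrow> grad v x = grad w x"
  unfolding grad_def by (subst pderiv_at_cong[of v w]) auto

lemma curl_cong: "(\<And>y. y \<in> U \<Longrightarrow> v y = w y) \<Longrightarrow> curl v x = curl w x"
  unfolding curl_def using pderiv_at_cong[of v w] by metis

lemma dvg_cong: "(\<And>y. y \<in> U \<Longrightarrow> \<phi> y = \<psi> y) \<Longrightarrow> dvg \<phi> x = dvg \<psi> x"
  unfolding dvg_def by (intro arg_cong2[where f = "(+)"] pderiv_at_cong) metis+

lemma vgrad_cong: "(\<And>y. y \<in> U \<Longrightarrow> \<phi> y = \<psi> y) \<Longrightarrow> vgrad \<phi> x = vgrad \<psi> x"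
  unfolding vgrad_def jacobian_def by (rule arg_cong[OF frechet_derivative_cong[OF U]])

end

lemma hess_cong:
  assumes "open U" "x \<in> U" "\<And>y. y \<in> U \<Longrightarrow> v y = w y"
  shows "hess v x = hess w x"
  unfolding hess_def by (intro vgrad_cong[OF assms(1,2)] grad_cong[OF assms(1)] assms(3))

lemma dir_deriv_qp: "dir_deriv n (qp a b c d e f) =
    aff (n $ 1 * b + n $ 2 * c) (2 * n $ 1 * d + n $ 2 * e) (n $ 1 * e + 2 * n $ 2 * f)"
  unfolding dir_deriv_def by (rule ext) (simp add: frechet_derivative_at[OF qp_has_derivative, symmetric] aff_def algebra_simps)

lemma dir_deriv_aff: "dir_deriv n (aff p q r) = (\<lambda>x. n $ 1 * q + n $ 2 * r)"
  unfolding dir_deriv_def by (rule ext) (simp add: frechet_derivative_at[OF aff_has_derivative, symmetric])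

lemma axis_nth_2 [simp]: "axis (1::2) (1::real) $ 1 = 1" "axis (1::2) (1::real) $ 2 = 0"
  "axis (2::2) (1::real) $ 1 = 0" "axis (2::2) (1::real) $ 2 = 1"
  by (auto simp: axis_def)

lemma grad_qp: "grad (qp a b c d e f) = aff (vector [b, c]) (vector [2 * d, e]) (vector [e, 2 * f])"
  by (rule ext) (simp add: pt_eq_iff grad_def pderiv_at_def dir_deriv_qp aff_def)

lemma curl_qp: "curl (qp a b c d e f) = aff (vector [c, - b]) (vector [e, - 2 * d]) (vector [2 * f, - e])"
  by (rule ext) (simp add: pt_eq_iff curl_def pderiv_at_def dir_deriv_qp aff_def algebra_simps)

lemma dvg_aff: "dvg (aff p q r) = (\<lambda>x. q $ 1 + r $ 2)"
  by (rule ext) (simp add: dvg_def aff_nth pderiv_at_def dir_deriv_aff)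

lemma vgrad_aff: "vgrad (aff p q r) = (\<lambda>x. \<chi> i j. if j = 1 then q $ i else r $ i)"
proof (rule ext)
  fix x
  show "vgrad (aff p q r) x = (\<chi> i j. if j = 1 then q $ i else r $ i)"
    unfolding vgrad_def jacobian_def frechet_derivative_at[OF aff_has_derivative, symmetric] matrix_def
    by (simp add: vec_eq_iff forall_2)
qed

lemma hess_qp: "hess (qp a b c d e f) = (\<lambda>x. \<chi> i j. if j = 1 then vector [2 * d, e] $ i else vector [e, 2 * f] $ i)"
  unfolding hess_def grad_qp vgrad_aff ..

text \<open>The Jacobian of the curl is the Hessian with its rows exchanged and one of them negated,
  which the Frobenius product of two such matrices does not see.\<close>

lemma hess_inner_qp: "hess (qp a b c d e f) x \<bullet> hess (qp a' b' c' d' e' f') y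
   = vgrad (curl (qp a b c d e f)) x \<bullet> vgrad (curl (qp a' b' c' d' e' f')) y"
  unfolding hess_qp curl_qp vgrad_aff by (simp add: inner_vec_def sum_2)

section \<open>Explicit polynomial spaces and piecewise functions on the mesh\<close>

lemma polys_2: "polys 2 = {p. \<exists>a b c d e f. p = qp a b c d e f}"
proof (intro equalityI subsetI)
  fix p assume "p \<in> polys 2"
  then obtain c where c: "p = (\<lambda>x. \<Sum>i\<le>2. \<Sum>j\<le>2 - i. c i j * (x $ 1) ^ i * (x $ 2) ^ j)"
    by (auto simp: polys_def)
  have "p = qp (c 0 0) (c 1 0) (c 0 1) (c 2 0) (c 1 1) (c 0 2)"
    unfolding c by (rule ext) (simp add: qp_def atMost_Suc numeral_2_eq_2)
  then show "p \<in> {p. \<exists>a b c d e f. p = qp a b c d e f}" by blast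
next
  fix p assume "p \<in> {p. \<exists>a b c d e f. p = qp a b c d e f}"
  then obtain a b c d e f where p: "p = qp a b c d e f" by auto
  define k where "k i j = (if i = 0 then if j = 0 then a else if j = 1 then c else f
     else if i = 1 then if j = 0 then b else e else d)" for i j :: nat
  have "p = (\<lambda>x. \<Sum>i\<le>2. \<Sum>j\<le>2 - i. k i j * (x $ 1) ^ i * (x $ 2) ^ j)"
    unfolding p by (rule ext) (simp add: qp_def atMost_Suc numeral_2_eq_2 k_def)
  then show "p \<in> polys 2" by (auto simp: polys_def)
qed

lemma polys_1: "polys 1 = {p. \<exists>a b c. p = aff a b c}"
proof (intro equalityI subsetI)
  fix p assume "p \<in> polys 1"
  then obtain c where c: "p = (\<lambda>x. \<Sum>i\<le>1. \<Sum>j\<le>1 - i. c i j * (x $ 1) ^ i * (x $ 2) ^ j)"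
    by (auto simp: polys_def)
  have "p = aff (c 0 0) (c 1 0) (c 0 1)"
    unfolding c by (rule ext) (simp add: aff_def)
  then show "p \<in> {p. \<exists>a b c. p = aff a b c}" by blast
next
  fix p :: "pt \<Rightarrow> real" assume "p \<in> {p. \<exists>a b c. p = aff a b c}"
  then obtain a b c where p: "p = aff a b c" by auto
  define k where "k i j = (if i = 0 then if j = 0 then a else c else b)" for i j :: nat
  have "p = (\<lambda>x. \<Sum>i\<le>1. \<Sum>j\<le>1 - i. k i j * (x $ 1) ^ i * (x $ 2) ^ j)"
    unfolding p by (rule ext) (simp add: aff_def k_def)
  then show "p \<in> polys 1" by (auto simp: polys_def)
qed

lemma polys_0: "polys 0 = {p. \<exists>a. p = (\<lambda>x. a)}"
  by (auto simp: polys_def)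

lemma aff_eq_qp: "aff a b c = qp a b c 0 0 0" for a b c :: real
  by (rule ext) (simp add: aff_def qp_def)

lemma polys_1_subset_2: "polys 1 \<subseteq> polys 2"
  unfolding polys_1 polys_2 aff_eq_qp by blast

text \<open>The representative is continuous on the whole plane: this gives integrability on bounded
  elements and also supplies the traces on element boundaries.\<close>

definition pwc :: "pt set set \<Rightarrow> (pt \<Rightarrow> 'b::euclidean_space) \<Rightarrow> bool" where
  "pwc T g \<longleftrightarrow> (\<forall>K\<in>T. \<exists>p. continuous_on UNIV p \<and> (\<forall>x\<in>interior K. g x = p x))"

definition pwaff :: "pt set set \<Rightarrow> (pt \<Rightarrow> 'b::euclidean_space) \<Rightarrow> bool" where
  "pwaff T g \<longleftrightarrow> (\<forall>K\<in>T. \<exists>p q r. \<forall>x\<in>interior K. g x = aff p q r x)"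

text \<open>The equality appropriate to mesh functions, whose values on the skeleton carry no
  information.\<close>

definition interior_eq :: "pt set set \<Rightarrow> (pt \<Rightarrow> 'b) \<Rightarrow> (pt \<Rightarrow> 'b) \<Rightarrow> bool" where
  "interior_eq T g h \<longleftrightarrow> (\<forall>K\<in>T. \<forall>x\<in>interior K. g x = h x)"

lemma interior_eqD: "interior_eq T g h \<Longrightarrow> K \<in> T \<Longrightarrow> x \<in> interior K \<Longrightarrow> g x = h x"
  by (auto simp: interior_eq_def)

lemma interior_eq_refl [simp]: "interior_eq T g g"
  by (auto simp: interior_eq_def)

lemma pwc_interior_eq: "pwc T g \<Longrightarrow> interior_eq T g h \<Longrightarrow> pwc T h"
  unfolding pwc_def interior_eq_def by metis

lemma pwc_constI: "(\<And>K. K \<in> T \<Longrightarrow> \<exists>k. \<forall>x\<in>interior K. g x = k) \<Longrightarrow> pwc T g"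
  unfolding pwc_def
proof
  fix K assume "K \<in> T" and *: "\<And>K. K \<in> T \<Longrightarrow> \<exists>k. \<forall>x\<in>interior K. g x = k"
  then obtain k where "\<forall>x\<in>interior K. g x = k" by blast
  then show "\<exists>p. continuous_on UNIV p \<and> (\<forall>x\<in>interior K. g x = p x)"
    by (intro exI[of _ "\<lambda>x. k"]) auto
qed

lemma pwaff_pwc: "pwaff T g \<Longrightarrow> pwc T g"
  unfolding pwaff_def pwc_def using continuous_on_aff by blast

lemma pw_polys_2D: assumes "v \<in> pw_polys T 2" "K \<in> T"
  obtains a b c d e f where "\<forall>x\<in>interior K. v x = qp a b c d e f x"
  using assms unfolding pw_polys_def polys_2 by blast

lemma pw_polys_1_iff: "v \<in> pw_polys T 1 \<longleftrightarrow> pwaff T v"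
  unfolding pw_polys_def polys_1 pwaff_def by (auto; blast)

lemma pw_polys_1_subset_2: "pw_polys T 1 \<subseteq> pw_polys T 2"
  using polys_1_subset_2 unfolding pw_polys_def by blast

lemma pwaff_components: "(\<forall>i. (\<lambda>x. \<psi> x $ i) \<in> pw_polys T 1) \<longleftrightarrow> pwaff T \<psi>" for \<psi> :: "pt \<Rightarrow> real^2"
proof
  assume l: "\<forall>i. (\<lambda>x. \<psi> x $ i) \<in> pw_polys T 1"
  show "pwaff T \<psi>" unfolding pwaff_def
  proof
    fix K assume K: "K \<in> T"
    obtain a b c where 1: "\<forall>x\<in>interior K. \<psi> x $ 1 = aff a b c x"
      using l K unfolding pw_polys_1_iff pwaff_def by blast
    obtain a' b' c' where 2: "\<forall>x\<in>interior K. \<psi> x $ 2 = aff a' b' c' x"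
      using l K unfolding pw_polys_1_iff pwaff_def by blast
    have "\<forall>x\<in>interior K. \<psi> x = aff (vector [a, a']) (vector [b, b']) (vector [c, c']) x"
      using 1 2 by (simp add: pt_eq_iff aff_def)
    then show "\<exists>p q r. \<forall>x\<in>interior K. \<psi> x = aff p q r x" by blast
  qed
next
  assume "pwaff T \<psi>"
  then show "\<forall>i. (\<lambda>x. \<psi> x $ i) \<in> pw_polys T 1"
    unfolding pw_polys_1_iff pwaff_def by (metis aff_nth)
qed

lemma pwc_inner: assumes "pwc T g" "pwc T h" shows "pwc T (\<lambda>x. g x \<bullet> h x)"
  unfolding pwc_def
proof
  fix K assume "K \<in> T"
  then obtain p q where "continuous_on UNIV p" "\<forall>x\<in>interior K. g x = p x"
      "continuous_on UNIV q" "\<forall>x\<in>interior K. h x = q x"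
    using assms unfolding pwc_def by blast
  then show "\<exists>p. continuous_on UNIV p \<and> (\<forall>x\<in>interior K. g x \<bullet> h x = p x)"
    by (intro exI[of _ "\<lambda>x. p x \<bullet> q x"]) (auto intro: continuous_on_inner)
qed

lemma pwaff_comb: assumes "pwaff T g" "pwaff T h" shows "pwaff T (\<lambda>x. r *\<^sub>R g x + s *\<^sub>R h x)"
  unfolding pwaff_def
proof
  fix K assume "K \<in> T"
  then obtain p q w p' q' w' where "\<forall>x\<in>interior K. g x = aff p q w x" "\<forall>x\<in>interior K. h x = aff p' q' w' x"
    using assms unfolding pwaff_def by blast
  then show "\<exists>p q w. \<forall>x\<in>interior K. r *\<^sub>R g x + s *\<^sub>R h x = aff p q w x"
    by (auto simp: aff_comb)
qed

lemma qp_comb: "r * qp a b c d e f x + s * qp a' b' c' d' e' f' x =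
   qp (r * a + s * a') (r * b + s * b') (r * c + s * c') (r * d + s * d') (r * e + s * e') (r * f + s * f') x"
  by (simp add: qp_def algebra_simps)

lemma pw_polys_2_comb:
  assumes "u \<in> pw_polys T 2" "v \<in> pw_polys T 2"
  shows "(\<lambda>x. r *\<^sub>R u x + s *\<^sub>R v x) \<in> pw_polys T 2"
  unfolding pw_polys_def
proof (intro CollectI ballI)
  fix K assume K: "K \<in> T"
  obtain a b c d e f where 1: "\<forall>x\<in>interior K. u x = qp a b c d e f x"
    using pw_polys_2D[OF assms(1) K] by metis
  obtain a' b' c' d' e' f' where 2: "\<forall>x\<in>interior K. v x = qp a' b' c' d' e' f' x"
    using pw_polys_2D[OF assms(2) K] by metis
  show "\<exists>p\<in>polys 2. \<forall>x\<in>interior K. r *\<^sub>R u x + s *\<^sub>R v x = p x"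
    unfolding polys_2 real_scaleR_def
  proof (rule bexI)
    show "\<forall>x\<in>interior K. r * u x + s * v x = qp (r * a + s * a') (r * b + s * b') (r * c + s * c')
      (r * d + s * d') (r * e + s * e') (r * f + s * f') x"
      using 1 2 by (simp add: qp_comb)
  qed blast
qed

lemma pw_polys_1_comb:
  "u \<in> pw_polys T 1 \<Longrightarrow> v \<in> pw_polys T 1 \<Longrightarrow> (\<lambda>x. r *\<^sub>R u x + s *\<^sub>R v x) \<in> pw_polys T 1"
  unfolding pw_polys_1_iff by (rule pwaff_comb)

lemma local_qp:
  assumes "\<forall>x\<in>interior K. v x = qp a b c d e f x" "x \<in> interior K"
  shows "grad v x = grad (qp a b c d e f) x" "curl v x = curl (qp a b c d e f) x"
    "hess v x = hess (qp a b c d e f) x" "vgrad (curl v) x = vgrad (curl (qp a b c d e f)) x"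
    "dir_deriv n v x = dir_deriv n (qp a b c d e f) x"
    "dir_deriv m (dir_deriv n v) x = dir_deriv m (dir_deriv n (qp a b c d e f)) x"
    "dvg (curl v) x = dvg (curl (qp a b c d e f)) x"
proof -
  note o = open_interior[of K]
  show "grad v x = grad (qp a b c d e f) x" by (rule grad_cong[OF o assms(2) bspec[OF assms(1)]])
  have c: "curl v y = curl (qp a b c d e f) y" if "y \<in> interior K" for y
    by (rule curl_cong[OF o that bspec[OF assms(1)]])
  then show "curl v x = curl (qp a b c d e f) x" using assms(2) .
  show "hess v x = hess (qp a b c d e f) x" by (rule hess_cong[OF o assms(2) bspec[OF assms(1)]])
  show "vgrad (curl v) x = vgrad (curl (qp a b c d e f)) x" by (rule vgrad_cong[OF o assms(2) c])
  show "dvg (curl v) x = dvg (curl (qp a b c d e f)) x" by (rule dvg_cong[OF o assms(2) c])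
  have d: "dir_deriv n v y = dir_deriv n (qp a b c d e f) y" if "y \<in> interior K" for y
    by (rule dir_deriv_cong[OF o that bspec[OF assms(1)]])
  then show "dir_deriv n v x = dir_deriv n (qp a b c d e f) x" using assms(2) .
  show "dir_deriv m (dir_deriv n v) x = dir_deriv m (dir_deriv n (qp a b c d e f)) x"
    by (rule dir_deriv_cong[OF o assms(2) d])
qed

lemma local_aff:
  assumes "\<forall>x\<in>interior K. \<psi> x = aff p q r x" "x \<in> interior K"
  shows "dvg \<psi> x = dvg (aff p q r) x" "vgrad \<psi> x = vgrad (aff p q r) x"
    "dir_deriv n (\<lambda>x. \<psi> x \<bullet> t) x = dir_deriv n (aff (p \<bullet> t) (q \<bullet> t) (r \<bullet> t)) x"
proof -
  show "dvg \<psi> x = dvg (aff p q r) x" by (rule dvg_cong[OF open_interior assms(2) bspec[OF assms(1)]])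
  show "vgrad \<psi> x = vgrad (aff p q r) x" by (rule vgrad_cong[OF open_interior assms(2) bspec[OF assms(1)]])
  show "dir_deriv n (\<lambda>x. \<psi> x \<bullet> t) x = dir_deriv n (aff (p \<bullet> t) (q \<bullet> t) (r \<bullet> t)) x"
    by (rule dir_deriv_cong[OF open_interior assms(2)]) (simp add: assms(1) aff_inner)
qed

lemma pwaff_pw_polys_2:
  assumes "v \<in> pw_polys T 2"
  shows "pwaff T (grad v)" (is ?A)
    "pwaff T (curl v)" (is ?B)
    "pwaff T (dir_deriv n v)" (is ?C)
    "pwc T (hess v)" (is ?D)
    "pwc T (vgrad (curl v))" (is ?E)
    "pwc T (dir_deriv m (dir_deriv n v))" (is ?F)
proof -
  have "(\<exists>p q r. \<forall>x\<in>interior K. grad v x = aff p q r x) \<and>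
     (\<exists>p q r. \<forall>x\<in>interior K. curl v x = aff p q r x) \<and>
     (\<exists>p q r. \<forall>x\<in>interior K. dir_deriv n v x = aff p q r x) \<and>
     (\<exists>p. continuous_on UNIV p \<and> (\<forall>x\<in>interior K. hess v x = p x)) \<and>
     (\<exists>p. continuous_on UNIV p \<and> (\<forall>x\<in>interior K. vgrad (curl v) x = p x)) \<and>
     (\<exists>p. continuous_on UNIV p \<and> (\<forall>x\<in>interior K. dir_deriv m (dir_deriv n v) x = p x))"
    if K: "K \<in> T" for K
  proof -
    obtain a b c d e f where v: "\<forall>x\<in>interior K. v x = qp a b c d e f x"
      using pw_polys_2D[OF assms K] by metis
    note l = local_qp[of K v, OF v]
    show ?thesis
    proof (intro conjI)
      show "\<exists>p q r. \<forall>x\<in>interior K. grad v x = aff p q r x" using l(1) unfolding grad_qp by blast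
      show "\<exists>p q r. \<forall>x\<in>interior K. curl v x = aff p q r x" using l(2) unfolding curl_qp by blast
      show "\<exists>p q r. \<forall>x\<in>interior K. dir_deriv n v x = aff p q r x" using l(5) unfolding dir_deriv_qp by blast
      show "\<exists>p. continuous_on UNIV p \<and> (\<forall>x\<in>interior K. hess v x = p x)"
        using l(3) unfolding hess_qp using continuous_on_const by blast
      show "\<exists>p. continuous_on UNIV p \<and> (\<forall>x\<in>interior K. vgrad (curl v) x = p x)"
        using l(4) unfolding curl_qp vgrad_aff using continuous_on_const by blast
      show "\<exists>p. continuous_on UNIV p \<and> (\<forall>x\<in>interior K. dir_deriv m (dir_deriv n v) x = p x)"
        using l(6) unfolding dir_deriv_qp dir_deriv_aff using continuous_on_const by blast
    qed
  qed
  then show ?A ?B ?C ?D ?E ?F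
    unfolding pwaff_def pwc_def by blast+
qed

lemma pwc_pw_polys_2: "v \<in> pw_polys T 2 \<Longrightarrow> pwc T v"
  unfolding pwc_def by (metis pw_polys_2D continuous_on_qp)

lemma pwaff_derivs:
  assumes "pwaff T \<psi>"
  shows "dvg \<psi> \<in> pw_polys T 0" "pwc T (dvg \<psi>)" "pwc T (vgrad \<psi>)"
    "pwc T (\<lambda>x. \<psi> x \<bullet> t)" "pwc T (dir_deriv n (\<lambda>x. \<psi> x \<bullet> t))"
proof -
  have *: "(\<exists>k. \<forall>x\<in>interior K. dvg \<psi> x = k) \<and> (\<exists>k. \<forall>x\<in>interior K. vgrad \<psi> x = k) \<and>
     (\<exists>k. \<forall>x\<in>interior K. dir_deriv n (\<lambda>x. \<psi> x \<bullet> t) x = k) \<and>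
     (\<exists>p q r. \<forall>x\<in>interior K. \<psi> x \<bullet> t = aff p q r x)"
    if K: "K \<in> T" for K
  proof -
    obtain p q r where v: "\<forall>x\<in>interior K. \<psi> x = aff p q r x"
      using assms K unfolding pwaff_def by blast
    have "\<forall>x\<in>interior K. \<psi> x \<bullet> t = aff (p \<bullet> t) (q \<bullet> t) (r \<bullet> t) x" using v by (simp add: aff_inner)
    moreover note l = local_aff[of K \<psi>, OF v, unfolded dvg_aff vgrad_aff dir_deriv_aff]
    have "\<exists>k. \<forall>x\<in>interior K. dvg \<psi> x = k" using l(1) by blast
    moreover have "\<exists>k. \<forall>x\<in>interior K. vgrad \<psi> x = k" using l(2) by blast
    moreover have "\<exists>k. \<forall>x\<in>interior K. dir_deriv n (\<lambda>x. \<psi> x \<bullet> t) x = k" using l(3) by blast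
    ultimately show ?thesis by blast
  qed
  show "dvg \<psi> \<in> pw_polys T 0" unfolding pw_polys_def polys_0
  proof (intro CollectI ballI)
    fix K assume "K \<in> T"
    then obtain k where "\<forall>x\<in>interior K. dvg \<psi> x = k" using * by blast
    then show "\<exists>p\<in>{p. \<exists>a. p = (\<lambda>x. a)}. \<forall>x\<in>interior K. dvg \<psi> x = p x"
      by (intro bexI[of _ "\<lambda>x. k"]) auto
  qed
  show "pwc T (dvg \<psi>)" by (rule pwc_constI) (rule conjunct1[OF *])
  show "pwc T (vgrad \<psi>)" by (rule pwc_constI) (rule conjunct1[OF conjunct2[OF *]])
  show "pwc T (dir_deriv n (\<lambda>x. \<psi> x \<bullet> t))"
    by (rule pwc_constI) (rule conjunct1[OF conjunct2[OF conjunct2[OF *]]])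
  have "pwaff T (\<lambda>x. \<psi> x \<bullet> t)" unfolding pwaff_def using * by blast
  then show "pwc T (\<lambda>x. \<psi> x \<bullet> t)" by (rule pwaff_pwc)
qed

lemma comb_pw_polys_2:
  assumes "u \<in> pw_polys T 2" "v \<in> pw_polys T 2"
  shows "interior_eq T (grad (\<lambda>x. r *\<^sub>R u x + s *\<^sub>R v x)) (\<lambda>x. r *\<^sub>R grad u x + s *\<^sub>R grad v x)" (is ?A)
    "interior_eq T (curl (\<lambda>x. r *\<^sub>R u x + s *\<^sub>R v x)) (\<lambda>x. r *\<^sub>R curl u x + s *\<^sub>R curl v x)" (is ?B)
    "interior_eq T (dir_deriv n (\<lambda>x. r *\<^sub>R u x + s *\<^sub>R v x))
       (\<lambda>x. r *\<^sub>R dir_deriv n u x + s *\<^sub>R dir_deriv n v x)" (is ?C)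
proof -
  have "grad (\<lambda>x. r *\<^sub>R u x + s *\<^sub>R v x) x = r *\<^sub>R grad u x + s *\<^sub>R grad v x \<and>
     curl (\<lambda>x. r *\<^sub>R u x + s *\<^sub>R v x) x = r *\<^sub>R curl u x + s *\<^sub>R curl v x \<and>
     dir_deriv n (\<lambda>x. r *\<^sub>R u x + s *\<^sub>R v x) x = r *\<^sub>R dir_deriv n u x + s *\<^sub>R dir_deriv n v x"
    if K: "K \<in> T" "x \<in> interior K" for K x
  proof -
    obtain a b c d e f where 1: "\<forall>x\<in>interior K. u x = qp a b c d e f x"
      using pw_polys_2D[OF assms(1) K(1)] by metis
    obtain a' b' c' d' e' f' where 2: "\<forall>x\<in>interior K. v x = qp a' b' c' d' e' f' x"
      using pw_polys_2D[OF assms(2) K(1)] by metis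
    have 3: "\<forall>x\<in>interior K. r *\<^sub>R u x + s *\<^sub>R v x = qp (r * a + s * a') (r * b + s * b') (r * c + s * c')
      (r * d + s * d') (r * e + s * e') (r * f + s * f') x"
      using 1 2 by (simp add: qp_comb)
    note l1 = local_qp[of K u, OF 1 K(2)] and l2 = local_qp[of K v, OF 2 K(2)]
      and l3 = local_qp[of K "\<lambda>x. r *\<^sub>R u x + s *\<^sub>R v x", OF 3 K(2)]
    show ?thesis unfolding l1(1,2,5) l2(1,2,5) l3(1,2,5) grad_qp curl_qp dir_deriv_qp aff_comb
      by (simp add: aff_def pt_eq_iff algebra_simps)
  qed
  then show ?A ?B ?C
    unfolding interior_eq_def by blast+
qed

lemma comb_pwaff:
  assumes "pwaff T \<phi>" "pwaff T \<psi>"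
  shows "interior_eq T (dvg (\<lambda>x. r *\<^sub>R \<phi> x + s *\<^sub>R \<psi> x)) (\<lambda>x. r *\<^sub>R dvg \<phi> x + s *\<^sub>R dvg \<psi> x)" (is ?A)
    "interior_eq T (vgrad (\<lambda>x. r *\<^sub>R \<phi> x + s *\<^sub>R \<psi> x)) (\<lambda>x. r *\<^sub>R vgrad \<phi> x + s *\<^sub>R vgrad \<psi> x)" (is ?B)
    "interior_eq T (dir_deriv n (\<lambda>x. (r *\<^sub>R \<phi> x + s *\<^sub>R \<psi> x) \<bullet> t))
       (\<lambda>x. r *\<^sub>R dir_deriv n (\<lambda>x. \<phi> x \<bullet> t) x + s *\<^sub>R dir_deriv n (\<lambda>x. \<psi> x \<bullet> t) x)" (is ?C)
proof -
  have "dvg (\<lambda>x. r *\<^sub>R \<phi> x + s *\<^sub>R \<psi> x) x = r *\<^sub>R dvg \<phi> x + s *\<^sub>R dvg \<psi> x \<and>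
    vgrad (\<lambda>x. r *\<^sub>R \<phi> x + s *\<^sub>R \<psi> x) x = r *\<^sub>R vgrad \<phi> x + s *\<^sub>R vgrad \<psi> x \<and>
    dir_deriv n (\<lambda>x. (r *\<^sub>R \<phi> x + s *\<^sub>R \<psi> x) \<bullet> t) x =
      r *\<^sub>R dir_deriv n (\<lambda>x. \<phi> x \<bullet> t) x + s *\<^sub>R dir_deriv n (\<lambda>x. \<psi> x \<bullet> t) x"
    if K: "K \<in> T" "x \<in> interior K" for K x
  proof -
    obtain p q w where 1: "\<forall>x\<in>interior K. \<phi> x = aff p q w x"
      using assms(1) K unfolding pwaff_def by blast
    obtain p' q' w' where 2: "\<forall>x\<in>interior K. \<psi> x = aff p' q' w' x"
      using assms(2) K unfolding pwaff_def by blast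
    have 3: "\<forall>x\<in>interior K. r *\<^sub>R \<phi> x + s *\<^sub>R \<psi> x =
        aff (r *\<^sub>R p + s *\<^sub>R p') (r *\<^sub>R q + s *\<^sub>R q') (r *\<^sub>R w + s *\<^sub>R w') x"
      using 1 2 by (simp add: aff_comb)
    note l1 = local_aff[of K \<phi>, OF 1 K(2)] and l2 = local_aff[of K \<psi>, OF 2 K(2)]
      and l3 = local_aff[of K "\<lambda>x. r *\<^sub>R \<phi> x + s *\<^sub>R \<psi> x", OF 3 K(2)]
    show ?thesis unfolding l1 l2 l3 dvg_aff vgrad_aff dir_deriv_aff
      by (simp add: vec_eq_iff inner_add_left algebra_simps)
  qed
  then show ?A ?B ?C
    unfolding interior_eq_def by blast+
qed

section \<open>Integrals and traces\<close>

lemma open_islimpt_closure: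
  fixes S :: "'a::euclidean_space set"
  assumes "open S" "x \<in> closure S"
  shows "x islimpt S"
  using assms interior_limit_point[of x S] by (auto simp: closure_def interior_open)

text \<open>The end points in \<open>edge_integral\<close> are a choice, so only some pair with the
  same segment is known. The pair depends on the segment alone, which lets different integrands be
  compared along one parametrization.\<close>

lemma edge_integral_repr:
  obtains a' b' where "closed_segment a b = closed_segment a' b'"
    "\<And>g. edge_integral (closed_segment a b) g = dist a' b' * integral {0..1} (\<lambda>s. g (linepath a' b' s))"
proof -
  obtain a' b' where ab: "(SOME (p, q). closed_segment a b = closed_segment p q) = (a', b')"
    by (meson surj_pair)
  have "case (a', b') of (p, q) \<Rightarrow> closed_segment a b = closed_segment p q"
    unfolding ab[symmetric] by (rule someI[of _ "(a, b)"]) simp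
  then show ?thesis using that ab by (auto simp: edge_integral_def)
qed

lemma edge_integral_cong:
  assumes "F = closed_segment a b" "\<And>x. x \<in> F \<Longrightarrow> g x = h x"
  shows "edge_integral F g = edge_integral F h"
proof -
  obtain a' b' where ab: "F = closed_segment a' b'"
    "\<And>g. edge_integral F g = dist a' b' * integral {0..1} (\<lambda>s. g (linepath a' b' s))"
    using edge_integral_repr[of a b] assms(1) by metis
  have "integral {0..1} (\<lambda>s. g (linepath a' b' s)) = integral {0..1} (\<lambda>s. h (linepath a' b' s))"
    using assms(2) ab(1) by (intro Henstock_Kurzweil_Integration.integral_cong) (auto simp: linepath_in_path)
  then show ?thesis unfolding ab(2) by simp
qed

lemma edge_integral_comb:
  assumes F: "F = closed_segment a b" and c: "continuous_on UNIV g" "continuous_on UNIV h"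
  shows "edge_integral F (\<lambda>x. r * g x + s * h x) = r * edge_integral F g + s * edge_integral F h"
proof -
  obtain a' b' where ab: "\<And>g. edge_integral F g = dist a' b' * integral {0..1} (\<lambda>s. g (linepath a' b' s))"
    using edge_integral_repr[of a b] F by metis
  have i: "(\<lambda>s. k (linepath a' b' s)) integrable_on {0..1}" if "continuous_on UNIV k" for k :: "pt \<Rightarrow> real"
    using continuous_on_compose2[OF that continuous_on_linepath[of "{0..1}" a' b']]
    by (intro integrable_continuous_real) auto
  have "integral {0..1} (\<lambda>t. r * g (linepath a' b' t) + s * h (linepath a' b' t)) =
     r * integral {0..1} (\<lambda>t. g (linepath a' b' t)) + s * integral {0..1} (\<lambda>t. h (linepath a' b' t))"
    using i[OF c(1)] i[OF c(2)]
    by (subst Henstock_Kurzweil_Integration.integral_add) (auto intro: integrable_on_mult_right)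
  then show ?thesis unfolding ab by (simp add: algebra_simps)
qed

text \<open>An affine function is affine in the parameter, so its mean is the midpoint value. Length
  and midpoint are symmetric in the end points, so the hidden choice of their order
  disappears.\<close>

lemma edge_integral_aff:
  assumes F: "F = closed_segment a b" and g: "\<And>x. x \<in> F \<Longrightarrow> g x = aff p q r x"
  shows "edge_integral F g = dist a b * aff p q r (midpoint a b)"
proof -
  obtain a' b' where ab: "F = closed_segment a' b'"
    "\<And>g. edge_integral F g = dist a' b' * integral {0..1} (\<lambda>s. g (linepath a' b' s))"
    using edge_integral_repr[of a b] F by metis
  have sym: "dist a b = dist a' b'" "midpoint a b = midpoint a' b'"
    using ab(1) F by (auto simp: doubleton_eq_iff dist_commute midpoint_sym)
  let ?A = "aff p q r a'" and ?B = "aff p q r b'"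
  have "((\<lambda>s. ?A + s * (?B - ?A)) has_integral (1 *\<^sub>R ?A + (1\<^sup>2 - 0\<^sup>2) / 2 * (?B - ?A))) {0..1}"
    using has_integral_const_real[of ?A 0 1] ident_has_integral[of 0 1]
    by (intro has_integral_add has_integral_mult_left) auto
  moreover have "?A + s * (?B - ?A) = aff p q r (linepath a' b' s)" for s
    by (simp add: aff_def linepath_def algebra_simps)
  ultimately have "integral {0..1} (\<lambda>s. aff p q r (linepath a' b' s)) = ?A + (?B - ?A) / 2"
    by (simp add: integral_unique)
  also have "\<dots> = aff p q r (midpoint a' b')"
    by (simp add: aff_def midpoint_def field_simps)
  finally have "edge_integral F (aff p q r) = dist a b * aff p q r (midpoint a b)"
    unfolding sym ab(2) by simp
  moreover have "edge_integral F g = edge_integral F (aff p q r)"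
    by (rule edge_integral_cong[OF F g])
  ultimately show ?thesis by simp
qed

section \<open>Integration over the domain and one-sided traces\<close>

lemma ip_commute: "ip \<Omega> g h = ip \<Omega> h g"
  by (simp add: ip_def inner_commute)

context domain_mesh
begin

lemma domain_lebesgue [measurable]: "\<Omega> \<in> sets lebesgue"
  using domain(1) by (simp add: lmeasurable_open)

lemma skeleton_negligible: "negligible (closure \<Omega> - \<Union>(interior ` T))"
proof -
  have "closure \<Omega> - \<Union>(interior ` T) \<subseteq> \<Union>(frontier ` T)"
    unfolding Union_mesh[symmetric] using mesh_closed by (auto simp: frontier_def)
  moreover have "negligible (\<Union>(frontier ` T))"
    using finite_mesh mesh_convex by (intro negligible_Union) (auto intro: negligible_convex_frontier)
  ultimately show ?thesis by (rule negligible_subset[rotated])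
qed

lemma AE_domainI:
  assumes "\<And>K x. K \<in> T \<Longrightarrow> x \<in> interior K \<Longrightarrow> P x"
  shows "AE x in lebesgue_on \<Omega>. P x"
proof -
  have "AE x in lebesgue. x \<notin> closure \<Omega> - \<Union>(interior ` T)"
    using skeleton_negligible by (intro AE_not_in) (simp add: negligible_iff_null_sets)
  then have "AE x in lebesgue. x \<in> \<Omega> \<longrightarrow> P x"
  proof eventually_elim
    case (elim x)
    then show ?case using assms closure_subset[of \<Omega>] by blast
  qed
  then show ?thesis by (subst AE_restrict_space_iff) auto
qed

lemma pwc_integrable:
  fixes g :: "pt \<Rightarrow> 'b::euclidean_space"
  assumes "pwc T g" shows "integrable (lebesgue_on \<Omega>) g"
proof -
  have int: "set_integrable lebesgue (interior K) g" if K: "K \<in> T" for K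
  proof -
    obtain p where p: "continuous_on UNIV p" "\<forall>x\<in>interior K. g x = p x"
      using assms K unfolding pwc_def by blast
    obtain a b where ab: "K \<subseteq> cbox a b"
      using bounded_subset_cbox_symmetric compact_imp_bounded[OF mesh_compact[OF K]] by metis
    have "p absolutely_integrable_on cbox a b"
      using p(1) continuous_on_subset by (intro absolutely_integrable_continuous) auto
    then have "set_integrable lebesgue (interior K) p"
      by (rule set_integrable_subset) (use ab interior_subset[of K] in auto)
    then show ?thesis using p(2) by (subst set_integrable_cong) auto
  qed
  have "g absolutely_integrable_on (\<Union>K\<in>T. interior K)"
    using finite_mesh int by (intro set_integrable_UN) auto
  then have "g absolutely_integrable_on \<Omega>"
  proof (rule absolutely_integrable_spike_set)
    have "{x \<in> (\<Union>K\<in>T. interior K) - \<Omega>. g x \<noteq> 0} = {}" using mesh_interior_subset by blast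
    then show "negligible {x \<in> (\<Union>K\<in>T. interior K) - \<Omega>. g x \<noteq> 0}" by (simp only: negligible_empty)
    show "negligible {x \<in> \<Omega> - (\<Union>K\<in>T. interior K). g x \<noteq> 0}"
      using closure_subset[of \<Omega>] by (intro negligible_subset[OF skeleton_negligible]) auto
  qed
  then show ?thesis
    unfolding set_integrable_def by (subst integrable_restrict_space) auto
qed

lemma pwc_integral_cong:
  fixes g :: "pt \<Rightarrow> real"
  assumes "pwc T g" "interior_eq T g h"
  shows "(LINT x|lebesgue_on \<Omega>. g x) = (LINT x|lebesgue_on \<Omega>. h x)"
proof (rule integral_cong_AE)
  show "g \<in> borel_measurable (lebesgue_on \<Omega>)" "h \<in> borel_measurable (lebesgue_on \<Omega>)"
    using pwc_integrable[OF assms(1)] pwc_integrable[OF pwc_interior_eq[OF assms]] by auto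
  show "AE x in lebesgue_on \<Omega>. g x = h x"
    using assms(2) by (intro AE_domainI) (auto simp: interior_eq_def)
qed

lemma integral_pw_const:
  assumes "\<And>K x. K \<in> T \<Longrightarrow> x \<in> interior K \<Longrightarrow> g x = k K"
  shows "(LINT x|lebesgue_on \<Omega>. g x) = (\<Sum>K\<in>T. k K * measure lebesgue K)" "pwc T g"
proof -
  show g: "pwc T g" using assms by (intro pwc_constI) blast
  have "(g has_integral (\<Sum>K\<in>T. k K * measure lebesgue K)) (\<Union>T)"
  proof (rule has_integral_Union[OF finite_mesh])
    fix K assume K: "K \<in> T"
    have lm: "K \<in> lmeasurable" using mesh_compact[OF K] by (rule lmeasurable_compact)
    have "((\<lambda>x. 1) has_integral measure lebesgue K) K"
      using integrable_integral[OF integrable_on_const[OF lm, of "1::real"]] lmeasure_integral[OF lm] by simp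
    then have "((\<lambda>x. k K * 1) has_integral k K * measure lebesgue K) K"
      by (rule has_integral_mult_right)
    then show "(g has_integral k K * measure lebesgue K) K"
      by (rule has_integral_spike[OF negligible_convex_frontier[OF mesh_convex[OF K]], rotated])
        (use assms K mesh_closed[OF K] in \<open>auto simp: frontier_def\<close>)
  next
    have "negligible (K \<inter> K')" if K: "K \<in> T" "K' \<in> T" "K \<noteq> K'" for K K'
    proof -
      have "K \<inter> K' \<subseteq> frontier K'"
        using mesh_interior_disjoint[OF K(1,2)] K mesh_closed by (auto simp: frontier_def)
      then show ?thesis using negligible_convex_frontier[OF mesh_convex[OF K(2)]] negligible_subset by blast
    qed
    then show "pairwise (\<lambda>S S'. negligible (S \<inter> S')) T" by (auto simp: pairwise_def)
  qed
  then have "(g has_integral (\<Sum>K\<in>T. k K * measure lebesgue K)) \<Omega>"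
    unfolding Union_mesh
  proof (subst (asm) has_integral_spike_set_eq[of "closure \<Omega>" \<Omega>])
    show "negligible {x \<in> closure \<Omega> - \<Omega>. g x \<noteq> 0}"
      by (rule negligible_subset[OF negligible_convex_frontier[OF domain(2)]])
        (use domain(1) in \<open>auto simp: frontier_def interior_open\<close>)
    have "{x \<in> \<Omega> - closure \<Omega>. g x \<noteq> 0} = {}" using closure_subset by blast
    then show "negligible {x \<in> \<Omega> - closure \<Omega>. g x \<noteq> 0}" by (simp only: negligible_empty)
  qed
  then show "(LINT x|lebesgue_on \<Omega>. g x) = (\<Sum>K\<in>T. k K * measure lebesgue K)"
    using lebesgue_integral_eq_integral[OF pwc_integrable[OF g]] by (simp add: integral_unique)
qed

lemma ip_cong:
  assumes "pwc T g" "pwc T h" "interior_eq T g g'" "interior_eq T h h'"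
  shows "ip \<Omega> g h = ip \<Omega> g' h'"
  unfolding ip_def using assms
  by (intro pwc_integral_cong pwc_inner) (auto simp: interior_eq_def)

lemma ip_comb_left:
  assumes "pwc T g" "pwc T g'" "pwc T h"
  shows "ip \<Omega> (\<lambda>x. r *\<^sub>R g x + s *\<^sub>R g' x) h = r * ip \<Omega> g h + s * ip \<Omega> g' h"
  unfolding ip_def using pwc_integrable[OF pwc_inner[OF assms(1,3)]] pwc_integrable[OF pwc_inner[OF assms(2,3)]]
  by (simp add: inner_add_left)

lemma ip_comb_right:
  assumes "pwc T g" "pwc T g'" "pwc T h"
  shows "ip \<Omega> h (\<lambda>x. r *\<^sub>R g x + s *\<^sub>R g' x) = r * ip \<Omega> h g + s * ip \<Omega> h g'"
  using ip_comb_left[OF assms] by (simp add: ip_commute)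

lemma ip_nonneg: "ip \<Omega> g g \<ge> 0"
  unfolding ip_def by (rule integral_nonneg_AE) simp

text \<open>A nonzero value of the continuous representative at an interior point persists on an
  open set, which is not negligible; almost everywhere thus becomes everywhere on the open
  triangles.\<close>

lemma ip_zeroD:
  fixes g :: "pt \<Rightarrow> 'b::euclidean_space"
  assumes g: "pwc T g" and z: "ip \<Omega> g g = 0"
  shows "interior_eq T g (\<lambda>x. 0)"
proof -
  have "AE x in lebesgue_on \<Omega>. g x \<bullet> g x = 0"
    using z integral_nonneg_eq_0_iff_AE[OF pwc_integrable[OF pwc_inner[OF g g]]] by (simp add: ip_def)
  then have "AE x in lebesgue. x \<in> \<Omega> \<longrightarrow> g x = 0" by (subst (asm) AE_restrict_space_iff) auto
  then have neg: "negligible {x. \<not> (x \<in> \<Omega> \<longrightarrow> g x = 0)}"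
    unfolding eventually_ae_filter by (auto simp: negligible_iff_null_sets[symmetric] intro: negligible_subset)
  have "g x = 0" if K: "K \<in> T" and x: "x \<in> interior K" for K x
  proof (rule ccontr)
    assume nz: "g x \<noteq> 0"
    obtain p where p: "continuous_on UNIV p" "\<forall>x\<in>interior K. g x = p x"
      using g K unfolding pwc_def by blast
    let ?U = "interior K \<inter> {y. p y \<noteq> 0}"
    have "open {y. p y \<noteq> 0}" using p(1) by (intro open_Collect_neq) (auto intro: continuous_intros)
    then have "open ?U" by auto
    moreover have "x \<in> ?U" using x nz p(2) by auto
    moreover have "?U \<subseteq> {x. \<not> (x \<in> \<Omega> \<longrightarrow> g x = 0)}"
      using p(2) mesh_interior_subset[OF K] by auto
    ultimately show False using neg open_not_negligible negligible_subset by blast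
  qed
  then show ?thesis by (auto simp: interior_eq_def)
qed

text \<open>An element is the closure of its interior, so each of its points, corners included, is a
  limit point of the interior and the limit in \<open>elem_trace\<close> is unique.\<close>

lemma elem_trace_eq:
  fixes g p :: "pt \<Rightarrow> 'b::euclidean_space"
  assumes K: "K \<in> T" "x \<in> K" and p: "continuous_on UNIV p" "\<forall>y\<in>interior K. g y = p y"
  shows "elem_trace K g x = p x"
proof -
  have "x islimpt interior K"
    using open_islimpt_closure[OF open_interior] mesh_closure_interior[OF K(1)] K(2) by blast
  then have nt: "\<not> trivial_limit (at x within interior K)" by (simp add: trivial_limit_within)
  have "(p \<longlongrightarrow> p x) (at x within interior K)"
    using p(1) continuous_on_subset[OF p(1), of "insert x (interior K)"]
    by (metis UNIV_I continuous_on_def tendsto_within_subset top_greatest)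
  then have "(g \<longlongrightarrow> p x) (at x within interior K)"
    using Lim_cong_within[of x x "p x" "p x" "interior K" "interior K" g p] p(2) by auto
  then show ?thesis unfolding elem_trace_def using nt by (intro tendsto_Lim)
qed

lemma elem_trace_cong:
  assumes "\<forall>y\<in>interior K. g y = h y" shows "elem_trace K g = elem_trace K h"
  unfolding elem_trace_def by (rule ext, rule Lim_cong) (auto simp: eventually_at_filter assms)

lemma elem_trace_comb:
  assumes K: "K \<in> T" "x \<in> K" and g: "pwc T g" "pwc T h"
  shows "elem_trace K (\<lambda>x. r *\<^sub>R g x + s *\<^sub>R h x) x = r *\<^sub>R elem_trace K g x + s *\<^sub>R elem_trace K h x"
proof -
  obtain p where p: "continuous_on UNIV p" "\<forall>x\<in>interior K. g x = p x"
    using g K unfolding pwc_def by blast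
  obtain q where q: "continuous_on UNIV q" "\<forall>x\<in>interior K. h x = q x"
    using g K unfolding pwc_def by blast
  have "elem_trace K (\<lambda>x. r *\<^sub>R g x + s *\<^sub>R h x) x = r *\<^sub>R p x + s *\<^sub>R q x"
    using p q by (intro elem_trace_eq[OF K]) (auto intro!: continuous_intros)
  then show ?thesis using elem_trace_eq[OF K p] elem_trace_eq[OF K q] by simp
qed

lemma bd_trace_cong:
  assumes "F \<in> boundary_edges \<Omega> T" "interior_eq T g h"
  shows "bd_trace T F g = bd_trace T F h"
proof -
  obtain K where K: "K \<in> T" "element_at T F = K" using boundary_edgeE[OF assms(1)] by metis
  then have "\<forall>x\<in>interior K. g x = h x" using assms(2) by (simp add: interior_eq_def)
  then show ?thesis unfolding bd_trace_def K(2) by (rule elem_trace_cong)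
qed

lemma bd_trace_repr:
  fixes g :: "pt \<Rightarrow> 'b::euclidean_space"
  assumes F: "F \<in> boundary_edges \<Omega> T" and g: "pwc T g"
  shows "\<exists>p. continuous_on UNIV p \<and> (\<forall>x\<in>F. bd_trace T F g x = p x)"
proof -
  obtain K a b c where K: "K \<in> T" "F edge_of K" "element_at T F = K" using boundary_edgeE[OF F] by metis
  obtain p where p: "continuous_on UNIV p" "\<forall>x\<in>interior K. g x = p x"
    using g K unfolding pwc_def by blast
  have "bd_trace T F g x = p x" if "x \<in> F" for x
    unfolding bd_trace_def K(3) using that K edge_of_imp_subset p by (intro elem_trace_eq) auto
  then show ?thesis using p(1) by blast
qed

lemma bd_trace_comb:
  assumes F: "F \<in> boundary_edges \<Omega> T" and g: "pwc T g" "pwc T h" and x: "x \<in> F"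
  shows "bd_trace T F (\<lambda>x. r *\<^sub>R g x + s *\<^sub>R h x) x = r *\<^sub>R bd_trace T F g x + s *\<^sub>R bd_trace T F h x"
proof -
  obtain K a b c where K: "K \<in> T" "F edge_of K" "element_at T F = K" using boundary_edgeE[OF F] by metis
  then show ?thesis unfolding bd_trace_def using g x edge_of_imp_subset by (intro elem_trace_comb) auto
qed

lemma edge_ip_commute: "edge_ip F g h = edge_ip F h g"
  by (simp add: edge_ip_def mult.commute)

lemma edge_ip_cong:
  assumes F: "F \<in> boundary_edges \<Omega> T" and "\<And>x. x \<in> F \<Longrightarrow> g x * h x = g' x * h' x"
  shows "edge_ip F g h = edge_ip F g' h'"
proof -
  obtain a b where "F = closed_segment a b" using boundary_edgeE[OF F] by metis
  then show ?thesis unfolding edge_ip_def using assms(2) by (rule edge_integral_cong)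
qed

lemma edge_ip_comb:
  assumes F: "F \<in> boundary_edges \<Omega> T" and g: "pwc T g" "pwc T h" "pwc T k"
  shows "edge_ip F (bd_trace T F g) (bd_trace T F (\<lambda>x. r *\<^sub>R h x + s *\<^sub>R k x)) =
    r * edge_ip F (bd_trace T F g) (bd_trace T F h) + s * edge_ip F (bd_trace T F g) (bd_trace T F k)"
proof -
  obtain a b where ab: "F = closed_segment a b" using boundary_edgeE[OF F] by metis
  obtain p where p: "continuous_on UNIV p" "\<forall>x\<in>F. bd_trace T F g x = p x"
    using bd_trace_repr[OF F g(1)] by blast
  obtain q where q: "continuous_on UNIV q" "\<forall>x\<in>F. bd_trace T F h x = q x"
    using bd_trace_repr[OF F g(2)] by blast
  obtain w where w: "continuous_on UNIV w" "\<forall>x\<in>F. bd_trace T F k x = w x"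
    using bd_trace_repr[OF F g(3)] by blast
  have "edge_ip F (bd_trace T F g) (bd_trace T F (\<lambda>x. r *\<^sub>R h x + s *\<^sub>R k x)) =
    edge_integral F (\<lambda>x. r * (p x * q x) + s * (p x * w x))"
    unfolding edge_ip_def using p q w bd_trace_comb[OF F g(2,3)]
    by (intro edge_integral_cong[OF ab]) (simp add: algebra_simps)
  also have "\<dots> = r * edge_integral F (\<lambda>x. p x * q x) + s * edge_integral F (\<lambda>x. p x * w x)"
    using p(1) q(1) w(1) by (intro edge_integral_comb[OF ab] continuous_on_mult)
  also have "edge_integral F (\<lambda>x. p x * q x) = edge_ip F (bd_trace T F g) (bd_trace T F h)"
    unfolding edge_ip_def using p q by (intro edge_integral_cong[OF ab]) simp
  also have "edge_integral F (\<lambda>x. p x * w x) = edge_ip F (bd_trace T F g) (bd_trace T F k)"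
    unfolding edge_ip_def using p w by (intro edge_integral_cong[OF ab]) simp
  finally show ?thesis .
qed

section \<open>The Brinkman form and its relation to the Morley form\<close>

lemma c_form_comb:
  assumes \<phi>: "pwaff T \<phi>" and \<psi>: "pwaff T \<psi>" "pwaff T \<theta>"
  shows "c_form \<Omega> T \<sigma> \<phi> (\<lambda>x. r *\<^sub>R \<psi> x + s *\<^sub>R \<theta> x) =
    r * c_form \<Omega> T \<sigma> \<phi> \<psi> + s * c_form \<Omega> T \<sigma> \<phi> \<theta>"
proof -
  let ?\<xi> = "\<lambda>x. r *\<^sub>R \<psi> x + s *\<^sub>R \<theta> x"
  let ?n = "outward_normal \<Omega>" and ?t = "tangent \<Omega>"
  note d\<phi> = pwaff_derivs[OF \<phi>] and d\<psi> = pwaff_derivs[OF \<psi>(1)] and d\<theta> = pwaff_derivs[OF \<psi>(2)]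
    and d\<xi> = pwaff_derivs[OF pwaff_comb[OF \<psi>]]
  have 1: "ip \<Omega> (vgrad \<phi>) (vgrad ?\<xi>) = r * ip \<Omega> (vgrad \<phi>) (vgrad \<psi>) + s * ip \<Omega> (vgrad \<phi>) (vgrad \<theta>)"
    using ip_cong[OF d\<phi>(3) d\<xi>(3) interior_eq_refl comb_pwaff(2)[OF \<psi>]] ip_comb_right[OF d\<psi>(3) d\<theta>(3) d\<phi>(3)]
    by simp
  have 2: "edge_ip F (bd_trace T F g) (bd_trace T F (\<lambda>x. ?\<xi> x \<bullet> ?t F)) =
      r * edge_ip F (bd_trace T F g) (bd_trace T F (\<lambda>x. \<psi> x \<bullet> ?t F)) +
      s * edge_ip F (bd_trace T F g) (bd_trace T F (\<lambda>x. \<theta> x \<bullet> ?t F))"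
    if "F \<in> boundary_edges \<Omega> T" "pwc T g" for F g
    using edge_ip_comb[OF that d\<psi>(4) d\<theta>(4), of r "?t F" s "?t F"] by (simp add: inner_add_left)
  have 3: "edge_ip F (bd_trace T F g) (bd_trace T F (dir_deriv (?n F) (\<lambda>x. ?\<xi> x \<bullet> ?t F))) =
      r * edge_ip F (bd_trace T F g) (bd_trace T F (dir_deriv (?n F) (\<lambda>x. \<psi> x \<bullet> ?t F))) +
      s * edge_ip F (bd_trace T F g) (bd_trace T F (dir_deriv (?n F) (\<lambda>x. \<theta> x \<bullet> ?t F)))"
    if "F \<in> boundary_edges \<Omega> T" "pwc T g" for F g
    using edge_ip_comb[OF that d\<psi>(5) d\<theta>(5), of r "?n F" "?t F" s "?n F" "?t F"]
      bd_trace_cong[OF that(1) comb_pwaff(3)[OF \<psi>]] by simp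
  show ?thesis unfolding c_form_def Let_def 1
    by (simp only: 2[OF _ d\<phi>(4)] 2[OF _ d\<phi>(5)] 3[OF _ d\<phi>(4)] cong: sum.cong)
      (simp add: sum.distrib sum_distrib_left algebra_simps)
qed

lemma c_form_cong:
  assumes "pwaff T \<phi>" "pwaff T \<psi>" "interior_eq T \<phi> \<phi>'"
  shows "c_form \<Omega> T \<sigma> \<phi> \<psi> = c_form \<Omega> T \<sigma> \<phi>' \<psi>"
proof -
  have v: "interior_eq T (vgrad \<phi>) (vgrad \<phi>')"
    unfolding interior_eq_def
  proof (intro ballI)
    fix K x assume K: "K \<in> T" "x \<in> interior K"
    show "vgrad \<phi> x = vgrad \<phi>' x"
      by (rule vgrad_cong[OF open_interior K(2)]) (rule interior_eqD[OF assms(3) K(1)])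
  qed
  have t: "interior_eq T (\<lambda>x. \<phi> x \<bullet> t) (\<lambda>x. \<phi>' x \<bullet> t)" for t
    using assms(3) by (auto simp: interior_eq_def)
  have n: "interior_eq T (dir_deriv n (\<lambda>x. \<phi> x \<bullet> t)) (dir_deriv n (\<lambda>x. \<phi>' x \<bullet> t))" for n t
    unfolding interior_eq_def
  proof (intro ballI)
    fix K x assume K: "K \<in> T" "x \<in> interior K"
    show "dir_deriv n (\<lambda>x. \<phi> x \<bullet> t) x = dir_deriv n (\<lambda>x. \<phi>' x \<bullet> t) x"
      by (rule dir_deriv_cong[OF open_interior K(2)]) (rule interior_eqD[OF t K(1)])
  qed
  show ?thesis unfolding c_form_def Let_def
    using ip_cong[OF pwaff_derivs(3)[OF assms(1)] pwaff_derivs(3)[OF assms(2)] v interior_eq_refl]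
    by (simp add: bd_trace_cong[OF _ t] bd_trace_cong[OF _ n] cong: sum.cong)
qed

text \<open>The right-hand sides are written as combinations so that the linearity of traces applies.\<close>

lemma curl_tangent:
  assumes "v \<in> pw_polys T 2"
  shows "interior_eq T (\<lambda>x. curl v x \<bullet> tangent \<Omega> F) (\<lambda>x. (-1) *\<^sub>R dir_deriv (outward_normal \<Omega> F) v x + 0 *\<^sub>R v x)" (is ?A)
    "interior_eq T (dir_deriv (outward_normal \<Omega> F) (\<lambda>x. curl v x \<bullet> tangent \<Omega> F))
       (\<lambda>x. (-1) *\<^sub>R dir_deriv (outward_normal \<Omega> F) (dir_deriv (outward_normal \<Omega> F) v) x + 0 *\<^sub>R v x)" (is ?B)
proof -
  let ?n = "outward_normal \<Omega> F" and ?t = "tangent \<Omega> F"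
  \<comment> \<open>The tangent is minus \<open>rot\<close> of the normal while the curl is
    \<open>rot\<close> of the gradient; this is the source of the minus sign.\<close>
  have t: "?t $ 1 = - ?n $ 2" "?t $ 2 = ?n $ 1" by (auto simp: tangent_def Let_def)
  have "curl v x \<bullet> ?t = - dir_deriv ?n v x \<and>
      dir_deriv ?n (\<lambda>x. curl v x \<bullet> ?t) x = - dir_deriv ?n (dir_deriv ?n v) x"
    if K: "K \<in> T" and x: "x \<in> interior K" for K x
  proof -
    obtain a b c d e f where v: "\<forall>x\<in>interior K. v x = qp a b c d e f x"
      using pw_polys_2D[OF assms K] by metis
    have c: "\<forall>x\<in>interior K. curl v x = aff (vector [c, - b]) (vector [e, - 2 * d]) (vector [2 * f, - e]) x"
      using local_qp(2)[OF v] by (simp add: curl_qp)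
    show ?thesis
      unfolding local_qp(5)[OF v x] local_qp(6)[OF v x] local_aff(3)[OF c x] bspec[OF c x]
        dir_deriv_qp dir_deriv_aff aff_inner
      by (simp add: inner_pt t aff_def algebra_simps)
  qed
  then show ?A ?B
    unfolding interior_eq_def by simp_all
qed

text \<open>The volume terms agree by \<open>hess_inner_qp\<close>. In each boundary term both
  factors change sign under \<open>curl_tangent\<close>, so the products are unchanged.\<close>

lemma c_form_curl:
  assumes u: "u \<in> pw_polys T 2" and v: "v \<in> pw_polys T 2"
  shows "c_form \<Omega> T \<sigma> (curl u) (curl v) = a_form \<Omega> T \<sigma> u v"
proof -
  let ?n = "\<lambda>F. dir_deriv (outward_normal \<Omega> F)" and ?tr = "\<lambda>F. bd_trace T F"
    and ?t = "\<lambda>F w x. curl w x \<bullet> tangent \<Omega> F"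
  note pu = pwaff_pw_polys_2[OF u] and pv = pwaff_pw_polys_2[OF v]
  have "interior_eq T (\<lambda>x. hess u x \<bullet> hess v x) (\<lambda>x. vgrad (curl u) x \<bullet> vgrad (curl v) x)"
    unfolding interior_eq_def
  proof (intro ballI)
    fix K x assume K: "K \<in> T" "x \<in> interior K"
    obtain a b c d e f where 1: "\<forall>x\<in>interior K. u x = qp a b c d e f x"
      using pw_polys_2D[OF u K(1)] by metis
    obtain a' b' c' d' e' f' where 2: "\<forall>x\<in>interior K. v x = qp a' b' c' d' e' f' x"
      using pw_polys_2D[OF v K(1)] by metis
    show "hess u x \<bullet> hess v x = vgrad (curl u) x \<bullet> vgrad (curl v) x"
      unfolding local_qp(3,4)[OF 1 K(2)] local_qp(3,4)[OF 2 K(2)] by (rule hess_inner_qp)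
  qed
  then have 1: "ip \<Omega> (vgrad (curl u)) (vgrad (curl v)) = ip \<Omega> (hess u) (hess v)"
    unfolding ip_def by (intro pwc_integral_cong[symmetric] pwc_inner pu pv)
  have 2: "?tr F (?t F w) x = - ?tr F (?n F w) x"
    "?tr F (?n F (?t F w)) x =
      - ?tr F (?n F (?n F w)) x"
    if F: "F \<in> boundary_edges \<Omega> T" "x \<in> F" and w: "w \<in> pw_polys T 2" for F x w
  proof -
    have neg: "?tr F (\<lambda>x. (-1) *\<^sub>R g x + 0 *\<^sub>R w x) x = - ?tr F g x" if "pwc T g" for g
      using bd_trace_comb[OF F(1) that pwc_pw_polys_2[OF w] F(2), of "-1" 0] by simp
    show "?tr F (?t F w) x = - ?tr F (?n F w) x"
      unfolding bd_trace_cong[OF F(1) curl_tangent(1)[OF w]]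
      by (rule neg[OF pwaff_pwc[OF pwaff_pw_polys_2(3)[OF w]]])
    show "?tr F (?n F (?t F w)) x =
      - ?tr F (?n F (?n F w)) x"
      unfolding bd_trace_cong[OF F(1) curl_tangent(2)[OF w]]
      by (rule neg[OF pwaff_pw_polys_2(6)[OF w]])
  qed
  have 3: "edge_ip F (?tr F (?n F (?t F u)))
      (?tr F (?t F v)) =
    edge_ip F (?tr F (?n F (?n F u)))
      (?tr F (?n F v))"
    "edge_ip F (?tr F (?t F u))
      (?tr F (?n F (?t F v))) =
    edge_ip F (?tr F (?n F u))
      (?tr F (?n F (?n F v)))"
    "edge_ip F (?tr F (?t F u)) (?tr F (?t F v)) =
    edge_ip F (?tr F (?n F u)) (?tr F (?n F v))"
    if F: "F \<in> boundary_edges \<Omega> T" for F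
    by (rule edge_ip_cong[OF F], simp add: 2[OF F _ u] 2[OF F _ v])+
  show ?thesis unfolding a_form_def c_form_def Let_def 1 by (simp add: 3 cong: sum.cong)
qed

end

section \<open>The nonconforming spaces\<close>

text \<open>The first identity is the midpoint rule for the affine derivative along a segment. It
  translates vertex values of quadratics into midpoint values of gradients, and so Morley conditions
  into Crouzeix-Raviart conditions.\<close>

lemma polys_2_props:
  assumes "p \<in> polys 2"
  shows "p b - p a = grad p (midpoint a b) \<bullet> (b - a)" "dir_deriv n p x = n \<bullet> grad p x"
    "curl p x = rot (grad p x)" "continuous_on UNIV p" "continuous_on UNIV (grad p)"
proof -
  obtain \<alpha> \<beta> \<gamma> \<delta> \<epsilon> \<zeta> where p: "p = qp \<alpha> \<beta> \<gamma> \<delta> \<epsilon> \<zeta>" using assms unfolding polys_2 by blast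
  show "p b - p a = grad p (midpoint a b) \<bullet> (b - a)"
    unfolding p grad_qp by (simp add: qp_def aff_def inner_pt midpoint_def field_simps power2_eq_square)
  show "dir_deriv n p x = n \<bullet> grad p x"
    unfolding p grad_qp dir_deriv_qp by (simp add: aff_def inner_pt algebra_simps)
  show "curl p x = rot (grad p x)" by (simp add: curl_def grad_def pt_eq_iff)
  show "continuous_on UNIV p" unfolding p by (rule continuous_on_qp)
  show "continuous_on UNIV (grad p)" unfolding p grad_qp by (rule continuous_on_aff)
qed

lemma midpoint_in_convex: "convex S \<Longrightarrow> a \<in> S \<Longrightarrow> b \<in> S \<Longrightarrow> midpoint a b \<in> S"
  using closed_segment_subset[of a S b] midpoint_in_closed_segment[of a b] by blast

lemma rot_inner_rot [simp]: "rot u \<bullet> rot v = u \<bullet> v"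
  by (simp add: inner_pt)

lemma rot_eq_iff [simp]: "rot u = rot v \<longleftrightarrow> u = v"
  by (auto simp: pt_eq_iff)

lemma continuous_on_rot:
  assumes "continuous_on S f" shows "continuous_on S (\<lambda>x. rot (f x))"
proof -
  have *: "(\<lambda>x. rot (f x)) = (\<lambda>x. (f x $ 2) *\<^sub>R axis 1 1 - (f x $ 1) *\<^sub>R axis 2 1)"
    by (rule ext) (simp add: pt_eq_iff)
  show ?thesis unfolding * by (intro continuous_intros continuous_on_component assms)
qed

text \<open>Supplies the gradient of an affine function with prescribed increments along two
  independent edges.\<close>

lemma inner_pair_solvable:
  assumes "cross2 u v \<noteq> 0"
  shows "\<exists>G. G \<bullet> u = \<alpha> \<and> G \<bullet> v = \<beta>"
proof -
  have "cross2 v u = - cross2 u v" by (simp add: cross2_def)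
  then have "((\<alpha> / cross2 u v) *\<^sub>R rot v - (\<beta> / cross2 u v) *\<^sub>R rot u) \<bullet> u = \<alpha>"
    "((\<alpha> / cross2 u v) *\<^sub>R rot v - (\<beta> / cross2 u v) *\<^sub>R rot u) \<bullet> v = \<beta>"
    using assms by (simp_all add: inner_diff_left inner_rot)
  then show ?thesis by blast
qed

lemma content_tri: "tri K a b c \<Longrightarrow> measure lebesgue K = \<bar>cross2 (b - a) (c - a)\<bar> / 2"
proof -
  assume t: "tri K a b c"
  have "K \<in> sets borel" using triD(10)[OF t] by (rule borel_closed)
  then have "measure lebesgue K = measure lborel (convex hull {a, b, c})"
    using triD(1)[OF t] by simp
  then show ?thesis unfolding content_triangle by (simp add: cross2_def abs_if algebra_simps)
qed

text \<open>The divergence theorem on a triangle, since the midpoint rule is exact for affine fields.\<close>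

lemma aff_divergence_triangle:
  "aff p q r (midpoint a b) \<bullet> rot (b - a) + aff p q r (midpoint b c) \<bullet> rot (c - b)
     + aff p q r (midpoint c a) \<bullet> rot (a - c) = (q $ 1 + r $ 2) * cross2 (b - a) (c - a) / 2"
  by (simp add: aff_def inner_pt midpoint_def cross2_def field_simps)

context domain_mesh
begin

lemma polys_traces:
  assumes K: "K \<in> T" "x \<in> K" and p: "p \<in> polys 2" "\<forall>y\<in>interior K. v y = p y"
  shows "elem_trace K v x = p x" "elem_trace K (curl v) x = rot (grad p x)"
    "elem_trace K (dir_deriv n v) x = n \<bullet> grad p x"
proof -
  note pp = polys_2_props[OF p(1)]
  show "elem_trace K v x = p x" by (rule elem_trace_eq[OF K pp(4) p(2)])
  have "curl v y = rot (grad p y)" if "y \<in> interior K" for y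
    using curl_cong[OF open_interior that, of v p] p(2) pp(3) by simp
  moreover have "continuous_on UNIV (\<lambda>y. rot (grad p y))"
    by (rule continuous_on_rot[OF pp(5)])
  ultimately show "elem_trace K (curl v) x = rot (grad p x)" by (intro elem_trace_eq[OF K]) auto
  have "dir_deriv n v y = n \<bullet> grad p y" if "y \<in> interior K" for y
    using dir_deriv_cong[OF open_interior that, of v p] p(2) pp(2) by simp
  then show "elem_trace K (dir_deriv n v) x = n \<bullet> grad p x"
    using pp(5) by (intro elem_trace_eq[OF K]) (auto intro!: continuous_intros)
qed

lemma pwaff_trace:
  assumes "K \<in> T" "\<forall>y\<in>interior K. \<psi> y = aff p q r y" "x \<in> K"
  shows "elem_trace K \<psi> x = aff p q r x"
  using assms continuous_on_aff by (intro elem_trace_eq) auto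

lemma mesh_edge_points:
  assumes "K \<in> T" "closed_segment a b edge_of K"
  obtains c where "tri K a b c"
proof -
  have "a \<noteq> b" using assms(2) by (auto simp: edge_of_def)
  then show ?thesis using closed_segment_tri[OF assms(1) _ assms(2)] that by blast
qed

lemma edge_jump_integral:
  fixes \<psi> :: "pt \<Rightarrow> real^2"
  assumes K: "K \<in> T" "K' \<in> T" and F: "closed_segment a b edge_of K" "closed_segment a b edge_of K'"
    and \<psi>: "pwaff T \<psi>"
  shows "edge_integral (closed_segment a b) (\<lambda>x. (elem_trace K \<psi> x - elem_trace K' \<psi> x) \<bullet> t) =
    dist a b * ((elem_trace K \<psi> (midpoint a b) - elem_trace K' \<psi> (midpoint a b)) \<bullet> t)"
proof -
  have sub: "closed_segment a b \<subseteq> K" "closed_segment a b \<subseteq> K'" using F edge_of_imp_subset by auto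
  obtain p q r where 1: "\<forall>y\<in>interior K. \<psi> y = aff p q r y" using \<psi> K unfolding pwaff_def by blast
  obtain p' q' r' where 2: "\<forall>y\<in>interior K'. \<psi> y = aff p' q' r' y" using \<psi> K unfolding pwaff_def by blast
  have *: "(elem_trace K \<psi> x - elem_trace K' \<psi> x) \<bullet> t = aff ((p - p') \<bullet> t) ((q - q') \<bullet> t) ((r - r') \<bullet> t) x"
    if "x \<in> closed_segment a b" for x
  proof -
    have "elem_trace K \<psi> x = aff p q r x" "elem_trace K' \<psi> x = aff p' q' r' x"
      using pwaff_trace[OF K(1) 1, of x] pwaff_trace[OF K(2) 2, of x] that sub by auto
    then show ?thesis by (simp add: aff_def inner_add_left inner_diff_left algebra_simps)
  qed
  show ?thesis
    using edge_integral_aff[of "closed_segment a b" a b, OF refl *] *[of "midpoint a b"] by simp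
qed

lemma edge_flux_integral:
  fixes \<psi> :: "pt \<Rightarrow> real^2"
  assumes K: "K \<in> T" and F: "closed_segment a b edge_of K" and \<psi>: "pwaff T \<psi>"
  shows "edge_integral (closed_segment a b) (\<lambda>x. elem_trace K \<psi> x \<bullet> t) =
    dist a b * (elem_trace K \<psi> (midpoint a b) \<bullet> t)"
proof -
  obtain p q r where 1: "\<forall>y\<in>interior K. \<psi> y = aff p q r y" using \<psi> K unfolding pwaff_def by blast
  have *: "elem_trace K \<psi> x \<bullet> t = aff (p \<bullet> t) (q \<bullet> t) (r \<bullet> t) x" if "x \<in> closed_segment a b" for x
    using pwaff_trace[OF K 1, of x] that edge_of_imp_subset[OF F] by (auto simp: aff_inner)
  show ?thesis
    using edge_integral_aff[of "closed_segment a b" a b, OF refl *] *[of "midpoint a b"] by simp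
qed

text \<open>The edge conditions are midpoint conditions because affine functions are integrated by their
  midpoint values.\<close>

lemma cr_space_iff:
  "\<psi> \<in> cr_space \<Omega> T \<longleftrightarrow> pwaff T \<psi> \<and>
    (\<forall>K\<in>T. \<forall>K'\<in>T. \<forall>a b. closed_segment a b edge_of K \<and> closed_segment a b edge_of K' \<longrightarrow>
       elem_trace K \<psi> (midpoint a b) = elem_trace K' \<psi> (midpoint a b)) \<and>
    (\<forall>K\<in>T. \<forall>a b. closed_segment a b edge_of K \<and> closed_segment a b \<subseteq> frontier \<Omega> \<longrightarrow>
       elem_trace K \<psi> (midpoint a b) \<bullet> rot (b - a) = 0)" (is "_ \<longleftrightarrow> ?R")
proof (cases "pwaff T \<psi>")
  case False
  then show ?thesis unfolding cr_space_def using pwaff_components[of \<psi> T] by blast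
next
  case \<psi>: True
  have pos: "dist a b \<noteq> 0" if "K \<in> T" "closed_segment a b edge_of K" for K a b
    using mesh_edge_points[OF that] triD(3) by (metis dist_eq_0_iff)
  have 1: "(\<forall>i. edge_integral F (\<lambda>x. (elem_trace K \<psi> x - elem_trace K' \<psi> x) $ i) = 0) \<longleftrightarrow>
      elem_trace K \<psi> (midpoint a b) = elem_trace K' \<psi> (midpoint a b)"
    if K: "K \<in> T" "K' \<in> T" "closed_segment a b edge_of K" "closed_segment a b edge_of K'"
      and F: "F = closed_segment a b" for K K' a b F
  proof -
    have "edge_integral F (\<lambda>x. (elem_trace K \<psi> x - elem_trace K' \<psi> x) $ i) =
        dist a b * (elem_trace K \<psi> (midpoint a b) - elem_trace K' \<psi> (midpoint a b)) $ i" for i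
      using edge_jump_integral[OF K \<psi>, of "axis i 1"] unfolding F inner_axis by simp
    then show ?thesis using pos[OF K(1,3)] by (auto simp: vec_eq_iff)
  qed
  have 2: "edge_integral F (\<lambda>x. bd_trace T F \<psi> x \<bullet> outward_normal \<Omega> F) = 0 \<longleftrightarrow>
      elem_trace K \<psi> (midpoint a b) \<bullet> rot (b - a) = 0"
    if K: "K \<in> T" "closed_segment a b edge_of K" "closed_segment a b \<subseteq> frontier \<Omega>"
      and F: "F = closed_segment a b" for K a b F
  proof -
    obtain c where t: "tri K a b c" using mesh_edge_points[OF K(1,2)] .
    have "edge_integral F (\<lambda>x. bd_trace T F \<psi> x \<bullet> outward_normal \<Omega> F) =
        dist a b * (elem_trace K \<psi> (midpoint a b) \<bullet> outward_normal K F)"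
      unfolding bd_trace_def F element_at_eq[OF K] boundary_normal[OF K] edge_flux_integral[OF K(1,2) \<psi>] ..
    also have "\<dots> = sgn (cross2 (b - a) (c - a)) * (elem_trace K \<psi> (midpoint a b) \<bullet> rot (b - a))"
      unfolding F outward_normal_tri[OF t] using pos[OF K(1,2)] by simp
    finally show ?thesis using triD(2)[OF t] by (simp add: sgn_eq_0_iff)
  qed
  show ?thesis
  proof
    assume c: "\<psi> \<in> cr_space \<Omega> T"
    have "elem_trace K \<psi> (midpoint a b) = elem_trace K' \<psi> (midpoint a b)"
      if "K \<in> T" "K' \<in> T" "closed_segment a b edge_of K" "closed_segment a b edge_of K'" for K K' a b
    proof (cases "K = K'")
      case False
      then show ?thesis using c 1[OF that refl] that unfolding cr_space_def by blast
    qed simp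
    moreover have "elem_trace K \<psi> (midpoint a b) \<bullet> rot (b - a) = 0"
      if "K \<in> T" "closed_segment a b edge_of K" "closed_segment a b \<subseteq> frontier \<Omega>" for K a b
      using c 2[OF that refl] that unfolding cr_space_def boundary_edges_def by blast
    ultimately show ?R
      using \<psi> by blast
  next
    assume r: ?R
    have "\<forall>i. edge_integral F (\<lambda>x. (elem_trace K \<psi> x - elem_trace K' \<psi> x) $ i) = 0"
      if K: "K \<in> T" "K' \<in> T" "F edge_of K" "F edge_of K'" for K K' F
    proof -
      obtain a b c where "tri K a b c" "F = closed_segment a b" using mesh_edge[OF K(1,3)] .
      then show ?thesis using 1[of K K' a b F] r K by blast
    qed
    moreover have "edge_integral F (\<lambda>x. bd_trace T F \<psi> x \<bullet> outward_normal \<Omega> F) = 0"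
      if F: "F \<in> boundary_edges \<Omega> T" for F
    proof -
      obtain K a b where "K \<in> T" "F edge_of K" "F \<subseteq> frontier \<Omega>" "F = closed_segment a b"
        using boundary_edgeE[OF F] by metis
      then show ?thesis using 2[of K a b F] r by blast
    qed
    ultimately show "\<psi> \<in> cr_space \<Omega> T"
      unfolding cr_space_def using pwaff_components[of \<psi> T] \<psi> by blast
  qed
qed

lemma cr_space_comb:
  assumes "\<phi> \<in> cr_space \<Omega> T" "\<psi> \<in> cr_space \<Omega> T"
  shows "(\<lambda>x. r *\<^sub>R \<phi> x + s *\<^sub>R \<psi> x) \<in> cr_space \<Omega> T"
proof -
  have a: "pwaff T \<phi>" "pwaff T \<psi>" using assms unfolding cr_space_iff by blast+
  have mid: "midpoint a b \<in> K" if "closed_segment a b edge_of K" for a b K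
    using edge_of_imp_subset[OF that] by (meson midpoints_in_convex_hull subsetD midpoint_in_closed_segment)
  have tr: "elem_trace K (\<lambda>x. r *\<^sub>R \<phi> x + s *\<^sub>R \<psi> x) (midpoint a b) =
      r *\<^sub>R elem_trace K \<phi> (midpoint a b) + s *\<^sub>R elem_trace K \<psi> (midpoint a b)"
    if "K \<in> T" "closed_segment a b edge_of K" for K a b
    using elem_trace_comb[OF that(1) mid[OF that(2)] a[THEN pwaff_pwc]] .
  show ?thesis
    unfolding cr_space_iff[of "\<lambda>x. r *\<^sub>R \<phi> x + s *\<^sub>R \<psi> x"]
  proof (intro conjI ballI allI impI)
    show "pwaff T (\<lambda>x. r *\<^sub>R \<phi> x + s *\<^sub>R \<psi> x)" by (rule pwaff_comb[OF a])
    fix K K' a b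
    assume K: "K \<in> T" "K' \<in> T" "closed_segment a b edge_of K \<and> closed_segment a b edge_of K'"
    have "elem_trace K \<phi> (midpoint a b) = elem_trace K' \<phi> (midpoint a b)"
      "elem_trace K \<psi> (midpoint a b) = elem_trace K' \<psi> (midpoint a b)"
      using assms K unfolding cr_space_iff by blast+
    then show "elem_trace K (\<lambda>x. r *\<^sub>R \<phi> x + s *\<^sub>R \<psi> x) (midpoint a b) =
      elem_trace K' (\<lambda>x. r *\<^sub>R \<phi> x + s *\<^sub>R \<psi> x) (midpoint a b)" using tr K by simp
  next
    fix K a b
    assume K: "K \<in> T" "closed_segment a b edge_of K \<and> closed_segment a b \<subseteq> frontier \<Omega>"
    have "elem_trace K \<phi> (midpoint a b) \<bullet> rot (b - a) = 0" "elem_trace K \<psi> (midpoint a b) \<bullet> rot (b - a) = 0"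
      using assms K unfolding cr_space_iff by blast+
    then show "elem_trace K (\<lambda>x. r *\<^sub>R \<phi> x + s *\<^sub>R \<psi> x) (midpoint a b) \<bullet> rot (b - a) = 0"
      using tr K by (simp add: inner_add_left)
  qed
qed

section \<open>The Morley space and its curls\<close>

lemma mwx_pw_polys: "v \<in> mwx_space0 \<Omega> T \<Longrightarrow> v \<in> pw_polys T 2"
  by (simp add: mwx_space0_def mwx_space_def)

lemma mwx_vertex:
  assumes "v \<in> mwx_space0 \<Omega> T" "K \<in> T" "K' \<in> T" "a extreme_point_of K" "a extreme_point_of K'"
  shows "elem_trace K v a = elem_trace K' v a"
proof -
  have "\<forall>K\<in>T. \<forall>K'\<in>T. \<forall>a. a extreme_point_of K \<and> a extreme_point_of K' \<longrightarrow> elem_trace K v a = elem_trace K' v a"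
    using assms(1) unfolding mwx_space0_def mwx_space_def by (elim CollectE conjE) assumption
  from mp[OF spec[OF bspec[OF bspec[OF this assms(2)] assms(3)]] conjI[OF assms(4,5)]] show ?thesis .
qed

lemma mwx_normal:
  assumes "v \<in> mwx_space0 \<Omega> T" "K \<in> T" "K' \<in> T" "closed_segment a b edge_of K" "closed_segment a b edge_of K'"
  shows "elem_trace K (dir_deriv (outward_normal K (closed_segment a b)) v) (midpoint a b) =
    elem_trace K' (dir_deriv (outward_normal K (closed_segment a b)) v) (midpoint a b)"
proof -
  have "\<forall>K\<in>T. \<forall>K'\<in>T. \<forall>a b. closed_segment a b edge_of K \<and> closed_segment a b edge_of K' \<longrightarrow>
      elem_trace K (dir_deriv (outward_normal K (closed_segment a b)) v) (midpoint a b) =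
      elem_trace K' (dir_deriv (outward_normal K (closed_segment a b)) v) (midpoint a b)"
    using assms(1) unfolding mwx_space0_def mwx_space_def Let_def by (elim CollectE conjE) assumption
  from mp[OF spec[OF spec[OF bspec[OF bspec[OF this assms(2)] assms(3)]]] conjI[OF assms(4,5)]] show ?thesis .
qed

lemma mwx_boundary:
  assumes "v \<in> mwx_space0 \<Omega> T" "K \<in> T" "a extreme_point_of K" "a \<in> frontier \<Omega>"
  shows "elem_trace K v a = 0"
  using assms unfolding mwx_space0_def by blast

lemma mwx_space0_comb:
  assumes u: "u \<in> mwx_space0 \<Omega> T" and v: "v \<in> mwx_space0 \<Omega> T"
  shows "(\<lambda>x. r *\<^sub>R u x + s *\<^sub>R v x) \<in> mwx_space0 \<Omega> T"
proof -
  let ?w = "\<lambda>x. r *\<^sub>R u x + s *\<^sub>R v x"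
  note pu = mwx_pw_polys[OF u] and pv = mwx_pw_polys[OF v]
  have t: "elem_trace K ?w a = r *\<^sub>R elem_trace K u a + s *\<^sub>R elem_trace K v a" if "K \<in> T" "a extreme_point_of K" for K a
    using elem_trace_comb[OF that(1) _ pwc_pw_polys_2[OF pu] pwc_pw_polys_2[OF pv]] that(2)
    by (simp add: extreme_point_of_def)
  have n: "elem_trace K (dir_deriv n ?w) (midpoint a b) = r *\<^sub>R elem_trace K (dir_deriv n u) (midpoint a b)
      + s *\<^sub>R elem_trace K (dir_deriv n v) (midpoint a b)"
    if K: "K \<in> T" "closed_segment a b edge_of K" for K n a b
  proof -
    have "midpoint a b \<in> K" using edge_of_imp_subset[OF K(2)] midpoint_in_closed_segment by blast
    moreover have "elem_trace K (dir_deriv n ?w) = elem_trace K (\<lambda>x. r *\<^sub>R dir_deriv n u x + s *\<^sub>R dir_deriv n v x)"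
      using comb_pw_polys_2(3)[OF pu pv] K(1) unfolding interior_eq_def by (intro elem_trace_cong) blast
    ultimately show ?thesis
      using elem_trace_comb[OF K(1) _ pwaff_pwc[OF pwaff_pw_polys_2(3)[OF pu]] pwaff_pwc[OF pwaff_pw_polys_2(3)[OF pv]]]
      by simp
  qed
  show ?thesis unfolding mwx_space0_def mwx_space_def Let_def
  proof (intro CollectI conjI ballI allI impI)
    show "?w \<in> pw_polys T 2" by (rule pw_polys_2_comb[OF pu pv])
    fix K assume K: "K \<in> T"
    { fix K' a assume K': "K' \<in> T" and a: "a extreme_point_of K \<and> a extreme_point_of K'"
      then have "elem_trace K u a = elem_trace K' u a" "elem_trace K v a = elem_trace K' v a"
        using mwx_vertex[OF u K K'] mwx_vertex[OF v K K'] by simp_all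
      then show "elem_trace K ?w a = elem_trace K' ?w a" using t[OF K] t[OF K'] a by simp
    next
      fix K' a b assume K': "K' \<in> T" and a: "closed_segment a b edge_of K \<and> closed_segment a b edge_of K'"
      let ?n = "outward_normal K (closed_segment a b)"
      have "elem_trace K (dir_deriv ?n u) (midpoint a b) = elem_trace K' (dir_deriv ?n u) (midpoint a b)"
        "elem_trace K (dir_deriv ?n v) (midpoint a b) = elem_trace K' (dir_deriv ?n v) (midpoint a b)"
        using mwx_normal[OF u K K'] mwx_normal[OF v K K'] a by simp_all
      then show "elem_trace K (dir_deriv ?n ?w) (midpoint a b) = elem_trace K' (dir_deriv ?n ?w) (midpoint a b)"
        using n[OF K] n[OF K'] a by simp
    next
      fix a assume a: "a extreme_point_of K \<and> a \<in> frontier \<Omega>"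
      then have "elem_trace K u a = 0" "elem_trace K v a = 0"
        using mwx_boundary[OF u K] mwx_boundary[OF v K] by simp_all
      then show "elem_trace K ?w a = 0" using t[OF K] a by simp
    }
  qed
qed

text \<open>Equal values at the ends of an edge give equal tangential derivatives at its midpoint,
  and the normal derivatives agree there by definition; so the whole gradient is continuous at
  midpoints. On boundary edges the vertex values vanish, which kills the tangential derivative, that
  is, the normal component of the curl.\<close>

lemma curl_in_cr_space:
  assumes v: "v \<in> mwx_space0 \<Omega> T"
  shows "curl v \<in> cr_space \<Omega> T"
  unfolding cr_space_iff
proof (intro conjI ballI allI impI)
  note pv = mwx_pw_polys[OF v]
  show "pwaff T (curl v)" by (rule pwaff_pw_polys_2(2)[OF pv])
  have edge: "\<exists>p\<in>polys 2. (\<forall>x\<in>interior K. v x = p x) \<and> a extreme_point_of K \<and> b extreme_point_of K \<and>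
      elem_trace K v a = p a \<and> elem_trace K v b = p b \<and>
      elem_trace K (curl v) (midpoint a b) = rot (grad p (midpoint a b)) \<and>
      (\<forall>n. elem_trace K (dir_deriv n v) (midpoint a b) = n \<bullet> grad p (midpoint a b))"
    if K: "K \<in> T" "closed_segment a b edge_of K" for K a b
  proof -
    obtain p where p: "p \<in> polys 2" "\<forall>x\<in>interior K. v x = p x" using pv K unfolding pw_polys_def by blast
    obtain c where t: "tri K a b c" using mesh_edge_points[OF K] .
    have in_K: "a \<in> K" "b \<in> K" "midpoint a b \<in> K"
      using triD[OF t] edge_of_imp_subset[OF K(2)] midpoint_in_closed_segment by blast+
    show ?thesis using p tri_extreme_point[OF t] polys_traces[OF K(1) _ p] in_K by (intro bexI[of _ p]) auto
  qed
  { fix K K' a b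
    assume K: "K \<in> T" "K' \<in> T" and "closed_segment a b edge_of K \<and> closed_segment a b edge_of K'"
    then have F: "closed_segment a b edge_of K" "closed_segment a b edge_of K'" by auto
    obtain c where t: "tri K a b c" using mesh_edge_points[OF K(1) F(1)] .
    let ?m = "midpoint a b" and ?n = "outward_normal K (closed_segment a b)"
    obtain p where p: "p \<in> polys 2" "a extreme_point_of K" "b extreme_point_of K"
      "elem_trace K v a = p a" "elem_trace K v b = p b" "elem_trace K (curl v) ?m = rot (grad p ?m)"
      "elem_trace K (dir_deriv ?n v) ?m = ?n \<bullet> grad p ?m"
      using edge[OF K(1) F(1)] by blast
    obtain q where q: "q \<in> polys 2" "a extreme_point_of K'" "b extreme_point_of K'"
      "elem_trace K' v a = q a" "elem_trace K' v b = q b" "elem_trace K' (curl v) ?m = rot (grad q ?m)"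
      "elem_trace K' (dir_deriv ?n v) ?m = ?n \<bullet> grad q ?m"
      using edge[OF K(2) F(2)] by blast
    have "elem_trace K v a = elem_trace K' v a" "elem_trace K v b = elem_trace K' v b"
      using mwx_vertex[OF v K] p(2,3) q(2,3) by simp_all
    then have "(grad p ?m - grad q ?m) \<bullet> (b - a) = 0"
      using p(4,5) q(4,5) polys_2_props(1)[OF p(1), of b a] polys_2_props(1)[OF q(1), of b a]
      by (simp add: inner_diff_left)
    moreover have "elem_trace K (dir_deriv ?n v) ?m = elem_trace K' (dir_deriv ?n v) ?m"
      by (rule mwx_normal[OF v K F])
    then have "?n \<bullet> (grad p ?m - grad q ?m) = 0" using p(7) q(7) by (simp add: inner_diff_right)
    then have "(grad p ?m - grad q ?m) \<bullet> rot (b - a) = 0"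
      unfolding outward_normal_tri[OF t] using triD[OF t] by (simp add: inner_commute sgn_eq_0_iff)
    ultimately have "grad p ?m - grad q ?m = 0"
      by (rule linear_orthogonal_frame) (use triD(3)[OF t] in simp)
    then show "elem_trace K (curl v) ?m = elem_trace K' (curl v) ?m" using p(6) q(6) by simp
  next
    fix K a b
    assume K: "K \<in> T" and "closed_segment a b edge_of K \<and> closed_segment a b \<subseteq> frontier \<Omega>"
    then have F: "closed_segment a b edge_of K" "a \<in> frontier \<Omega>" "b \<in> frontier \<Omega>" by auto
    obtain p where p: "p \<in> polys 2" "a extreme_point_of K" "b extreme_point_of K"
      "elem_trace K v a = p a" "elem_trace K v b = p b"
      "elem_trace K (curl v) (midpoint a b) = rot (grad p (midpoint a b))"
      using edge[OF K F(1)] by blast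
    have "elem_trace K v a = 0" "elem_trace K v b = 0"
      using mwx_boundary[OF v K] p(2,3) F(2,3) by simp_all
    then show "elem_trace K (curl v) (midpoint a b) \<bullet> rot (b - a) = 0"
      using p(4-6) polys_2_props(1)[OF p(1), of b a] by simp
  }
qed

section \<open>Divergences of Crouzeix-Raviart fields\<close>

lemma dvg_curl:
  assumes "v \<in> pw_polys T 2" shows "interior_eq T (dvg (curl v)) (\<lambda>x. 0)"
  unfolding interior_eq_def
proof (intro ballI)
  fix K x assume K: "K \<in> T" "x \<in> interior K"
  obtain a b c d e f where "\<forall>x\<in>interior K. v x = qp a b c d e f x"
    using pw_polys_2D[OF assms K(1)] by metis
  from local_qp(7)[OF this K(2)] show "dvg (curl v) x = 0" by (simp add: curl_qp dvg_aff)
qed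

text \<open>Sum the divergence theorem over the elements and regroup by edges: on an interior edge
  the midpoint values agree and the normals are opposite, on a boundary edge the flux is zero. Hence
  divergences are admissible pressures and test functions in \<open>pw_const_space0\<close>.\<close>

lemma cr_divergence_mean:
  assumes \<psi>: "\<psi> \<in> cr_space \<Omega> T"
  shows "(LINT x|lebesgue_on \<Omega>. dvg \<psi> x) = 0"
proof -
  have a: "pwaff T \<psi>" using \<psi> unfolding cr_space_iff by blast
  then obtain p q r where aff: "\<And>K. K \<in> T \<Longrightarrow> \<forall>x\<in>interior K. \<psi> x = aff (p K) (q K) (r K) x"
    unfolding pwaff_def by metis
  define k where "k K = q K $ 1 + r K $ 2" for K
  have k: "dvg \<psi> x = k K" if "K \<in> T" "x \<in> interior K" for K x
    using local_aff(1)[OF aff[OF that(1)] that(2)] by (simp add: dvg_aff k_def)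
  \<comment> \<open>The flux of \<open>\<psi>\<close> out of \<open>K\<close> through the edge
    \<open>F\<close>.\<close>
  define J where "J K F = edge_integral F (\<lambda>x. elem_trace K \<psi> x \<bullet> outward_normal K F)" for K F
  have J: "J K (closed_segment a b) =
      sgn (cross2 (b - a) (c - a)) * (elem_trace K \<psi> (midpoint a b) \<bullet> rot (b - a))"
    if "K \<in> T" "tri K a b c" for K a b c
  proof -
    have e: "closed_segment a b edge_of K" using tri_edge_iff[OF that(2)] by blast
    show ?thesis unfolding J_def edge_flux_integral[OF that(1) e a] outward_normal_tri[OF that(2)]
      using triD(3)[OF that(2)] by simp
  qed
  have local: "k K * measure lebesgue K = (\<Sum>F | F edge_of K. J K F)" if K: "K \<in> T" for K
  proof -
    obtain a b c where t: "tri K a b c" using mesh_tri[OF K] .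
    note t2 = tri_rotate[OF t] and t3 = tri_rotate[OF tri_rotate[OF t]]
    \<comment> \<open>Signed area is invariant under cyclic relabelling, so one common sign factors
      out of the three fluxes.\<close>
    have cr: "cross2 (c - b) (a - b) = cross2 (b - a) (c - a)" "cross2 (a - c) (b - c) = cross2 (b - a) (c - a)"
      by (auto simp: cross2_def algebra_simps)
    have in_K: "midpoint a b \<in> K" "midpoint b c \<in> K" "midpoint c a \<in> K"
      using triD(8,11-13)[OF t] by (auto intro: midpoint_in_convex)
    have "(\<Sum>F | F edge_of K. J K F) = sgn (cross2 (b - a) (c - a)) *
       (aff (p K) (q K) (r K) (midpoint a b) \<bullet> rot (b - a) + aff (p K) (q K) (r K) (midpoint b c) \<bullet> rot (c - b)
       + aff (p K) (q K) (r K) (midpoint c a) \<bullet> rot (a - c))"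
      unfolding sum_tri_edges[OF t] J[OF K t] J[OF K t2] J[OF K t3] cr
        pwaff_trace[OF K aff[OF K] in_K(1)] pwaff_trace[OF K aff[OF K] in_K(2)] pwaff_trace[OF K aff[OF K] in_K(3)]
      by (simp add: algebra_simps)
    also have "\<dots> = k K * (\<bar>cross2 (b - a) (c - a)\<bar> / 2)"
      unfolding aff_divergence_triangle k_def by (simp add: abs_sgn algebra_simps)
    finally show ?thesis unfolding content_tri[OF t] by simp
  qed
  define E where "E = (\<Union>K\<in>T. {F. F edge_of K})"
  have finE: "finite E"
  proof -
    have "finite {F. F edge_of K}" if K: "K \<in> T" for K
    proof -
      obtain a b c where t: "tri K a b c" using mesh_tri[OF K] .
      have "{F. F edge_of K} = {closed_segment a b, closed_segment b c, closed_segment c a}"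
        using tri_edge_iff[OF t] by blast
      then show ?thesis by simp
    qed
    then show ?thesis unfolding E_def using finite_mesh by blast
  qed
  have edge: "(\<Sum>K | K \<in> T \<and> F edge_of K. J K F) = 0" if F: "F \<in> E" for F
  proof -
    obtain K where K: "K \<in> T" "F edge_of K" using F E_def by blast
    obtain a b c where t: "tri K a b c" "F = closed_segment a b" using mesh_edge[OF K] .
    show ?thesis
    proof (cases "F \<subseteq> frontier \<Omega>")
      case True
      then have "{K. K \<in> T \<and> F edge_of K} = {K}" using K boundary_element_unique by blast
      moreover have "elem_trace K \<psi> (midpoint a b) \<bullet> rot (b - a) = 0"
        using \<psi> K t(2) True unfolding cr_space_iff by blast
      ultimately show ?thesis using J[OF K(1) t(1)] t(2) by simp
    next
      case False
      then obtain K' where K': "K' \<in> T" "K' \<noteq> K" "F edge_of K'" using interior_edge_neighbour[OF K] by metis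
      have "{K. K \<in> T \<and> F edge_of K} = {K, K'}"
        using K K' at_most_two_elements[OF K(1) K'(1) _ K(2) K'(3)] by blast
      then have "(\<Sum>K | K \<in> T \<and> F edge_of K. J K F) = J K F + J K' F" using K'(2) by simp
      moreover obtain c' where t': "tri K' a b c'" using mesh_edge_points K'(1,3) t(2) by blast
      moreover have "elem_trace K \<psi> (midpoint a b) = elem_trace K' \<psi> (midpoint a b)"
        using \<psi> K K' t(2) unfolding cr_space_iff by blast
      ultimately show ?thesis
        using J[OF K(1) t(1)] J[OF K'(1) t'] mesh_opposite[OF K(1) K'(1) K'(2)[symmetric] t(1) t'] t(2) by simp
    qed
  qed
  have "(LINT x|lebesgue_on \<Omega>. dvg \<psi> x) = (\<Sum>K\<in>T. k K * measure lebesgue K)"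
    using k by (rule integral_pw_const)
  also have "\<dots> = (\<Sum>K\<in>T. \<Sum>F | F \<in> E \<and> F edge_of K. J K F)"
    using local by (intro sum.cong refl) (auto simp: E_def intro!: sum.cong)
  also have "\<dots> = (\<Sum>F\<in>E. \<Sum>K | K \<in> T \<and> F edge_of K. J K F)"
    by (rule sum.swap_restrict[OF finite_mesh finE])
  also have "\<dots> = 0" using edge by simp
  finally show ?thesis .
qed

section \<open>Exactness of the discrete complex\<close>


text \<open>The relative frontier of a bounded convex set is connected except in dimension one, and
  an open nonempty planar set has dimension two.\<close>

lemma connected_domain_frontier: "connected (frontier \<Omega>)"
proof -
  have "aff_dim \<Omega> = 2" using aff_dim_open[OF domain(1,4)] by simp
  then have "connected (rel_frontier \<Omega>)" using domain by (intro connected_sphere_gen) auto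
  then show ?thesis using domain by (simp add: rel_frontier_nonempty_interior interior_open)
qed

lemma finite_vertices: "finite {a. \<exists>K\<in>T. a extreme_point_of K}"
proof -
  have "finite {a. a extreme_point_of K}" if K: "K \<in> T" for K
  proof -
    obtain a b c where "tri K a b c" using mesh_tri[OF K] .
    then have "{a. a extreme_point_of K} = {a, b, c}" using tri_extreme_point by blast
    then show ?thesis by simp
  qed
  then have "finite (\<Union>K\<in>T. {a. a extreme_point_of K})" using finite_mesh by blast
  then show ?thesis by (rule rev_finite_subset) blast
qed

text \<open>A point outside the interior has a vanishing barycentric coordinate, which places it on
  the edge opposite to that vertex.\<close>

lemma tri_boundary_segment:
  assumes t: "tri K a b c" and x: "x \<in> K" "x \<notin> interior K"
  obtains F where "F edge_of K" "x \<in> F"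
proof -
  obtain u v w where uvw: "0 \<le> u" "0 \<le> v" "0 \<le> w" "u + v + w = 1" "x = u *\<^sub>R a + v *\<^sub>R b + w *\<^sub>R c"
    using x(1) unfolding triD(1)[OF t] convex_hull_3 by blast
  have "u = 0 \<or> v = 0 \<or> w = 0"
  proof (rule ccontr)
    assume "\<not> ?thesis"
    then have "0 < u" "0 < v" "0 < w" using uvw by auto
    then show False using x(2) uvw unfolding tri_interior[OF t] by blast
  qed
  then consider "w = 0" | "u = 0" | "v = 0" by blast
  then show ?thesis
  proof cases
    case 1
    then have "u = 1 - v" "x = u *\<^sub>R a + v *\<^sub>R b" using uvw by auto
    then have "x \<in> closed_segment a b" using uvw by (auto simp: in_segment)
    then show ?thesis using that tri_edge_iff[OF t] by blast
  next
    case 2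
    then have "v = 1 - w" "x = v *\<^sub>R b + w *\<^sub>R c" using uvw by auto
    then have "x \<in> closed_segment b c" using uvw by (auto simp: in_segment)
    then show ?thesis using that tri_edge_iff[OF t] by blast
  next
    case 3
    then have "w = 1 - u" "x = w *\<^sub>R c + u *\<^sub>R a" using uvw by (auto simp: add.commute)
    then have "x \<in> closed_segment c a" using uvw by (auto simp: in_segment)
    then show ?thesis using that tri_edge_iff[OF t] by blast
  qed
qed

text \<open>A frontier point that is not a vertex lies inside a boundary edge, so a continuous function
  that is constant on each boundary edge has finite range on the connected frontier.\<close>

lemma constant_on_frontier:
  fixes g :: "pt \<Rightarrow> real"
  assumes cont: "continuous_on (frontier \<Omega>) g"
    and edge: "\<And>K a b x. K \<in> T \<Longrightarrow> closed_segment a b edge_of K \<Longrightarrow> closed_segment a b \<subseteq> frontier \<Omega> \<Longrightarrow>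
      x \<in> closed_segment a b \<Longrightarrow> g x = g a"
  shows "\<exists>c. \<forall>x\<in>frontier \<Omega>. g x = c"
proof -
  let ?V = "{a. \<exists>K\<in>T. a extreme_point_of K}"
  have "g x \<in> g ` ?V" if x: "x \<in> frontier \<Omega>" for x
  proof -
    have fr: "frontier \<Omega> = closure \<Omega> - \<Omega>" using domain(1) by (simp add: frontier_def interior_open)
    then obtain K where K: "K \<in> T" "x \<in> K" using x Union_mesh by blast
    obtain a0 b0 c0 where t0: "tri K a0 b0 c0" using mesh_tri[OF K(1)] .
    have "x \<notin> interior K" using x mesh_interior_subset[OF K(1)] unfolding fr by blast
    then obtain F where F: "F edge_of K" "x \<in> F" using tri_boundary_segment[OF t0 K(2)] by blast
    obtain a b c where t: "tri K a b c" "F = closed_segment a b" using mesh_edge[OF K(1) F(1)] .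
    have ext: "a \<in> ?V" "b \<in> ?V" using tri_extreme_point[OF t(1)] K(1) by blast+
    show ?thesis
    proof (cases "x = a \<or> x = b")
      case False
      then have "x \<in> rel_interior F"
        using F(2) triD(3)[OF t(1)] unfolding t(2) by (simp add: rel_interior_closed_segment open_segment_def)
      then have "F \<subseteq> frontier \<Omega>"
        using segment_in_frontier[OF x] edge_of_imp_subset[OF F(1)] mesh_subset[OF K(1)] by blast
      then have "g x = g a" using edge[OF K(1), of a b x] F t(2) by simp
      then show ?thesis using imageI[OF ext(1), of g] by simp
    next
      case True
      then show ?thesis using imageI[OF ext(1), of g] imageI[OF ext(2), of g] by auto
    qed
  qed
  then have "g ` frontier \<Omega> \<subseteq> g ` ?V" by (rule image_subsetI)
  then have "finite (g ` frontier \<Omega>)" by (rule finite_subset) (rule finite_imageI[OF finite_vertices])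
  then have "g constant_on frontier \<Omega>"
    by (rule continuous_finite_range_constant[OF connected_domain_frontier cont])
  then show ?thesis unfolding constant_on_def by blast
qed

text \<open>On each element a divergence-free affine field has a quadratic stream function. Its increments along edges are determined by the midpoint values of
  the field, so the affine interpolants of the stream functions satisfy the compatibility condition
  that makes them glue, up to constants, over the convex domain.\<close>

lemma cr_divergence_free_is_curl:
  assumes \<psi>: "\<psi> \<in> cr_space \<Omega> T" and div: "interior_eq T (dvg \<psi>) (\<lambda>x. 0)"
  shows "\<exists>v\<in>mwx_space0 \<Omega> T. interior_eq T (curl v) \<psi>"
proof -
  have a: "pwaff T \<psi>" using \<psi> unfolding cr_space_iff by blast
  have "\<exists>P. P \<in> polys 2 \<and> (\<forall>x\<in>interior K. \<psi> x = rot (grad P x)) \<and> (\<forall>x\<in>K. elem_trace K \<psi> x = rot (grad P x))"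
    if K: "K \<in> T" for K
  proof -
    obtain p q r where aff: "\<forall>x\<in>interior K. \<psi> x = aff p q r x" using a K unfolding pwaff_def by blast
    obtain x0 where "x0 \<in> interior K" using mesh_interior_nonempty[OF K] by blast
    then have qr: "q $ 1 + r $ 2 = 0"
      using interior_eqD[OF div K] local_aff(1)[OF aff] by (simp add: dvg_aff)
    \<comment> \<open>Obtained by integrating the conditions that the partial derivatives of
      \<open>P\<close> be minus the second and plus the first component of the field. They prescribe
      the mixed coefficient twice, consistently because of \<open>qr\<close>.\<close>
    define P where "P = qp 0 (- p $ 2) (p $ 1) (- q $ 2 / 2) (q $ 1) (r $ 1 / 2)"
    have e: "rot (grad P x) = aff p q r x" for x
      using qr unfolding P_def grad_qp
      by (simp add: aff_def pt_eq_iff) (metis add.inverse_inverse add_eq_0_iff mult_minus_right)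
    have "P \<in> polys 2" unfolding polys_2 P_def by blast
    then show ?thesis using aff e pwaff_trace[OF K aff] by (intro exI[of _ P]) auto
  qed
  then obtain P where P: "\<And>K. K \<in> T \<Longrightarrow> P K \<in> polys 2"
    "\<And>K x. K \<in> T \<Longrightarrow> x \<in> interior K \<Longrightarrow> \<psi> x = rot (grad (P K) x)"
    "\<And>K x. K \<in> T \<Longrightarrow> x \<in> K \<Longrightarrow> elem_trace K \<psi> x = rot (grad (P K) x)"
    by metis
  note PP = polys_2_props[OF P(1)]
  \<comment> \<open>Neighbouring stream functions share their gradient only at the midpoint of a
    common edge, so along the edge they may differ by more than a constant. Their affine
    interpolants, with gradients \<open>G K\<close>, do not.\<close>
  have "\<exists>G. \<forall>a b. a extreme_point_of K \<longrightarrow> b extreme_point_of K \<longrightarrow> P K b - P K a = G \<bullet> (b - a)"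
    if K: "K \<in> T" for K
  proof -
    obtain a b c where t: "tri K a b c" using mesh_tri[OF K] .
    obtain G where G: "G \<bullet> (b - a) = P K b - P K a" "G \<bullet> (c - a) = P K c - P K a"
      using inner_pair_solvable[OF triD(2)[OF t]] by blast
    have G': "G \<bullet> b = G \<bullet> a + (P K b - P K a)" "G \<bullet> c = G \<bullet> a + (P K c - P K a)"
      using G by (simp_all add: inner_diff_right)
    have "\<forall>x y. x \<in> {a, b, c} \<longrightarrow> y \<in> {a, b, c} \<longrightarrow> P K y - P K x = G \<bullet> (y - x)"
      using G' by (auto simp: inner_diff_right)
    then show ?thesis unfolding tri_extreme_point[OF t] by blast
  qed
  then obtain G where G: "\<And>K a b. K \<in> T \<Longrightarrow> a extreme_point_of K \<Longrightarrow> b extreme_point_of K \<Longrightarrow>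
      P K b - P K a = G K \<bullet> (b - a)"
    by metis
  have edge_grad: "G K \<bullet> (b - a) = grad (P K) (midpoint a b) \<bullet> (b - a)"
    if K: "K \<in> T" "closed_segment a b edge_of K" for K a b
  proof -
    obtain c where t: "tri K a b c" using mesh_edge_points[OF K] .
    show ?thesis using G[OF K(1), of a b] PP(1)[OF K(1), of b a] tri_extreme_point[OF t] by simp
  qed
  have mid: "midpoint a b \<in> K" if "closed_segment a b edge_of K" for a b K
    using edge_of_imp_subset[OF that] midpoint_in_closed_segment by blast
  have shared: "grad (P K) (midpoint a b) = grad (P K') (midpoint a b)"
    if K: "K \<in> T" "K' \<in> T" "closed_segment a b edge_of K" "closed_segment a b edge_of K'" for K K' a b
  proof -
    have "elem_trace K \<psi> (midpoint a b) = elem_trace K' \<psi> (midpoint a b)"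
      using \<psi> K unfolding cr_space_iff by blast
    then show ?thesis using P(3)[OF K(1) mid[OF K(3)]] P(3)[OF K(2) mid[OF K(4)]] by simp
  qed
  have along: "z \<bullet> (y - x) = 0" if z: "z \<bullet> (b - a) = 0" and xy: "x \<in> closed_segment a b" "y \<in> closed_segment a b"
    for a b x y z :: pt
  proof -
    obtain s t where st: "x = (1 - s) *\<^sub>R a + s *\<^sub>R b" "y = (1 - t) *\<^sub>R a + t *\<^sub>R b"
      using xy by (auto simp: in_segment)
    have "y - x = (t - s) *\<^sub>R (b - a)" unfolding st by (simp add: algebra_simps)
    then show ?thesis using z by simp
  qed
  have compat: "G K \<bullet> y - G K \<bullet> x = G K' \<bullet> y - G K' \<bullet> x"
    if K: "K \<in> T" "K' \<in> T" and xy: "x \<in> K \<inter> K'" "y \<in> K \<inter> K'" for K K' x y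
  proof (cases "K = K' \<or> x = y")
    case False
    then have e: "K \<inter> K' edge_of K" "K \<inter> K' edge_of K'" using mesh_shared_edge[OF K _ xy] by auto
    obtain a b c where t: "tri K a b c" "K \<inter> K' = closed_segment a b" using mesh_edge[OF K(1) e(1)] .
    have "(G K - G K') \<bullet> (b - a) = 0"
      using edge_grad[OF K(1)] edge_grad[OF K(2)] shared[OF K] e t(2) by (simp add: inner_diff_left)
    then have "(G K - G K') \<bullet> (y - x) = 0" using along xy t(2) by blast
    then show ?thesis by (simp add: inner_diff_left inner_diff_right)
  qed auto
  \<comment> \<open>The global continuous piecewise affine function \<open>g\<close> reproduces the
    vertex increments of every local stream function.\<close>
  have "\<exists>g. \<forall>K\<in>T. \<forall>x\<in>K. \<forall>y\<in>K. g y - g x = G K \<bullet> y - G K \<bullet> x"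
  proof (rule convex_cover_potential[where S = "closure \<Omega>" and h = "\<lambda>K x. G K \<bullet> x"])
    show "finite T" by (rule finite_mesh)
    show "closed K" "convex K" if "K \<in> T" for K using mesh_closed[OF that] mesh_convex[OF that] .
    show "\<Union>T = closure \<Omega>" by (rule Union_mesh)
    show "convex (closure \<Omega>)" by (rule convex_closure[OF domain(2)])
    show "compact (closure \<Omega>)" using domain(3) by (simp add: compact_closure)
  qed (rule compat)
  then obtain g where g: "\<And>K x y. K \<in> T \<Longrightarrow> x \<in> K \<Longrightarrow> y \<in> K \<Longrightarrow> g y - g x = G K \<bullet> y - G K \<bullet> x"
    by metis
  have "continuous_on K g" if K: "K \<in> T" for K
  proof -
    obtain x0 where x0: "x0 \<in> K" using mesh_interior_nonempty[OF K] interior_subset by blast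
    have "g y = G K \<bullet> y - G K \<bullet> x0 + g x0" if "y \<in> K" for y using g[OF K x0 that] by simp
    then show ?thesis by (subst continuous_on_cong[OF refl]) (auto intro!: continuous_intros)
  qed
  then have "continuous_on (\<Union>T) g"
    using continuous_on_closed_Union[OF finite_mesh, of "\<lambda>K. K" g] mesh_closed by simp
  then have cont: "continuous_on (frontier \<Omega>) g"
    using continuous_on_subset Union_mesh by (metis Diff_subset frontier_def)
  have "\<exists>c. \<forall>x\<in>frontier \<Omega>. g x = c"
  proof (rule constant_on_frontier[OF cont])
    fix K a b x
    assume K: "K \<in> T" "closed_segment a b edge_of K" "closed_segment a b \<subseteq> frontier \<Omega>" "x \<in> closed_segment a b"
    have "elem_trace K \<psi> (midpoint a b) \<bullet> rot (b - a) = 0" using \<psi> K unfolding cr_space_iff by blast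
    then have "grad (P K) (midpoint a b) \<bullet> (b - a) = 0" using P(3)[OF K(1) mid[OF K(2)]] by simp
    then have "G K \<bullet> (b - a) = 0" using edge_grad[OF K(1,2)] by simp
    then have "G K \<bullet> (x - a) = 0" using along[of "G K" b a a x] K(4) by simp
    moreover have "a \<in> K" "x \<in> K" using edge_of_imp_subset[OF K(2)] K(4) by auto
    ultimately show "g x = g a" using g[OF K(1), of a x] by (simp add: inner_diff_right)
  qed
  then obtain c0 where c0: "\<And>x. x \<in> frontier \<Omega> \<Longrightarrow> g x = c0" by blast
  have "\<exists>a. a extreme_point_of K" if "K \<in> T" for K
    using mesh_tri[OF that] tri_extreme_point by (metis insertI1)
  then obtain e where e: "\<And>K. K \<in> T \<Longrightarrow> e K extreme_point_of K" by metis
  \<comment> \<open>The constant aligns the stream function with \<open>g - c0\<close> at one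
    vertex; equal increments then align it at all vertices of the element.\<close>
  define \<kappa> where "\<kappa> K = g (e K) - c0 - P K (e K)" for K
  \<comment> \<open>The choice is determined on open triangles because these are disjoint; elsewhere
    the value is arbitrary.\<close>
  define v where "v x = P (SOME K. K \<in> T \<and> x \<in> interior K) x + \<kappa> (SOME K. K \<in> T \<and> x \<in> interior K)" for x
  define W where "W K x = P K x + \<kappa> K" for K x
  have vW: "\<forall>x\<in>interior K. v x = W K x" if K: "K \<in> T" for K
  proof
    fix x assume x: "x \<in> interior K"
    have "(SOME K. K \<in> T \<and> x \<in> interior K) = K"
    proof (rule some_equality)
      show "K \<in> T \<and> x \<in> interior K" using K x by simp
      fix K' assume "K' \<in> T \<and> x \<in> interior K'"
      then show "K' = K" using mesh_interior_disjoint[of K' K x] K x interior_subset[of K'] by blast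
    qed
    then show "v x = W K x" by (simp add: v_def W_def)
  qed
  have W2: "W K \<in> polys 2" and gW: "grad (W K) = grad (P K)" if K: "K \<in> T" for K
  proof -
    obtain \<alpha> \<beta> \<gamma> \<delta> \<eta> \<zeta> where p: "P K = qp \<alpha> \<beta> \<gamma> \<delta> \<eta> \<zeta>" using P(1)[OF K] unfolding polys_2 by blast
    have w: "W K = qp (\<alpha> + \<kappa> K) \<beta> \<gamma> \<delta> \<eta> \<zeta>" by (rule ext) (simp add: W_def p qp_def)
    show "W K \<in> polys 2" unfolding polys_2 using w by blast
    show "grad (W K) = grad (P K)" unfolding w p grad_qp ..
  qed
  note tr = polys_traces[OF _ _ W2 vW]
  have vert: "elem_trace K v b = g b - c0" if K: "K \<in> T" "b extreme_point_of K" for K b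
  proof -
    have bK: "b \<in> K" "e K \<in> K" using K(2) e[OF K(1)] by (auto simp: extreme_point_of_def)
    have "elem_trace K v b = P K b - P K (e K) + g (e K) - c0"
      using tr(1)[OF K(1) bK(1) K(1) K(1)] by (simp add: W_def \<kappa>_def)
    also have "P K b - P K (e K) = g b - g (e K)"
      using G[OF K(1) e[OF K(1)] K(2)] g[OF K(1) bK(2,1)] by (simp add: inner_diff_right)
    finally show ?thesis by simp
  qed
  have "v \<in> mwx_space0 \<Omega> T" unfolding mwx_space0_def mwx_space_def Let_def
  proof (intro CollectI conjI ballI allI impI)
    show "v \<in> pw_polys T 2" unfolding pw_polys_def using W2 vW by blast
    fix K assume K: "K \<in> T"
    { fix K' a assume K': "K' \<in> T" and "a extreme_point_of K \<and> a extreme_point_of K'"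
      then show "elem_trace K v a = elem_trace K' v a" using vert[OF K] vert[OF K'] by simp
    next
      fix K' a b assume K': "K' \<in> T" and F: "closed_segment a b edge_of K \<and> closed_segment a b edge_of K'"
      then show "elem_trace K (dir_deriv (outward_normal K (closed_segment a b)) v) (midpoint a b) =
          elem_trace K' (dir_deriv (outward_normal K (closed_segment a b)) v) (midpoint a b)"
        using tr(3)[OF K mid K K] tr(3)[OF K' mid K' K'] gW[OF K] gW[OF K'] shared[OF K K'] by simp
    next
      fix a assume "a extreme_point_of K \<and> a \<in> frontier \<Omega>"
      then show "elem_trace K v a = 0" using vert[OF K] c0 by simp
    }
  qed
  moreover have "interior_eq T (curl v) \<psi>" unfolding interior_eq_def
  proof (intro ballI)
    fix K x assume K: "K \<in> T" "x \<in> interior K"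
    have "curl v x = curl (W K) x" by (rule curl_cong[OF open_interior K(2)]) (rule bspec[OF vW[OF K(1)]])
    also have "\<dots> = rot (grad (P K) x)" using polys_2_props(3)[OF W2[OF K(1)]] gW[OF K(1)] by simp
    also have "\<dots> = \<psi> x" using P(2)[OF K] by simp
    finally show "curl v x = \<psi> x" .
  qed
  ultimately show ?thesis by blast
qed

end

section \<open>Functions in the closure of the test functions\<close>

text \<open>The complement of the support is open, so derivatives also vanish off the domain;
  integrals of the function and of its gradient may thus be taken over the whole plane.\<close>

lemma test_functionD:
  assumes "\<phi> \<in> test_functions \<Omega>"
  shows "continuous_on UNIV \<phi>" "\<phi> differentiable (at x)" "continuous_on UNIV (pderiv_at i \<phi>)"
    "x \<notin> \<Omega> \<Longrightarrow> \<phi> x = 0" "x \<notin> \<Omega> \<Longrightarrow> pderiv_at i \<phi> x = 0"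
proof -
  have k: "Ck 0 \<phi>" "Ck (Suc 0) \<phi>" and supp: "closure {x. \<phi> x \<noteq> 0} \<subseteq> \<Omega>"
    using assms unfolding test_functions_def by blast+
  show "continuous_on UNIV \<phi>" "\<phi> differentiable (at x)" "continuous_on UNIV (pderiv_at i \<phi>)" using k by auto
  assume x: "x \<notin> \<Omega>"
  then have xs: "x \<in> - closure {x. \<phi> x \<noteq> 0}" using supp by blast
  show "\<phi> x = 0" using xs closure_subset[of "{x. \<phi> x \<noteq> 0}"] by blast
  have "pderiv_at i \<phi> x = pderiv_at i (\<lambda>x. 0) x"
    using closure_subset[of "{x. \<phi> x \<noteq> 0}"]
    by (intro pderiv_at_cong[of "- closure {x. \<phi> x \<noteq> 0}", OF _ xs]) (auto simp: open_Compl)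
  then show "pderiv_at i \<phi> x = 0"
    using frechet_derivative_const[of "0::real" x] by (simp add: pderiv_at_def dir_deriv_def)
qed

lemma pderiv_at_comb:
  assumes "\<phi> differentiable (at x)" "\<psi> differentiable (at x)"
  shows "pderiv_at i (\<lambda>x. r *\<^sub>R \<phi> x + s *\<^sub>R \<psi> x) x = r *\<^sub>R pderiv_at i \<phi> x + s *\<^sub>R pderiv_at i \<psi> x"
proof -
  have d: "(\<phi> has_derivative frechet_derivative \<phi> (at x)) (at x)" "(\<psi> has_derivative frechet_derivative \<psi> (at x)) (at x)"
    using assms by (simp_all add: frechet_derivative_works)
  have "((\<lambda>x. r *\<^sub>R \<phi> x + s *\<^sub>R \<psi> x) has_derivative
    (\<lambda>h. r *\<^sub>R frechet_derivative \<phi> (at x) h + s *\<^sub>R frechet_derivative \<psi> (at x) h)) (at x)"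
    by (intro has_derivative_add has_derivative_scaleR_right d)
  from frechet_derivative_at[OF this, symmetric] show ?thesis
    unfolding pderiv_at_def dir_deriv_def by simp
qed

lemma Ck_comb: "Ck k \<phi> \<Longrightarrow> Ck k \<psi> \<Longrightarrow> Ck k (\<lambda>x. r *\<^sub>R \<phi> x + s *\<^sub>R \<psi> x)"
proof (induction k arbitrary: \<phi> \<psi>)
  case 0
  then show ?case by (auto intro!: continuous_intros)
next
  case (Suc k)
  have d: "\<phi> differentiable (at x)" "\<psi> differentiable (at x)" for x using Suc.prems by auto
  have "pderiv_at i (\<lambda>x. r *\<^sub>R \<phi> x + s *\<^sub>R \<psi> x) = (\<lambda>x. r *\<^sub>R pderiv_at i \<phi> x + s *\<^sub>R pderiv_at i \<psi> x)" for i
    using pderiv_at_comb[OF d] by blast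
  moreover have "(\<lambda>x. r *\<^sub>R \<phi> x + s *\<^sub>R \<psi> x) differentiable (at x)" for x
    using d by (intro derivative_intros) auto
  moreover have "Ck k (\<lambda>x. r *\<^sub>R pderiv_at i \<phi> x + s *\<^sub>R pderiv_at i \<psi> x)" for i
    using Suc.prems by (intro Suc.IH) auto
  ultimately show ?case by simp
qed

lemma test_functions_comb:
  assumes "\<phi> \<in> test_functions \<Omega>" "\<psi> \<in> test_functions \<Omega>"
  shows "(\<lambda>x. r *\<^sub>R \<phi> x + s *\<^sub>R \<psi> x) \<in> test_functions \<Omega>"
proof -
  let ?A = "closure {x. \<phi> x \<noteq> 0} \<union> closure {x. \<psi> x \<noteq> 0}"
  have A: "compact ?A" "?A \<subseteq> \<Omega>" using assms unfolding test_functions_def by (auto intro: compact_Un)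
  let ?X = "{x. r *\<^sub>R \<phi> x + s *\<^sub>R \<psi> x \<noteq> 0}"
  have "?X \<subseteq> {x. \<phi> x \<noteq> 0} \<union> {x. \<psi> x \<noteq> 0}" by auto
  then have "?X \<subseteq> ?A"
    using closure_subset[of "{x. \<phi> x \<noteq> 0}"] closure_subset[of "{x. \<psi> x \<noteq> 0}"] by blast
  then have sub: "closure ?X \<subseteq> ?A" by (rule closure_minimal) (intro closed_Un closed_closure)
  then have "?A \<inter> closure ?X = closure ?X" by (rule Int_absorb1)
  then have "compact (closure ?X)" using compact_Int_closed[OF A(1) closed_closure[of ?X]] by (simp only:)
  moreover have "closure ?X \<subseteq> \<Omega>" using sub A(2) by (rule order_trans)
  moreover have "Ck k (\<lambda>x. r *\<^sub>R \<phi> x + s *\<^sub>R \<psi> x)" for k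
    using assms unfolding test_functions_def by (intro Ck_comb) auto
  ultimately show ?thesis unfolding test_functions_def by (intro CollectI conjI allI)
qed

lemma zero_test_function: "(\<lambda>x. 0) \<in> test_functions \<Omega>"
proof -
  have p: "pderiv_at i (\<lambda>x. 0) = (\<lambda>x. 0)" for i
    using frechet_derivative_const[of "0::real"] by (auto simp: pderiv_at_def dir_deriv_def)
  have "Ck k (\<lambda>x. 0)" for k by (induction k) (auto simp: p)
  then show ?thesis by (simp add: test_functions_def)
qed

section \<open>Translation estimates\<close>

lemma nn_integral_translate:
  fixes f :: "'a::euclidean_space \<Rightarrow> ennreal"
  assumes "f \<in> borel_measurable borel"
  shows "(\<integral>\<^sup>+x. f (x + y) \<partial>lborel) = (\<integral>\<^sup>+x. f x \<partial>lborel)"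
proof -
  have "(\<integral>\<^sup>+x. f x \<partial>lborel) = (\<integral>\<^sup>+x. f x \<partial>distr lborel borel ((+) y))" by (simp add: lborel_distr_plus)
  also have "\<dots> = (\<integral>\<^sup>+x. f (y + x) \<partial>lborel)" using assms by (intro nn_integral_distr) auto
  finally show ?thesis by (simp add: add.commute)
qed

text \<open>The variance of \<open>h\<close> about its mean over the unit interval is
  nonnegative.\<close>

lemma integral_square_le:
  fixes h :: "real \<Rightarrow> real"
  assumes "continuous_on {0..1} h"
  shows "(integral {0..1} h)\<^sup>2 \<le> integral {0..1} (\<lambda>s. (h s)\<^sup>2)"
proof -
  define m where "m = integral {0..1} h"
  have i: "h integrable_on {0..1}" "(\<lambda>s. (h s)\<^sup>2) integrable_on {0..1}"
    using assms by (auto intro!: integrable_continuous_real continuous_intros)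
  have "((\<lambda>s. (h s)\<^sup>2 - 2 * m * h s + m\<^sup>2) has_integral (integral {0..1} (\<lambda>s. (h s)\<^sup>2) - 2 * m * m + 1 *\<^sub>R m\<^sup>2)) {0..1}"
    using integrable_integral[OF i(1)] integrable_integral[OF i(2)] has_integral_const_real[of "m\<^sup>2" 0 1]
    unfolding m_def by (intro has_integral_add has_integral_diff has_integral_mult_right) auto
  moreover have "(h s)\<^sup>2 - 2 * m * h s + m\<^sup>2 \<ge> 0" for s
    using zero_le_power2[of "h s - m"] by (simp add: power2_diff algebra_simps)
  ultimately have "0 \<le> integral {0..1} (\<lambda>s. (h s)\<^sup>2) - 2 * m * m + 1 *\<^sub>R m\<^sup>2"
    by (rule has_integral_nonneg)
  then show ?thesis by (simp add: m_def[symmetric] power2_eq_square)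
qed

text \<open>The difference is \<open>t\<close> times the mean of the derivative along the segment.
  Squaring under the mean, exchanging the integrals and translation invariance remove the dependence
  on the position along the segment.\<close>

lemma test_function_translation:
  assumes \<phi>: "\<phi> \<in> test_functions \<Omega>"
  shows "(\<integral>\<^sup>+x. ennreal ((\<phi> (x + t *\<^sub>R axis 1 1) - \<phi> x)\<^sup>2) \<partial>lborel)
    \<le> ennreal (t\<^sup>2) * (\<integral>\<^sup>+x. ennreal ((pderiv_at 1 \<phi> x)\<^sup>2) \<partial>lborel)"
proof -
  let ?e = "axis 1 1 :: pt"
  let ?k = "\<lambda>x. ennreal ((pderiv_at 1 \<phi> x)\<^sup>2)"
  note cont = test_functionD(3)[OF \<phi>, of 1]
  have k_meas: "?k \<in> borel_measurable borel"
    using borel_measurable_continuous_onI[OF cont] by measurable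
  have pt: "ennreal ((\<phi> (x + t *\<^sub>R ?e) - \<phi> x)\<^sup>2) \<le>
      ennreal (t\<^sup>2) * (\<integral>\<^sup>+s. ?k (x + (s * t) *\<^sub>R ?e) * indicator {0..1} s \<partial>lborel)" for x
  proof -
    let ?h = "\<lambda>s. pderiv_at 1 \<phi> (x + (s * t) *\<^sub>R ?e)"
    have hc: "continuous_on {0..1} ?h"
      by (rule continuous_on_compose2[OF cont]) (auto intro!: continuous_intros)
    have hm: "?h \<in> borel_measurable borel"
      by (rule borel_measurable_continuous_onI, rule continuous_on_compose2[OF cont]) (auto intro!: continuous_intros)
    have "((\<lambda>s. \<phi> (x + (s * t) *\<^sub>R ?e)) has_vector_derivative t * ?h s) (at s within {0..1})" for s
    proof -
      let ?D = "frechet_derivative \<phi> (at (x + (s * t) *\<^sub>R ?e))"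
      have D: "(\<phi> has_derivative ?D) (at (x + (s * t) *\<^sub>R ?e))"
        using test_functionD(2)[OF \<phi>] by (simp add: frechet_derivative_works)
      have "((\<lambda>s. x + (s * t) *\<^sub>R ?e) has_derivative (\<lambda>d. (d * t) *\<^sub>R ?e)) (at s within {0..1})"
        by (auto intro!: derivative_eq_intros)
      then have "((\<lambda>s. \<phi> (x + (s * t) *\<^sub>R ?e)) has_derivative (\<lambda>d. ?D ((d * t) *\<^sub>R ?e))) (at s within {0..1})"
        using D by (rule has_derivative_compose)
      moreover have "?D ((d * t) *\<^sub>R ?e) = d *\<^sub>R (t * ?h s)" for d
        using linear_scale[OF has_derivative_linear[OF D], of "d * t" ?e]
        by (simp add: pderiv_at_def dir_deriv_def)
      ultimately show ?thesis by (simp add: has_vector_derivative_def)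
    qed
    then have "((\<lambda>s. t * ?h s) has_integral (\<phi> (x + (1 * t) *\<^sub>R ?e) - \<phi> (x + (0 * t) *\<^sub>R ?e))) {0..1}"
      by (intro fundamental_theorem_of_calculus) auto
    then have "\<phi> (x + t *\<^sub>R ?e) - \<phi> x = t * integral {0..1} ?h"
      by (simp add: has_integral_iff)
    then have "(\<phi> (x + t *\<^sub>R ?e) - \<phi> x)\<^sup>2 \<le> t\<^sup>2 * integral {0..1} (\<lambda>s. (?h s)\<^sup>2)"
      using integral_square_le[OF hc] by (simp add: power_mult_distrib mult_left_mono)
    also have "ennreal (t\<^sup>2 * integral {0..1} (\<lambda>s. (?h s)\<^sup>2)) = ennreal (t\<^sup>2) * ennreal (integral {0..1} (\<lambda>s. (?h s)\<^sup>2))"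
      by (rule ennreal_mult') simp
    also have "ennreal (integral {0..1} (\<lambda>s. (?h s)\<^sup>2)) = (\<integral>\<^sup>+s. ennreal ((?h s)\<^sup>2) * indicator {0..1} s \<partial>lborel)"
    proof -
      have "((\<lambda>s. (?h s)\<^sup>2) has_integral integral {0..1} (\<lambda>s. (?h s)\<^sup>2)) {0..1}"
        using hc by (intro integrable_integral integrable_continuous_real continuous_on_power)
      then have "((\<lambda>s. if s \<in> {0..1} then (?h s)\<^sup>2 else 0) has_integral integral {0..1} (\<lambda>s. (?h s)\<^sup>2)) UNIV"
        by (simp only: has_integral_restrict_UNIV)
      moreover have "(\<lambda>s. if s \<in> {0..1} then (?h s)\<^sup>2 else 0) \<in> borel_measurable borel"
        using hm by measurable
      ultimately have "(\<integral>\<^sup>+s. ennreal (if s \<in> {0..1} then (?h s)\<^sup>2 else 0) \<partial>lborel) =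
          ennreal (integral {0..1} (\<lambda>s. (?h s)\<^sup>2))"
        by (intro nn_integral_has_integral_lborel) auto
      moreover have "(\<integral>\<^sup>+s. ennreal (if s \<in> {0..1} then (?h s)\<^sup>2 else 0) \<partial>lborel) =
          (\<integral>\<^sup>+s. ennreal ((?h s)\<^sup>2) * indicator {0..1} s \<partial>lborel)"
        by (intro nn_integral_cong) (auto simp: indicator_def)
      ultimately show ?thesis by simp
    qed
    finally show ?thesis by (simp add: ennreal_leI)
  qed
  have meas: "(\<lambda>(x, s). ?k (x + (s * t) *\<^sub>R ?e) * indicator {0..1} s) \<in> borel_measurable (lborel \<Otimes>\<^sub>M lborel)"
  proof -
    have "(\<lambda>p. fst p + (snd p * t) *\<^sub>R ?e) \<in> borel_measurable (lborel \<Otimes>\<^sub>M (lborel :: real measure))"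
      by measurable
    from measurable_compose[OF this k_meas] show ?thesis unfolding split_beta by measurable
  qed
  have "(\<integral>\<^sup>+x. ennreal ((\<phi> (x + t *\<^sub>R ?e) - \<phi> x)\<^sup>2) \<partial>lborel) \<le>
     (\<integral>\<^sup>+x. ennreal (t\<^sup>2) * (\<integral>\<^sup>+s. ?k (x + (s * t) *\<^sub>R ?e) * indicator {0..1} s \<partial>lborel) \<partial>lborel)"
    by (rule nn_integral_mono) (rule pt)
  also have "\<dots> = ennreal (t\<^sup>2) * (\<integral>\<^sup>+x. (\<integral>\<^sup>+s. ?k (x + (s * t) *\<^sub>R ?e) * indicator {0..1} s \<partial>lborel) \<partial>lborel)"
    using lborel.borel_measurable_nn_integral[OF meas]
    by (intro nn_integral_cmult)
  also have "(\<integral>\<^sup>+x. (\<integral>\<^sup>+s. ?k (x + (s * t) *\<^sub>R ?e) * indicator {0..1} s \<partial>lborel) \<partial>lborel) =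
      (\<integral>\<^sup>+s. (\<integral>\<^sup>+x. ?k (x + (s * t) *\<^sub>R ?e) * indicator {0..1} s \<partial>lborel) \<partial>lborel)"
    by (rule lborel_pair.Fubini'[symmetric]) (use meas in simp)
  also have "\<dots> = (\<integral>\<^sup>+s. (\<integral>\<^sup>+x. ?k x \<partial>lborel) * indicator {0..1::real} s \<partial>lborel)"
  proof (rule nn_integral_cong)
    fix s :: real
    have "(\<lambda>x. ?k (x + (s * t) *\<^sub>R ?e)) \<in> borel_measurable lborel"
      using measurable_compose[OF _ k_meas, of "\<lambda>x. x + (s * t) *\<^sub>R ?e" lborel] by simp
    then show "(\<integral>\<^sup>+x. ?k (x + (s * t) *\<^sub>R ?e) * indicator {0..1} s \<partial>lborel) = (\<integral>\<^sup>+x. ?k x \<partial>lborel) * indicator {0..1} s"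
      using nn_integral_translate[OF k_meas, of "(s * t) *\<^sub>R ?e"] by (simp add: nn_integral_multc)
  qed
  also have "\<dots> = (\<integral>\<^sup>+x. ?k x \<partial>lborel)" by (simp add: nn_integral_cmult_indicator)
  finally show ?thesis .
qed

text \<open>For finitely many values, differences of order t in the square norm are of order t squared in the
  absolute norm; subdividing a translation that moves the support off itself then gives zero.\<close>

lemma finite_range_translation_zero:
  fixes f :: "'a::euclidean_space \<Rightarrow> real"
  assumes f_meas [measurable]: "f \<in> borel_measurable borel" and fin: "finite (range f)"
    and R: "R > 0" and out: "\<And>x. \<not> norm x < R \<Longrightarrow> f x = 0" and e: "norm e = 1"
    and square: "\<And>t. 0 < t \<Longrightarrow> t \<le> 1 \<Longrightarrow>
      (\<integral>\<^sup>+x. ennreal ((f (x + t *\<^sub>R e) - f x)\<^sup>2) \<partial>lborel) \<le> ennreal (C * t\<^sup>2)"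
  shows "AE x in lborel. f x = 0"
proof -
  define D where "D = (\<lambda>(a, b). \<bar>a - b\<bar>) ` (range f \<times> range f) - {0}"
  have finD: "finite D" unfolding D_def using fin by simp
  \<comment> \<open>The smallest gap between distinct values of \<open>f\<close>; inserting 1 keeps
    the set nonempty when \<open>f\<close> is constant. Differences are zero or at least
    \<open>\<gamma>\<close>, so they are dominated by their squares over
    \<open>\<gamma>\<close>.\<close>
  define \<gamma> where "\<gamma> = Min (insert 1 D)"
  have \<gamma>: "\<gamma> > 0" "\<bar>f x - f y\<bar> \<le> (f x - f y)\<^sup>2 / \<gamma>" for x y
  proof -
    have "\<forall>d\<in>insert 1 D. d > 0" by (auto simp: D_def)
    then show "\<gamma> > 0" unfolding \<gamma>_def using finD by (subst Min_gr_iff) auto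
    show "\<bar>f x - f y\<bar> \<le> (f x - f y)\<^sup>2 / \<gamma>"
    proof (cases "f x = f y")
      case False
      then have "\<bar>f x - f y\<bar> \<in> D" by (auto simp: D_def)
      then have "\<gamma> \<le> \<bar>f x - f y\<bar>" unfolding \<gamma>_def using finD by (intro Min_le) auto
      then have "\<gamma> * \<bar>f x - f y\<bar> \<le> \<bar>f x - f y\<bar> * \<bar>f x - f y\<bar>" by (intro mult_right_mono) auto
      then show ?thesis using \<open>\<gamma> > 0\<close> by (simp add: field_simps power2_eq_square)
    qed simp
  qed
  define I where "I y = (\<integral>\<^sup>+x. ennreal \<bar>f (x + y) - f x\<bar> \<partial>lborel)" for y
  have small: "I (t *\<^sub>R e) \<le> ennreal (C / \<gamma> * t\<^sup>2)" if t: "0 < t" "t \<le> 1" for t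
  proof -
    have "I (t *\<^sub>R e) \<le> (\<integral>\<^sup>+x. ennreal (1 / \<gamma>) * ennreal ((f (x + t *\<^sub>R e) - f x)\<^sup>2) \<partial>lborel)"
      unfolding I_def
    proof (rule nn_integral_mono)
      fix x
      show "ennreal \<bar>f (x + t *\<^sub>R e) - f x\<bar> \<le> ennreal (1 / \<gamma>) * ennreal ((f (x + t *\<^sub>R e) - f x)\<^sup>2)"
        using \<gamma>(2)[of "x + t *\<^sub>R e" x] \<gamma>(1) by (simp add: ennreal_mult'[symmetric] ennreal_leI)
    qed
    also have "\<dots> = ennreal (1 / \<gamma>) * (\<integral>\<^sup>+x. ennreal ((f (x + t *\<^sub>R e) - f x)\<^sup>2) \<partial>lborel)"
      by (rule nn_integral_cmult) measurable
    also have "\<dots> \<le> ennreal (1 / \<gamma>) * ennreal (C * t\<^sup>2)" using square[OF t] by (rule mult_left_mono) simp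
    also have "\<dots> = ennreal (C / \<gamma> * t\<^sup>2)" using \<gamma>(1) by (simp add: ennreal_mult'[symmetric])
    finally show ?thesis .
  qed
  \<comment> \<open>A translation by \<open>n\<close> steps telescopes into single steps, and each
    costs \<open>I y\<close> by translation invariance.\<close>
  have sub: "I (real n *\<^sub>R y) \<le> of_nat n * I y" for n y
  proof (induction n)
    case (Suc n)
    have "I (real (Suc n) *\<^sub>R y) \<le> (\<integral>\<^sup>+x. ennreal \<bar>f ((x + real n *\<^sub>R y) + y) - f (x + real n *\<^sub>R y)\<bar>
        + ennreal \<bar>f (x + real n *\<^sub>R y) - f x\<bar> \<partial>lborel)"
      unfolding I_def
    proof (rule nn_integral_mono)
      fix x
      have Suc_n: "x + real (Suc n) *\<^sub>R y = (x + real n *\<^sub>R y) + y" by (simp add: algebra_simps)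
      have "ennreal \<bar>f ((x + real n *\<^sub>R y) + y) - f x\<bar> \<le> ennreal (\<bar>f ((x + real n *\<^sub>R y) + y) - f (x + real n *\<^sub>R y)\<bar>
        + \<bar>f (x + real n *\<^sub>R y) - f x\<bar>)"
        by (rule ennreal_leI) linarith
      then show "ennreal \<bar>f (x + real (Suc n) *\<^sub>R y) - f x\<bar> \<le> ennreal \<bar>f ((x + real n *\<^sub>R y) + y) - f (x + real n *\<^sub>R y)\<bar>
        + ennreal \<bar>f (x + real n *\<^sub>R y) - f x\<bar>"
        unfolding Suc_n by simp
    qed
    also have "\<dots> = (\<integral>\<^sup>+x. ennreal \<bar>f ((x + real n *\<^sub>R y) + y) - f (x + real n *\<^sub>R y)\<bar> \<partial>lborel) + I (real n *\<^sub>R y)"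
      unfolding I_def by (rule nn_integral_add) measurable
    also have "(\<integral>\<^sup>+x. ennreal \<bar>f ((x + real n *\<^sub>R y) + y) - f (x + real n *\<^sub>R y)\<bar> \<partial>lborel) = I y"
      unfolding I_def by (rule nn_integral_translate[where f = "\<lambda>x. ennreal \<bar>f (x + y) - f x\<bar>"]) measurable
    finally have "I (real (Suc n) *\<^sub>R y) \<le> I y + I (real n *\<^sub>R y)" .
    also have "\<dots> \<le> I y + of_nat n * I y" using Suc.IH by (rule add_left_mono)
    finally show ?case by (simp add: algebra_simps)
  qed (simp add: I_def)
  \<comment> \<open>Translation by the diameter moves the ball containing the support off itself, so
    at each point at most one of the two values is nonzero.\<close>
  define L where "L = 2 * R"
  have L: "L > 0" using R(1) by (simp add: L_def)
  \<comment> \<open>The \<open>n\<close> steps of length \<open>L / n\<close> cost order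
    \<open>1 / n\<close> squared each, hence order \<open>1 / n\<close> in total. The condition on
    \<open>n\<close> keeps the step within the range of \<open>square\<close>.\<close>
  have "I (L *\<^sub>R e) \<le> ennreal (C / \<gamma> * L\<^sup>2 / real n)" if n: "L \<le> real n" for n
  proof -
    have n0: "real n > 0" using n L by linarith
    have "I (L *\<^sub>R e) = I (real n *\<^sub>R ((L / real n) *\<^sub>R e))" using n0 by simp
    also have "\<dots> \<le> of_nat n * I ((L / real n) *\<^sub>R e)" by (rule sub)
    also have "\<dots> \<le> of_nat n * ennreal (C / \<gamma> * (L / real n)\<^sup>2)"
      using small[of "L / real n"] n n0 L by (intro mult_left_mono) auto
    also have "\<dots> = ennreal (real n * (C / \<gamma> * (L / real n)\<^sup>2))"
      unfolding ennreal_of_nat_eq_real_of_nat by (rule ennreal_mult'[symmetric]) simp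
    also have "real n * (C / \<gamma> * (L / real n)\<^sup>2) = C / \<gamma> * L\<^sup>2 / real n"
      using n0 by (simp add: power2_eq_square field_simps)
    finally show ?thesis .
  qed
  moreover have "(\<lambda>n. ennreal (C / \<gamma> * L\<^sup>2 / real n)) \<longlonglongrightarrow> ennreal 0"
    by (intro tendsto_ennrealI lim_const_over_n)
  ultimately have "I (L *\<^sub>R e) \<le> ennreal 0"
    by (intro LIMSEQ_le_const) (auto intro: exI[of _ "nat \<lceil>L\<rceil>"] simp: nat_le_iff ceiling_le_iff)
  moreover have "(\<integral>\<^sup>+x. ennreal \<bar>f x\<bar> \<partial>lborel) \<le> I (L *\<^sub>R e)"
  proof -
    have "(\<integral>\<^sup>+x. ennreal \<bar>f x\<bar> \<partial>lborel) = (\<integral>\<^sup>+x. ennreal \<bar>f (x + L *\<^sub>R e)\<bar> \<partial>lborel)"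
      by (rule nn_integral_translate[symmetric]) measurable
    also have "\<dots> \<le> I (L *\<^sub>R e)" unfolding I_def
    proof (rule nn_integral_mono, rule ennreal_leI)
      fix x
      show "\<bar>f (x + L *\<^sub>R e)\<bar> \<le> \<bar>f (x + L *\<^sub>R e) - f x\<bar>"
      proof (cases "norm (x + L *\<^sub>R e) < R")
        case True
        have "L = norm ((x + L *\<^sub>R e) - x)" using L e by simp
        also have "\<dots> \<le> norm (x + L *\<^sub>R e) + norm x" by (rule norm_triangle_ineq4)
        finally have "\<not> norm x < R" using True by (auto simp: L_def)
        then show ?thesis using out by simp
      qed (simp add: out)
    qed
    finally show ?thesis .
  qed
  ultimately have "(\<integral>\<^sup>+x. ennreal \<bar>f x\<bar> \<partial>lborel) = 0" by simp
  then have "AE x in lborel. ennreal \<bar>f x\<bar> = 0" by (subst (asm) nn_integral_0_iff_AE) auto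
  then show ?thesis by simp
qed

context domain_mesh
begin

section \<open>Linear structure of \<open>L2\<close> and \<open>H10\<close>\<close>

lemma L2_inner_integrable:
  fixes f g :: "pt \<Rightarrow> 'b::euclidean_space"
  assumes f: "f \<in> L2 \<Omega>" and g: "g \<in> L2 \<Omega>"
  shows "integrable (lebesgue_on \<Omega>) (\<lambda>x. f x \<bullet> g x)"
proof (rule Bochner_Integration.integrable_bound)
  show "integrable (lebesgue_on \<Omega>) (\<lambda>x. (norm (f x))\<^sup>2 + (norm (g x))\<^sup>2)"
    using f g by (simp add: L2_def)
  show "(\<lambda>x. f x \<bullet> g x) \<in> borel_measurable (lebesgue_on \<Omega>)"
    using f g unfolding L2_def by (intro borel_measurable_inner) auto
  have "\<bar>a \<bullet> b\<bar> \<le> (norm a)\<^sup>2 + (norm b)\<^sup>2" for a b :: 'b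
  proof -
    have "2 * (norm a * norm b) \<le> (norm a)\<^sup>2 + (norm b)\<^sup>2"
      using zero_le_power2[of "norm a - norm b"] by (simp add: power2_diff algebra_simps)
    moreover have "0 \<le> norm a * norm b" by simp
    ultimately show ?thesis using Cauchy_Schwarz_ineq2[of a b] by linarith
  qed
  then show "AE x in lebesgue_on \<Omega>. norm (f x \<bullet> g x) \<le> norm ((norm (f x))\<^sup>2 + (norm (g x))\<^sup>2)"
    by simp
qed

text \<open>By the parallelogram law the two sides differ by the squared norm of
  \<open>r a - s b\<close>.\<close>

lemma norm_comb_le: "(norm (r *\<^sub>R a + s *\<^sub>R b))\<^sup>2 \<le> 2 * r\<^sup>2 * (norm a)\<^sup>2 + 2 * s\<^sup>2 * (norm b)\<^sup>2"
  for a b :: "'b::real_inner"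
proof -
  have "0 \<le> (r *\<^sub>R a - s *\<^sub>R b) \<bullet> (r *\<^sub>R a - s *\<^sub>R b)" by (rule inner_ge_zero)
  then show ?thesis unfolding power2_norm_eq_inner
    by (simp add: inner_add_left inner_add_right inner_diff_left inner_diff_right
        inner_commute power2_eq_square algebra_simps)
qed

lemma L2_comb:
  fixes f g :: "pt \<Rightarrow> 'b::euclidean_space"
  assumes f: "f \<in> L2 \<Omega>" and g: "g \<in> L2 \<Omega>"
  shows "(\<lambda>x. r *\<^sub>R f x + s *\<^sub>R g x) \<in> L2 \<Omega>"
proof -
  have m: "f \<in> borel_measurable (lebesgue_on \<Omega>)" "g \<in> borel_measurable (lebesgue_on \<Omega>)"
    using f g by (auto simp: L2_def)
  have m2: "(\<lambda>x. r *\<^sub>R f x + s *\<^sub>R g x) \<in> borel_measurable (lebesgue_on \<Omega>)"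
    by (intro borel_measurable_add borel_measurable_scaleR borel_measurable_const m)
  moreover have "integrable (lebesgue_on \<Omega>) (\<lambda>x. (norm (r *\<^sub>R f x + s *\<^sub>R g x))\<^sup>2)"
  proof (rule Bochner_Integration.integrable_bound)
    show "integrable (lebesgue_on \<Omega>) (\<lambda>x. 2 * r\<^sup>2 * (norm (f x))\<^sup>2 + 2 * s\<^sup>2 * (norm (g x))\<^sup>2)"
      using f g by (simp add: L2_def)
    show "(\<lambda>x. (norm (r *\<^sub>R f x + s *\<^sub>R g x))\<^sup>2) \<in> borel_measurable (lebesgue_on \<Omega>)"
      using m2 by measurable
    show "AE x in lebesgue_on \<Omega>. norm ((norm (r *\<^sub>R f x + s *\<^sub>R g x))\<^sup>2)
        \<le> norm (2 * r\<^sup>2 * (norm (f x))\<^sup>2 + 2 * s\<^sup>2 * (norm (g x))\<^sup>2)"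
      using norm_comb_le by (intro AE_I2) (auto intro: order_trans[OF _ abs_ge_self])
  qed
  ultimately show ?thesis by (simp add: L2_def)
qed

lemma ip_L2_comb_left:
  assumes "f \<in> L2 \<Omega>" "g \<in> L2 \<Omega>" "h \<in> L2 \<Omega>"
  shows "ip \<Omega> (\<lambda>x. r *\<^sub>R f x + s *\<^sub>R g x) h = r * ip \<Omega> f h + s * ip \<Omega> g h"
  unfolding ip_def using L2_inner_integrable[OF assms(1,3)] L2_inner_integrable[OF assms(2,3)]
  by (simp add: inner_add_left)

lemma ip_comb_le:
  assumes f: "f \<in> L2 \<Omega>" and g: "g \<in> L2 \<Omega>"
  shows "ip \<Omega> (\<lambda>x. r *\<^sub>R f x + s *\<^sub>R g x) (\<lambda>x. r *\<^sub>R f x + s *\<^sub>R g x) \<le> 2 * r\<^sup>2 * ip \<Omega> f f + 2 * s\<^sup>2 * ip \<Omega> g g"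
proof -
  have "ip \<Omega> (\<lambda>x. r *\<^sub>R f x + s *\<^sub>R g x) (\<lambda>x. r *\<^sub>R f x + s *\<^sub>R g x) \<le>
     (LINT x|lebesgue_on \<Omega>. 2 * r\<^sup>2 * (f x \<bullet> f x) + 2 * s\<^sup>2 * (g x \<bullet> g x))"
    unfolding ip_def
    using L2_inner_integrable[OF L2_comb[OF f g] L2_comb[OF f g]] L2_inner_integrable[OF f f] L2_inner_integrable[OF g g]
      norm_comb_le by (intro integral_mono) (auto simp: power2_norm_eq_inner)
  also have "\<dots> = 2 * r\<^sup>2 * ip \<Omega> f f + 2 * s\<^sup>2 * ip \<Omega> g g"
    unfolding ip_def using L2_inner_integrable[OF f f] L2_inner_integrable[OF g g] by simp
  finally show ?thesis .
qed

lemma pwc_L2: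
  fixes g :: "pt \<Rightarrow> 'b::euclidean_space"
  assumes "pwc T g" shows "g \<in> L2 \<Omega>"
  using pwc_integrable[OF assms] pwc_integrable[OF pwc_inner[OF assms assms]]
  by (auto simp: L2_def power2_norm_eq_inner)

lemma continuous_pwc: "continuous_on UNIV g \<Longrightarrow> pwc T g"
  unfolding pwc_def by blast

lemma test_function_L2:
  assumes "\<phi> \<in> test_functions \<Omega>"
  shows "\<phi> \<in> L2 \<Omega>" "pderiv_at i \<phi> \<in> L2 \<Omega>" "grad \<phi> \<in> L2 \<Omega>"
proof -
  note t = test_functionD[OF assms]
  show "\<phi> \<in> L2 \<Omega>" "pderiv_at i \<phi> \<in> L2 \<Omega>" using t by (auto intro: pwc_L2 continuous_pwc)
  have "continuous_on UNIV (grad \<phi>)" unfolding grad_def[abs_def] using t(3) by (intro continuous_on_vec_lambda)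
  then show "grad \<phi> \<in> L2 \<Omega>" by (intro pwc_L2 continuous_pwc)
qed

lemma L2_nth: "(G :: pt \<Rightarrow> real^2) \<in> L2 \<Omega> \<Longrightarrow> (\<lambda>x. G x $ i) \<in> L2 \<Omega>"
proof -
  assume G: "G \<in> L2 \<Omega>"
  have m: "(\<lambda>x. G x $ i) \<in> borel_measurable (lebesgue_on \<Omega>)"
    using borel_measurable_inner[OF _ borel_measurable_const[of "axis i 1"], of G "lebesgue_on \<Omega>"] G
    by (simp add: L2_def inner_axis)
  moreover have "integrable (lebesgue_on \<Omega>) (\<lambda>x. (norm (G x $ i))\<^sup>2)"
  proof (rule Bochner_Integration.integrable_bound)
    show "integrable (lebesgue_on \<Omega>) (\<lambda>x. (norm (G x))\<^sup>2)" using G by (simp add: L2_def)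
    show "(\<lambda>x. (norm (G x $ i))\<^sup>2) \<in> borel_measurable (lebesgue_on \<Omega>)"
      using m by measurable
    show "AE x in lebesgue_on \<Omega>. norm ((norm (G x $ i))\<^sup>2) \<le> norm ((norm (G x))\<^sup>2)"
    proof (rule AE_I2)
      fix x
      have "(norm (G x $ i))\<^sup>2 \<le> (norm (G x))\<^sup>2"
        by (rule power_mono) (simp_all add: component_le_norm_cart)
      then show "norm ((norm (G x $ i))\<^sup>2) \<le> norm ((norm (G x))\<^sup>2)" by simp
    qed
  qed
  ultimately show ?thesis by (simp add: L2_def)
qed

lemma H10_comb:
  assumes v: "v \<in> H10 \<Omega>" and w: "w \<in> H10 \<Omega>"
  shows "(\<lambda>x. r *\<^sub>R v x + s *\<^sub>R w x) \<in> H10 \<Omega>"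
proof -
  let ?u = "\<lambda>x. r *\<^sub>R v x + s *\<^sub>R w x"
  have L: "v \<in> L2 \<Omega>" "w \<in> L2 \<Omega>" using v w by (auto simp: H10_def)
  obtain G where G: "G \<in> L2 \<Omega>" "weak_gradient \<Omega> v G" "\<And>e. e > 0 \<Longrightarrow> \<exists>\<phi>\<in>test_functions \<Omega>.
      ip \<Omega> (\<lambda>x. v x - \<phi> x) (\<lambda>x. v x - \<phi> x) + ip \<Omega> (\<lambda>x. G x - grad \<phi> x) (\<lambda>x. G x - grad \<phi> x) < e\<^sup>2"
    using v unfolding H10_def by blast
  obtain H where H: "H \<in> L2 \<Omega>" "weak_gradient \<Omega> w H" "\<And>e. e > 0 \<Longrightarrow> \<exists>\<phi>\<in>test_functions \<Omega>.
      ip \<Omega> (\<lambda>x. w x - \<phi> x) (\<lambda>x. w x - \<phi> x) + ip \<Omega> (\<lambda>x. H x - grad \<phi> x) (\<lambda>x. H x - grad \<phi> x) < e\<^sup>2"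
    using w unfolding H10_def by blast
  let ?J = "\<lambda>x. r *\<^sub>R G x + s *\<^sub>R H x"
  have "weak_gradient \<Omega> ?u ?J" unfolding weak_gradient_def
  proof (intro ballI allI)
    fix \<psi> i assume \<psi>: "\<psi> \<in> test_functions \<Omega>"
    note t = test_function_L2[OF \<psi>]
    have g: "ip \<Omega> v (pderiv_at i \<psi>) = - ip \<Omega> (\<lambda>x. G x $ i) \<psi>" "ip \<Omega> w (pderiv_at i \<psi>) = - ip \<Omega> (\<lambda>x. H x $ i) \<psi>"
      using G(2) H(2) \<psi> unfolding weak_gradient_def by blast+
    have "ip \<Omega> ?u (pderiv_at i \<psi>) = r * ip \<Omega> v (pderiv_at i \<psi>) + s * ip \<Omega> w (pderiv_at i \<psi>)"
      by (rule ip_L2_comb_left[OF L t(2)])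
    moreover have "ip \<Omega> (\<lambda>x. r *\<^sub>R G x $ i + s *\<^sub>R H x $ i) \<psi> = r * ip \<Omega> (\<lambda>x. G x $ i) \<psi> + s * ip \<Omega> (\<lambda>x. H x $ i) \<psi>"
      by (rule ip_L2_comb_left[OF L2_nth[OF G(1)] L2_nth[OF H(1)] t(1)])
    ultimately show "ip \<Omega> ?u (pderiv_at i \<psi>) = - ip \<Omega> (\<lambda>x. ?J x $ i) \<psi>" using g by simp
  qed
  moreover have "\<exists>\<phi>\<in>test_functions \<Omega>. ip \<Omega> (\<lambda>x. ?u x - \<phi> x) (\<lambda>x. ?u x - \<phi> x)
      + ip \<Omega> (\<lambda>x. ?J x - grad \<phi> x) (\<lambda>x. ?J x - grad \<phi> x) < e\<^sup>2" if e: "e > 0" for e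
  proof -
    \<comment> \<open>The combined error is below the square of \<open>e\<close> because
      \<open>2 r^2 + 2 s^2\<close> is less than \<open>(2 (|r| + |s| + 1))^2\<close>; the summand 1
      covers \<open>r = s = 0\<close>.\<close>
    define d where "d = e / (2 * (\<bar>r\<bar> + \<bar>s\<bar> + 1))"
    have "0 < 2 * (\<bar>r\<bar> + \<bar>s\<bar> + 1)" by simp
    then have d: "d > 0" "e = 2 * (\<bar>r\<bar> + \<bar>s\<bar> + 1) * d" using e by (simp_all add: d_def)
    obtain \<phi> where \<phi>: "\<phi> \<in> test_functions \<Omega>"
      "ip \<Omega> (\<lambda>x. v x - \<phi> x) (\<lambda>x. v x - \<phi> x) + ip \<Omega> (\<lambda>x. G x - grad \<phi> x) (\<lambda>x. G x - grad \<phi> x) < d\<^sup>2"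
      using G(3)[OF d(1)] by blast
    obtain \<psi> where \<psi>: "\<psi> \<in> test_functions \<Omega>"
      "ip \<Omega> (\<lambda>x. w x - \<psi> x) (\<lambda>x. w x - \<psi> x) + ip \<Omega> (\<lambda>x. H x - grad \<psi> x) (\<lambda>x. H x - grad \<psi> x) < d\<^sup>2"
      using H(3)[OF d(1)] by blast
    let ?\<xi> = "\<lambda>x. r *\<^sub>R \<phi> x + s *\<^sub>R \<psi> x"
    have diffs: "(\<lambda>x. v x - \<phi> x) \<in> L2 \<Omega>" "(\<lambda>x. w x - \<psi> x) \<in> L2 \<Omega>"
      "(\<lambda>x. G x - grad \<phi> x) \<in> L2 \<Omega>" "(\<lambda>x. H x - grad \<psi> x) \<in> L2 \<Omega>"
      using L2_comb[OF L(1) test_function_L2(1)[OF \<phi>(1)], of 1 "-1"] L2_comb[OF L(2) test_function_L2(1)[OF \<psi>(1)], of 1 "-1"]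
        L2_comb[OF G(1) test_function_L2(3)[OF \<phi>(1)], of 1 "-1"] L2_comb[OF H(1) test_function_L2(3)[OF \<psi>(1)], of 1 "-1"]
      by simp_all
    have gr: "grad ?\<xi> x = r *\<^sub>R grad \<phi> x + s *\<^sub>R grad \<psi> x" for x
      using pderiv_at_comb[OF test_functionD(2)[OF \<phi>(1)] test_functionD(2)[OF \<psi>(1)]]
      by (simp add: grad_def vec_eq_iff)
    have e1: "(\<lambda>x. ?u x - ?\<xi> x) = (\<lambda>x. r *\<^sub>R (v x - \<phi> x) + s *\<^sub>R (w x - \<psi> x))"
      "(\<lambda>x. ?J x - grad ?\<xi> x) = (\<lambda>x. r *\<^sub>R (G x - grad \<phi> x) + s *\<^sub>R (H x - grad \<psi> x))"
      unfolding gr by (simp_all add: algebra_simps)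
    let ?A = "ip \<Omega> (\<lambda>x. v x - \<phi> x) (\<lambda>x. v x - \<phi> x)" and ?B = "ip \<Omega> (\<lambda>x. G x - grad \<phi> x) (\<lambda>x. G x - grad \<phi> x)"
    let ?C = "ip \<Omega> (\<lambda>x. w x - \<psi> x) (\<lambda>x. w x - \<psi> x)" and ?D = "ip \<Omega> (\<lambda>x. H x - grad \<psi> x) (\<lambda>x. H x - grad \<psi> x)"
    have "ip \<Omega> (\<lambda>x. ?u x - ?\<xi> x) (\<lambda>x. ?u x - ?\<xi> x) + ip \<Omega> (\<lambda>x. ?J x - grad ?\<xi> x) (\<lambda>x. ?J x - grad ?\<xi> x)
       \<le> (2 * r\<^sup>2 * ?A + 2 * s\<^sup>2 * ?C) + (2 * r\<^sup>2 * ?B + 2 * s\<^sup>2 * ?D)"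
      unfolding e1 by (intro add_mono ip_comb_le diffs)
    also have "\<dots> = 2 * r\<^sup>2 * (?A + ?B) + 2 * s\<^sup>2 * (?C + ?D)" by (simp add: algebra_simps)
    also have "\<dots> \<le> 2 * r\<^sup>2 * d\<^sup>2 + 2 * s\<^sup>2 * d\<^sup>2"
      using \<phi>(2) \<psi>(2) by (intro add_mono mult_left_mono) auto
    also have "\<dots> < e\<^sup>2"
    proof -
      have "2 * r\<^sup>2 + 2 * s\<^sup>2 < (2 * (\<bar>r\<bar> + \<bar>s\<bar> + 1))\<^sup>2"
      proof -
        have "(2 * (\<bar>r\<bar> + \<bar>s\<bar> + 1))\<^sup>2 = 4 * \<bar>r\<bar>\<^sup>2 + 4 * \<bar>s\<bar>\<^sup>2 + 4 + 8 * (\<bar>r\<bar> * \<bar>s\<bar>) + 8 * \<bar>r\<bar> + 8 * \<bar>s\<bar>"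
          by (simp only: power2_eq_square) (simp add: algebra_simps)
        moreover have "0 \<le> \<bar>r\<bar> * \<bar>s\<bar>" "0 \<le> r\<^sup>2" "0 \<le> s\<^sup>2" by simp_all
        moreover have "\<bar>r\<bar>\<^sup>2 = r\<^sup>2" "\<bar>s\<bar>\<^sup>2 = s\<^sup>2" by simp_all
        ultimately show ?thesis using abs_ge_zero[of r] abs_ge_zero[of s] by linarith
      qed
      then have "(2 * r\<^sup>2 + 2 * s\<^sup>2) * d\<^sup>2 < (2 * (\<bar>r\<bar> + \<bar>s\<bar> + 1))\<^sup>2 * d\<^sup>2"
        using d(1) by (intro mult_strict_right_mono) auto
      moreover have "e\<^sup>2 = (2 * (\<bar>r\<bar> + \<bar>s\<bar> + 1))\<^sup>2 * d\<^sup>2" unfolding d(2) by (rule power_mult_distrib)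
      ultimately show ?thesis by (simp only: distrib_right)
    qed
    finally show ?thesis by (rule bexI[OF _ test_functions_comb[OF \<phi>(1) \<psi>(1)]])
  qed
  ultimately show ?thesis using L2_comb[OF L] L2_comb[OF G(1) H(1)] unfolding H10_def by blast
qed

lemma zero_H10: "(\<lambda>x. 0) \<in> H10 \<Omega>"
proof -
  have "grad (\<lambda>x. 0) = (\<lambda>x. 0)"
    using frechet_derivative_const[of "0::real"]
    by (auto simp: grad_def pderiv_at_def dir_deriv_def vec_eq_iff)
  then have "\<exists>\<phi>\<in>test_functions \<Omega>. ip \<Omega> (\<lambda>x. 0 - \<phi> x) (\<lambda>x. 0 - \<phi> x)
      + ip \<Omega> (\<lambda>x. 0 - grad \<phi> x) (\<lambda>x. 0 - grad \<phi> x) < e\<^sup>2" if "e > 0" for e :: real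
    using that zero_test_function by (intro bexI[of _ "\<lambda>x. 0"]) (simp_all add: ip_def)
  then show ?thesis unfolding H10_def
    by (intro CollectI conjI exI[of _ "\<lambda>x. 0"]) (simp_all add: L2_def weak_gradient_def ip_def)
qed

text \<open>Translations leave the domain, so the estimates live on the whole plane with Borel
  measure. This passes from there to the inner product on the domain for functions extended by
  zero.\<close>

lemma nn_integral_domain:
  fixes g :: "pt \<Rightarrow> 'b::euclidean_space" and h :: "pt \<Rightarrow> real"
  assumes "g \<in> L2 \<Omega>" and eq: "\<And>K x. K \<in> T \<Longrightarrow> x \<in> interior K \<Longrightarrow> h x = g x \<bullet> g x" and out: "\<And>x. x \<notin> \<Omega> \<Longrightarrow> h x = 0"
  shows "(\<integral>\<^sup>+x. ennreal (h x) \<partial>lborel) = ennreal (ip \<Omega> g g)"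
proof -
  have "ennreal (ip \<Omega> g g) = (\<integral>\<^sup>+x. ennreal (g x \<bullet> g x) \<partial>lebesgue_on \<Omega>)"
    unfolding ip_def using L2_inner_integrable[OF assms(1,1)] by (intro nn_integral_eq_integral[symmetric]) auto
  also have "\<dots> = (\<integral>\<^sup>+x. ennreal (h x) \<partial>lebesgue_on \<Omega>)"
    using eq by (intro nn_integral_cong_AE AE_domainI) auto
  also have "\<dots> = (\<integral>\<^sup>+x. ennreal (h x) * indicator \<Omega> x \<partial>lebesgue)"
    by (intro nn_integral_restrict_space) auto
  also have "\<dots> = (\<integral>\<^sup>+x. ennreal (h x) \<partial>lebesgue)"
    using out by (intro nn_integral_cong) (auto simp: indicator_def)
  finally show ?thesis by (simp add: nn_integral_completion)
qed

text \<open>Approximation by test functions bounds the squared translation differences of the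
  extension by zero by a multiple of \<open>t^2\<close>, which a function with finitely many values
  survives only if it vanishes. Extension by zero makes jumps at the frontier count, so nonzero
  global constants are excluded too.\<close>

lemma H10_pw_const_zero:
  assumes \<eta>: "\<eta> \<in> H10 \<Omega>" and const: "\<And>K. K \<in> T \<Longrightarrow> \<exists>c. \<forall>x\<in>interior K. \<eta> x = c"
  shows "interior_eq T \<eta> (\<lambda>x. 0)"
proof -
  let ?e = "axis 1 1 :: pt"
  obtain c where c: "\<And>K x. K \<in> T \<Longrightarrow> x \<in> interior K \<Longrightarrow> \<eta> x = c K" using const by metis
  \<comment> \<open>A Borel representative on the plane: zero off the open triangles, with finitely
    many values.\<close>
  define f where "f x = (\<Sum>K\<in>T. c K * indicator (interior K) x)" for x
  have f_in: "f x = \<eta> x" if K: "K \<in> T" "x \<in> interior K" for K x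
  proof -
    have "c K' * indicator (interior K') x = (if K' = K then c K else 0)" if "K' \<in> T" for K'
      using mesh_interior_disjoint[OF that K(1)] K(2) interior_subset[of K'] by (auto simp: indicator_def)
    then have "f x = (\<Sum>K'\<in>T. if K' = K then c K else 0)" unfolding f_def by (intro sum.cong) auto
    then show ?thesis using K c finite_mesh by simp
  qed
  have f_out: "f x = 0" if "x \<notin> \<Omega>" for x
    unfolding f_def using that mesh_interior_subset by (intro sum.neutral) (auto simp: indicator_def)
  have f_meas [measurable]: "f \<in> borel_measurable borel" unfolding f_def by measurable
  have "range f \<subseteq> (\<lambda>A. sum c A) ` Pow T"
  proof (rule image_subsetI)
    fix x
    have "sum c {K \<in> T. x \<in> interior K} = (\<Sum>K\<in>T. if x \<in> interior K then c K else 0)"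
      by (rule sum.inter_filter[OF finite_mesh])
    also have "\<dots> = f x" unfolding f_def by (intro sum.cong refl) (simp add: indicator_def)
    finally have "f x = sum c {K \<in> T. x \<in> interior K}" by simp
    then show "f x \<in> (\<lambda>A. sum c A) ` Pow T" by blast
  qed
  then have fin: "finite (range f)" by (rule finite_subset) (use finite_mesh in simp)
  have \<eta>L: "\<eta> \<in> L2 \<Omega>" using \<eta> by (simp add: H10_def)
  obtain G where G: "G \<in> L2 \<Omega>" "\<And>e. e > 0 \<Longrightarrow> \<exists>\<phi>\<in>test_functions \<Omega>.
      ip \<Omega> (\<lambda>x. \<eta> x - \<phi> x) (\<lambda>x. \<eta> x - \<phi> x) + ip \<Omega> (\<lambda>x. G x - grad \<phi> x) (\<lambda>x. G x - grad \<phi> x) < e\<^sup>2"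
    using \<eta> unfolding H10_def by blast
  define M where "M = ip \<Omega> G G"
  have M: "M \<ge> 0" unfolding M_def by (rule ip_nonneg)
  \<comment> \<open>Two approximation terms contribute \<open>3 t^2\<close> each and the translation
    term \<open>3 t^2 (2 M + 2 t^2)\<close>; with \<open>t \<le> 1\<close> the sum is at most
    \<open>(12 + 6 M) t^2\<close>.\<close>
  define C where "C = 12 + 6 * M"
  have square: "(\<integral>\<^sup>+x. ennreal ((f (x + t *\<^sub>R ?e) - f x)\<^sup>2) \<partial>lborel) \<le> ennreal (C * t\<^sup>2)"
    if t: "0 < t" "t \<le> 1" for t
  proof -
    \<comment> \<open>The approximant depends on \<open>t\<close>: its squared error must itself be
      of order \<open>t^2\<close>.\<close>
    obtain \<phi> where \<phi>: "\<phi> \<in> test_functions \<Omega>"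
      "ip \<Omega> (\<lambda>x. \<eta> x - \<phi> x) (\<lambda>x. \<eta> x - \<phi> x) + ip \<Omega> (\<lambda>x. G x - grad \<phi> x) (\<lambda>x. G x - grad \<phi> x) < t\<^sup>2"
      using G(2)[OF t(1)] by blast
    note td = test_functionD[OF \<phi>(1)] and tL = test_function_L2[OF \<phi>(1)]
    have [measurable]: "\<phi> \<in> borel_measurable borel" using td(1) by (rule borel_measurable_continuous_onI)
    have dL: "(\<lambda>x. \<eta> x - \<phi> x) \<in> L2 \<Omega>" "(\<lambda>x. G x - grad \<phi> x) \<in> L2 \<Omega>"
      using L2_comb[OF \<eta>L tL(1), of 1 "-1"] L2_comb[OF G(1) tL(3), of 1 "-1"] by simp_all
    have b: "ip \<Omega> (\<lambda>x. \<eta> x - \<phi> x) (\<lambda>x. \<eta> x - \<phi> x) \<le> t\<^sup>2" "ip \<Omega> (\<lambda>x. G x - grad \<phi> x) (\<lambda>x. G x - grad \<phi> x) \<le> t\<^sup>2"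
      using \<phi>(2) ip_nonneg[of "\<lambda>x. \<eta> x - \<phi> x"] ip_nonneg[of "\<lambda>x. G x - grad \<phi> x"] by linarith+
    have A: "(\<integral>\<^sup>+x. ennreal ((f x - \<phi> x)\<^sup>2) \<partial>lborel) \<le> ennreal (t\<^sup>2)"
    proof -
      have "(\<integral>\<^sup>+x. ennreal ((f x - \<phi> x)\<^sup>2) \<partial>lborel) = ennreal (ip \<Omega> (\<lambda>x. \<eta> x - \<phi> x) (\<lambda>x. \<eta> x - \<phi> x))"
        using f_in f_out td(4) by (intro nn_integral_domain[OF dL(1)]) (auto simp: power2_eq_square)
      then show ?thesis using b(1) by (simp add: ennreal_leI)
    qed
    have A': "(\<integral>\<^sup>+x. ennreal ((f (x + t *\<^sub>R ?e) - \<phi> (x + t *\<^sub>R ?e))\<^sup>2) \<partial>lborel) \<le> ennreal (t\<^sup>2)"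
      using A by (subst nn_integral_translate[of "\<lambda>x. ennreal ((f x - \<phi> x)\<^sup>2)"]) simp_all
    \<comment> \<open>Although \<open>\<phi>\<close> varies with \<open>t\<close>, its gradient is
      controlled by \<open>M\<close>, which belongs to \<open>\<eta>\<close> alone, and by the
      approximation error.\<close>
    have gradL: "ip \<Omega> (grad \<phi>) (grad \<phi>) \<le> 2 * M + 2 * t\<^sup>2"
    proof -
      have "grad \<phi> = (\<lambda>x. 1 *\<^sub>R G x + (-1) *\<^sub>R (G x - grad \<phi> x))" by simp
      then have "ip \<Omega> (grad \<phi>) (grad \<phi>) \<le> 2 * 1\<^sup>2 * ip \<Omega> G G
          + 2 * (-1)\<^sup>2 * ip \<Omega> (\<lambda>x. G x - grad \<phi> x) (\<lambda>x. G x - grad \<phi> x)"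
        using ip_comb_le[OF G(1) dL(2), of 1 "-1"] by simp
      then show ?thesis using b(2) by (simp add: M_def)
    qed
    have B: "(\<integral>\<^sup>+x. ennreal ((\<phi> (x + t *\<^sub>R ?e) - \<phi> x)\<^sup>2) \<partial>lborel) \<le> ennreal (t\<^sup>2 * (2 * M + 2 * t\<^sup>2))"
    proof -
      have "(\<integral>\<^sup>+x. ennreal ((pderiv_at 1 \<phi> x)\<^sup>2) \<partial>lborel) \<le> (\<integral>\<^sup>+x. ennreal (grad \<phi> x \<bullet> grad \<phi> x) \<partial>lborel)"
        by (intro nn_integral_mono ennreal_leI) (simp add: inner_pt grad_def power2_eq_square)
      also have "\<dots> = ennreal (ip \<Omega> (grad \<phi>) (grad \<phi>))"
        using td(5) by (intro nn_integral_domain[OF tL(3)]) (auto simp: grad_def inner_pt)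
      also have "\<dots> \<le> ennreal (2 * M + 2 * t\<^sup>2)" using gradL by (rule ennreal_leI)
      finally have "ennreal (t\<^sup>2) * (\<integral>\<^sup>+x. ennreal ((pderiv_at 1 \<phi> x)\<^sup>2) \<partial>lborel)
          \<le> ennreal (t\<^sup>2) * ennreal (2 * M + 2 * t\<^sup>2)" by (rule mult_left_mono) simp
      then show ?thesis
        using order_trans[OF test_function_translation[OF \<phi>(1), of t]] by (simp add: ennreal_mult')
    qed
    have three: "(a + b + d)\<^sup>2 \<le> 3 * a\<^sup>2 + 3 * b\<^sup>2 + 3 * d\<^sup>2" for a b d :: real
    proof -
      have "0 \<le> (a - b)\<^sup>2 + (b - d)\<^sup>2 + (a - d)\<^sup>2" by simp
      then show ?thesis by (simp add: power2_eq_square algebra_simps)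
    qed
    have "(\<integral>\<^sup>+x. ennreal ((f (x + t *\<^sub>R ?e) - f x)\<^sup>2) \<partial>lborel) \<le>
      (\<integral>\<^sup>+x. (3 * ennreal ((f (x + t *\<^sub>R ?e) - \<phi> (x + t *\<^sub>R ?e))\<^sup>2) + 3 * ennreal ((\<phi> (x + t *\<^sub>R ?e) - \<phi> x)\<^sup>2))
         + 3 * ennreal ((f x - \<phi> x)\<^sup>2) \<partial>lborel)"
    proof (rule nn_integral_mono)
      fix x
      have "(f (x + t *\<^sub>R ?e) - f x)\<^sup>2 \<le> 3 * (f (x + t *\<^sub>R ?e) - \<phi> (x + t *\<^sub>R ?e))\<^sup>2 + 3 * (\<phi> (x + t *\<^sub>R ?e) - \<phi> x)\<^sup>2 + 3 * (\<phi> x - f x)\<^sup>2"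
        using three[of "f (x + t *\<^sub>R ?e) - \<phi> (x + t *\<^sub>R ?e)" "\<phi> (x + t *\<^sub>R ?e) - \<phi> x" "\<phi> x - f x"] by simp
      also have "(\<phi> x - f x)\<^sup>2 = (f x - \<phi> x)\<^sup>2" by (rule power2_commute)
      finally show "ennreal ((f (x + t *\<^sub>R ?e) - f x)\<^sup>2) \<le>
        (3 * ennreal ((f (x + t *\<^sub>R ?e) - \<phi> (x + t *\<^sub>R ?e))\<^sup>2) + 3 * ennreal ((\<phi> (x + t *\<^sub>R ?e) - \<phi> x)\<^sup>2))
         + 3 * ennreal ((f x - \<phi> x)\<^sup>2)"
        by (simp add: ennreal_leI ennreal_mult'[symmetric] ennreal_plus[symmetric] ennreal_numeral[symmetric] del: ennreal_plus ennreal_numeral)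
    qed
    also have "\<dots> = (3 * (\<integral>\<^sup>+x. ennreal ((f (x + t *\<^sub>R ?e) - \<phi> (x + t *\<^sub>R ?e))\<^sup>2) \<partial>lborel)
        + 3 * (\<integral>\<^sup>+x. ennreal ((\<phi> (x + t *\<^sub>R ?e) - \<phi> x)\<^sup>2) \<partial>lborel)) + 3 * (\<integral>\<^sup>+x. ennreal ((f x - \<phi> x)\<^sup>2) \<partial>lborel)"
      by (subst nn_integral_add; (measurable; fail)?)+ (simp add: nn_integral_add nn_integral_cmult)
    also have "\<dots> \<le> (3 * ennreal (t\<^sup>2) + 3 * ennreal (t\<^sup>2 * (2 * M + 2 * t\<^sup>2))) + 3 * ennreal (t\<^sup>2)"
      using A A' B by (intro add_mono mult_left_mono) auto
    also have "\<dots> = ennreal ((3 * t\<^sup>2 + 3 * (t\<^sup>2 * (2 * M + 2 * t\<^sup>2))) + 3 * t\<^sup>2)"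
      using M by (simp add: ennreal_mult'[symmetric] ennreal_plus[symmetric] ennreal_numeral[symmetric] del: ennreal_plus ennreal_numeral)
    also have "\<dots> \<le> ennreal (C * t\<^sup>2)"
    proof (rule ennreal_leI)
      have "t\<^sup>2 * t\<^sup>2 \<le> t\<^sup>2 * 1" using t by (intro mult_left_mono) (auto simp: power_le_one)
      then show "(3 * t\<^sup>2 + 3 * (t\<^sup>2 * (2 * M + 2 * t\<^sup>2))) + 3 * t\<^sup>2 \<le> C * t\<^sup>2"
        by (simp add: C_def algebra_simps)
    qed
    finally show ?thesis .
  qed
  obtain R where R: "R > 0" "\<And>x. x \<in> \<Omega> \<Longrightarrow> norm x < R" using domain(3) by (metis bounded_pos_less)
  have "AE x in lborel. f x = 0"
    using f_out R(2) by (intro finite_range_translation_zero[OF f_meas fin R(1) _ _ square]) auto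
  then have "AE x in lebesgue. f x = 0" by (rule AE_completion)
  then have neg: "negligible {x. f x \<noteq> 0}"
    unfolding eventually_ae_filter by (auto simp: negligible_iff_null_sets[symmetric] intro: negligible_subset)
  have "c K = 0" if K: "K \<in> T" for K
  proof (rule ccontr)
    assume "c K \<noteq> 0"
    then have "interior K \<subseteq> {x. f x \<noteq> 0}" using f_in[OF K] c[OF K] by auto
    then show False using neg open_not_negligible[OF open_interior] mesh_interior_nonempty[OF K] negligible_subset
      by blast
  qed
  then show ?thesis unfolding interior_eq_def using c by simp
qed

section \<open>Decoupling\<close>


text \<open>These point evaluations are the separating functionals for
  \<open>semidefinite_riesz\<close>. On each element a grid of three by three interior points
  recovers the six coefficients of a quadratic.\<close>

lemma pw_polys_2_separating:
  obtains I where "finite I" "\<And>v. v \<in> pw_polys T 2 \<Longrightarrow> \<forall>x\<in>I. v x = 0 \<Longrightarrow> interior_eq T v (\<lambda>x. 0)"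
proof -
  have "\<exists>I. finite I \<and> (\<forall>v\<in>pw_polys T 2. (\<forall>x\<in>I. v x = 0) \<longrightarrow> (\<forall>x\<in>interior K. v x = 0))" if K: "K \<in> T" for K
  proof -
    obtain x0 where "x0 \<in> interior K" using mesh_interior_nonempty[OF K] by blast
    then obtain e where e: "e > 0" "ball x0 e \<subseteq> interior K" using open_contains_ball open_interior by blast
    \<comment> \<open>Grid points differ from the centre by at most \<open>2 t\<close> in each
      coordinate, so they stay within distance \<open>4 t < e\<close>.\<close>
    define t where "t = e / 5"
    have t: "t > 0" "e = 5 * t" using e by (auto simp: t_def)
    define X where "X i j = x0 + vector [real i * t, real j * t]" for i j :: nat
    have X_nth: "X i j $ 1 = x0 $ 1 + real i * t" "X i j $ 2 = x0 $ 2 + real j * t" for i j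
      by (simp_all add: X_def)
    have XK: "X i j \<in> interior K" if "i \<le> 2" "j \<le> 2" for i j
    proof -
      have "norm (X i j - x0) \<le> \<bar>(X i j - x0) $ 1\<bar> + \<bar>(X i j - x0) $ 2\<bar>"
        using norm_le_l1_cart[of "X i j - x0"] by (simp add: sum_2)
      also have "\<dots> = real i * t + real j * t" using t by (simp add: X_nth)
      also have "\<dots> \<le> 2 * t + 2 * t" using that t(1) by (intro add_mono mult_right_mono) auto
      also have "\<dots> < e" using t by simp
      finally have "X i j \<in> ball x0 e" by (simp add: dist_norm norm_minus_commute)
      then show ?thesis using e(2) by blast
    qed
    have "\<forall>x\<in>interior K. v x = 0" if v: "v \<in> pw_polys T 2" and z: "\<forall>i\<le>2. \<forall>j\<le>2. v (X i j) = 0" for v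
    proof -
      obtain a b c d f g where q: "\<forall>x\<in>interior K. v x = qp a b c d f g x" using pw_polys_2D[OF v K] by metis
      have zq: "qp a b c d f g (X i j) = 0" if "i \<le> 2" "j \<le> 2" for i j
        using q z XK[OF that] that by metis
      let ?q = "qp a b c d f g"
      \<comment> \<open>Second differences isolate the quadratic coefficients; once these vanish,
        first differences give the linear ones.\<close>
      have "2 * (t * t) * d = ?q (X 2 0) - 2 * ?q (X 1 0) + ?q (X 0 0)"
        "2 * (t * t) * g = ?q (X 0 2) - 2 * ?q (X 0 1) + ?q (X 0 0)"
        "t * t * f = ?q (X 1 1) - ?q (X 1 0) - ?q (X 0 1) + ?q (X 0 0)"
        unfolding qp_def X_nth by (simp_all add: power2_eq_square algebra_simps)
      then have "2 * (t * t) * d = 0" "2 * (t * t) * g = 0" "t * t * f = 0" by (simp_all only: zq)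
      then have dgf: "d = 0" "g = 0" "f = 0" using t(1) by simp_all
      have "t * b = ?q (X 1 0) - ?q (X 0 0)" "t * c = ?q (X 0 1) - ?q (X 0 0)"
        unfolding qp_def X_nth dgf by (simp_all add: algebra_simps)
      then have "t * b = 0" "t * c = 0" by (simp_all only: zq)
      then have bc: "b = 0" "c = 0" using t(1) by simp_all
      then have "a = 0" using zq[of 0 0] unfolding qp_def dgf bc by simp
      then show ?thesis using q dgf bc by (simp add: qp_def)
    qed
    then show ?thesis
      by (intro exI[of _ "(\<lambda>(i, j). X i j) ` ({..2} \<times> {..2})"]) auto
  qed
  then obtain I where I: "\<And>K. K \<in> T \<Longrightarrow> finite (I K)"
    "\<And>K v. K \<in> T \<Longrightarrow> v \<in> pw_polys T 2 \<Longrightarrow> \<forall>x\<in>I K. v x = 0 \<Longrightarrow> \<forall>x\<in>interior K. v x = 0"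
    by metis
  show ?thesis
  proof (rule that[of "\<Union>(I ` T)"])
    show "finite (\<Union>(I ` T))" using finite_mesh I(1) by blast
    show "interior_eq T v (\<lambda>x. 0)" if "v \<in> pw_polys T 2" "\<forall>x\<in>\<Union>(I ` T). v x = 0" for v
      unfolding interior_eq_def using I(2)[OF _ that(1)] that(2) by blast
  qed
qed

lemma derivs_zero:
  assumes "interior_eq T v (\<lambda>x. 0)"
  shows "interior_eq T (grad v) (\<lambda>x. 0)" "interior_eq T (curl v) (\<lambda>x. 0)"
proof -
  have "grad v x = 0 \<and> curl v x = 0" if K: "K \<in> T" "x \<in> interior K" for K x
  proof -
    have e: "\<forall>y\<in>interior K. v y = qp 0 0 0 0 0 0 y" using assms K(1) by (simp add: interior_eq_def qp_def)
    show ?thesis unfolding local_qp(1,2)[OF e K(2)] grad_qp curl_qp by (simp add: aff_def pt_eq_iff)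
  qed
  then show "interior_eq T (grad v) (\<lambda>x. 0)" "interior_eq T (curl v) (\<lambda>x. 0)"
    unfolding interior_eq_def by blast+
qed

lemma pwaff_zero_dvg:
  assumes "interior_eq T \<psi> (\<lambda>x. 0)" shows "interior_eq T (dvg \<psi>) (\<lambda>x. 0)"
  unfolding interior_eq_def
proof (intro ballI)
  fix K x assume K: "K \<in> T" "x \<in> interior K"
  have e: "\<forall>y\<in>interior K. \<psi> y = aff 0 0 0 y" using assms K(1) by (simp add: interior_eq_def aff_def)
  show "dvg \<psi> x = 0" unfolding local_aff(1)[OF e K(2)] dvg_aff by simp
qed

lemma pwc_const [simp]: "pwc T (\<lambda>x. k)"
  by (intro pwc_constI) blast

lemma ip_zero_left: "pwc T g \<Longrightarrow> pwc T h \<Longrightarrow> interior_eq T g (\<lambda>x. 0) \<Longrightarrow> ip \<Omega> g h = 0"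
  using ip_cong[of g h "\<lambda>x. 0" h] by (simp add: ip_def)

lemma ip_zero_right: "pwc T g \<Longrightarrow> pwc T h \<Longrightarrow> interior_eq T h (\<lambda>x. 0) \<Longrightarrow> ip \<Omega> g h = 0"
  using ip_zero_left[of h g] by (simp add: ip_commute)

lemma curl_eq_rot: "curl v x = rot (grad v x)"
  by (simp add: curl_def grad_def pt_eq_iff)

lemma ip_curl: "ip \<Omega> (curl u) (curl v) = ip \<Omega> (grad u) (grad v)"
  by (simp add: ip_def curl_eq_rot)

lemma gradient_form_linear:
  assumes "u \<in> pw_polys T 2" "v \<in> pw_polys T 2" "pwc T h"
  shows "ip \<Omega> (grad (\<lambda>x. r *\<^sub>R u x + s *\<^sub>R v x)) h = r * ip \<Omega> (grad u) h + s * ip \<Omega> (grad v) h"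
proof -
  have p: "pwc T (grad w)" if "w \<in> pw_polys T 2" for w using pwaff_pwc[OF pwaff_pw_polys_2(1)[OF that]] .
  show ?thesis
    using ip_cong[OF p[OF pw_polys_2_comb[OF assms(1,2)]] assms(3) comb_pw_polys_2(1)[OF assms(1,2)] interior_eq_refl]
      ip_comb_left[OF p[OF assms(1)] p[OF assms(2)] assms(3)] by simp
qed

text \<open>Used for Lagrange and Morley spaces alike. The condition \<open>ker\<close> holds at
  once for functionals that see only the gradient; for the load it is where
  \<open>H10_pw_const_zero\<close> enters.\<close>

lemma gradient_riesz:
  fixes V :: "(pt \<Rightarrow> real) set"
  assumes V: "V \<noteq> {}" "V \<subseteq> pw_polys T 2"
      "\<And>u v r s. u \<in> V \<Longrightarrow> v \<in> V \<Longrightarrow> (\<lambda>x. r *\<^sub>R u x + s *\<^sub>R v x) \<in> V"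
    and L: "\<And>u v r s. u \<in> V \<Longrightarrow> v \<in> V \<Longrightarrow> L (\<lambda>x. r *\<^sub>R u x + s *\<^sub>R v x) = r * L u + s * L v"
    and ker: "\<And>v. v \<in> V \<Longrightarrow> interior_eq T (grad v) (\<lambda>x. 0) \<Longrightarrow> L v = 0"
  shows "\<exists>u\<in>V. \<forall>v\<in>V. ip \<Omega> (grad u) (grad v) = L v"
proof -
  obtain I where I: "finite I" "\<And>v. v \<in> pw_polys T 2 \<Longrightarrow> \<forall>x\<in>I. v x = 0 \<Longrightarrow> interior_eq T v (\<lambda>x. 0)"
    using pw_polys_2_separating by metis
  have p: "v \<in> pw_polys T 2" if "v \<in> V" for v using V(2) that by blast
  have g: "pwc T (grad v)" if "v \<in> V" for v using pwaff_pwc[OF pwaff_pw_polys_2(1)[OF p[OF that]]] .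
  show ?thesis
  proof (rule semidefinite_riesz[where I = I and \<Lambda> = "\<lambda>x v. v x" and B = "\<lambda>u v. ip \<Omega> (grad u) (grad v)"])
    fix u v w r s assume uv: "u \<in> V" "v \<in> V" "w \<in> V"
    show "ip \<Omega> (grad (\<lambda>x. r *\<^sub>R u x + s *\<^sub>R v x)) (grad w) = r * ip \<Omega> (grad u) (grad w) + s * ip \<Omega> (grad v) (grad w)"
      using uv p g by (intro gradient_form_linear) auto
  next
    fix v assume v: "v \<in> V" "\<And>i. i \<in> I \<Longrightarrow> v i = 0"
    then have "interior_eq T (grad v) (\<lambda>x. 0)" using I(2)[OF p] derivs_zero(1) by blast
    then show "ip \<Omega> (grad v) (grad v) = 0" by (rule ip_zero_left[OF g[OF v(1)] g[OF v(1)]])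
  next
    fix v assume v: "v \<in> V" "ip \<Omega> (grad v) (grad v) = 0"
    show "L v = 0" by (rule ker[OF v(1) ip_zeroD[OF g[OF v(1)] v(2)]])
  qed (use I V L ip_commute ip_nonneg in \<open>simp_all\<close>)
qed

text \<open>The null vectors of this form are exactly the discretely divergence-free fields, so a
  functional vanishing on them is represented by a divergence. The separating functionals are the
  point evaluations of both components.\<close>

lemma divergence_riesz:
  assumes L: "\<And>\<phi> \<psi> r s. \<phi> \<in> cr_space \<Omega> T \<Longrightarrow> \<psi> \<in> cr_space \<Omega> T \<Longrightarrow>
      L (\<lambda>x. r *\<^sub>R \<phi> x + s *\<^sub>R \<psi> x) = r * L \<phi> + s * L \<psi>"
    and ker: "\<And>\<psi>. \<psi> \<in> cr_space \<Omega> T \<Longrightarrow> interior_eq T (dvg \<psi>) (\<lambda>x. 0) \<Longrightarrow> L \<psi> = 0"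
    and ne: "cr_space \<Omega> T \<noteq> {}"
  shows "\<exists>\<phi>\<in>cr_space \<Omega> T. \<forall>\<psi>\<in>cr_space \<Omega> T. ip \<Omega> (dvg \<phi>) (dvg \<psi>) = L \<psi>"
proof -
  obtain I where I: "finite I" "\<And>v. v \<in> pw_polys T 2 \<Longrightarrow> \<forall>x\<in>I. v x = 0 \<Longrightarrow> interior_eq T v (\<lambda>x. 0)"
    using pw_polys_2_separating by metis
  have a: "pwaff T \<psi>" if "\<psi> \<in> cr_space \<Omega> T" for \<psi> using that unfolding cr_space_iff by blast
  have d: "pwc T (dvg \<psi>)" if "\<psi> \<in> cr_space \<Omega> T" for \<psi> using pwaff_derivs(2)[OF a[OF that]] .
  show ?thesis
  proof (rule semidefinite_riesz[where I = "I \<times> (UNIV :: 2 set)" and \<Lambda> = "\<lambda>(x, i) \<psi>. \<psi> x $ i"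
        and B = "\<lambda>\<phi> \<psi>. ip \<Omega> (dvg \<phi>) (dvg \<psi>)"])
    show "finite (I \<times> (UNIV :: 2 set))" using I(1) by simp
    fix \<phi> \<psi> \<theta> r s assume v: "\<phi> \<in> cr_space \<Omega> T" "\<psi> \<in> cr_space \<Omega> T" "\<theta> \<in> cr_space \<Omega> T"
    have "ip \<Omega> (dvg (\<lambda>x. r *\<^sub>R \<phi> x + s *\<^sub>R \<psi> x)) (dvg \<theta>) = ip \<Omega> (\<lambda>x. r *\<^sub>R dvg \<phi> x + s *\<^sub>R dvg \<psi> x) (dvg \<theta>)"
      by (rule ip_cong[OF d[OF cr_space_comb[OF v(1,2)]] d[OF v(3)] comb_pwaff(1)[OF a[OF v(1)] a[OF v(2)]] interior_eq_refl])
    also have "\<dots> = r * ip \<Omega> (dvg \<phi>) (dvg \<theta>) + s * ip \<Omega> (dvg \<psi>) (dvg \<theta>)"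
      by (rule ip_comb_left[OF d[OF v(1)] d[OF v(2)] d[OF v(3)]])
    finally show "ip \<Omega> (dvg (\<lambda>x. r *\<^sub>R \<phi> x + s *\<^sub>R \<psi> x)) (dvg \<theta>) = r * ip \<Omega> (dvg \<phi>) (dvg \<theta>) + s * ip \<Omega> (dvg \<psi>) (dvg \<theta>)" .
  next
    fix \<psi> assume \<psi>: "\<psi> \<in> cr_space \<Omega> T"
      and z: "\<And>i. i \<in> I \<times> (UNIV :: 2 set) \<Longrightarrow> (case i of (x, i) \<Rightarrow> \<lambda>\<psi>. \<psi> x $ i) \<psi> = 0"
    have "(\<lambda>x. \<psi> x $ i) \<in> pw_polys T 2" for i
      using a[OF \<psi>] pw_polys_1_subset_2 pwaff_components by blast
    moreover have "\<forall>x\<in>I. \<psi> x $ i = 0" for i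
    proof
      fix x assume "x \<in> I"
      then show "\<psi> x $ i = 0" using z[of "(x, i)"] by simp
    qed
    ultimately have "interior_eq T (\<lambda>x. \<psi> x $ i) (\<lambda>x. 0)" for i by (rule I(2))
    then have "interior_eq T \<psi> (\<lambda>x. 0)" unfolding interior_eq_def vec_eq_iff zero_index by blast
    then show "ip \<Omega> (dvg \<psi>) (dvg \<psi>) = 0" by (intro ip_zero_left d \<psi> pwaff_zero_dvg)
  next
    fix \<psi> assume \<psi>: "\<psi> \<in> cr_space \<Omega> T" "ip \<Omega> (dvg \<psi>) (dvg \<psi>) = 0"
    show "L \<psi> = 0" by (rule ker[OF \<psi>(1) ip_zeroD[OF d[OF \<psi>(1)] \<psi>(2)]])
  next
    show "ip \<Omega> (dvg \<phi>) (dvg \<psi>) = ip \<Omega> (dvg \<psi>) (dvg \<phi>)" for \<phi> \<psi> by (rule ip_commute)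
    show "ip \<Omega> (dvg \<psi>) (dvg \<psi>) \<ge> 0" for \<psi> by (rule ip_nonneg)
  qed (use ne cr_space_comb L in \<open>auto simp: split_beta\<close>)
qed

lemma c_form_commute: "c_form \<Omega> T \<sigma> \<phi> \<psi> = c_form \<Omega> T \<sigma> \<psi> \<phi>"
  unfolding c_form_def Let_def
  by (simp add: ip_commute[of \<Omega> "vgrad \<phi>"] edge_ip_commute[of _ "bd_trace T _ (\<lambda>x. \<phi> x \<bullet> _)"]
      edge_ip_commute[of _ "bd_trace T _ (dir_deriv _ (\<lambda>x. \<phi> x \<bullet> _))"])

section \<open>The Lagrange problem and the projection\<close>

lemma lagrange_space0D:
  assumes "l \<in> {1, 2}" "v \<in> lagrange_space0 \<Omega> T l"
  shows "v \<in> H10 \<Omega>" "v \<in> L2 \<Omega>" "v \<in> pw_polys T 2"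
proof -
  show h: "v \<in> H10 \<Omega>" using assms by (simp add: lagrange_space0_def)
  then show "v \<in> L2 \<Omega>" by (simp add: H10_def)
  show "v \<in> pw_polys T 2" using assms pw_polys_1_subset_2 by (auto simp: lagrange_space0_def)
qed

lemma lagrange_space0_comb:
  assumes "l \<in> {1, 2}" "u \<in> lagrange_space0 \<Omega> T l" "v \<in> lagrange_space0 \<Omega> T l"
  shows "(\<lambda>x. r *\<^sub>R u x + s *\<^sub>R v x) \<in> lagrange_space0 \<Omega> T l"
  using assms H10_comb pw_polys_1_comb pw_polys_2_comb unfolding lagrange_space0_def by blast

lemma zero_lagrange_space0: assumes "l \<in> {1, 2}" shows "(\<lambda>x. 0) \<in> lagrange_space0 \<Omega> T l"
proof -
  have "(\<lambda>x. 0) = aff (0::real) 0 0" "(\<lambda>x. 0) = qp 0 0 0 0 0 0" by (auto simp: aff_def qp_def)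
  then have "(\<lambda>x. 0) \<in> polys 1" "(\<lambda>x. 0) \<in> polys 2" unfolding polys_1 polys_2 by blast+
  then show ?thesis using assms zero_H10 unfolding lagrange_space0_def pw_polys_def by auto
qed

lemma lagrange_riesz:
  assumes l: "l \<in> {1, 2}"
    and L: "\<And>u v r s. u \<in> lagrange_space0 \<Omega> T l \<Longrightarrow> v \<in> lagrange_space0 \<Omega> T l \<Longrightarrow>
      L (\<lambda>x. r *\<^sub>R u x + s *\<^sub>R v x) = r * L u + s * L v"
    and ker: "\<And>v. v \<in> lagrange_space0 \<Omega> T l \<Longrightarrow> interior_eq T (grad v) (\<lambda>x. 0) \<Longrightarrow> L v = 0"
  shows "\<exists>u\<in>lagrange_space0 \<Omega> T l. \<forall>v\<in>lagrange_space0 \<Omega> T l. ip \<Omega> (grad u) (grad v) = L v"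
  using zero_lagrange_space0[OF l] lagrange_space0D(3)[OF l] lagrange_space0_comb[OF l] L ker
  by (intro gradient_riesz) blast+

text \<open>The increment of a quadratic between two points is given by its gradient at their
  midpoint, and the interior of an element is convex.\<close>

lemma grad_zero_imp_const:
  assumes v: "v \<in> pw_polys T 2" and g: "interior_eq T (grad v) (\<lambda>x. 0)" and K: "K \<in> T"
  shows "\<exists>c. \<forall>x\<in>interior K. v x = c"
proof -
  obtain p where p: "p \<in> polys 2" "\<forall>x\<in>interior K. v x = p x" using v K unfolding pw_polys_def by blast
  obtain x0 where x0: "x0 \<in> interior K" using mesh_interior_nonempty[OF K] by blast
  have "p x = p x0" if x: "x \<in> interior K" for x
  proof -
    have m: "midpoint x0 x \<in> interior K"
      using midpoint_in_convex[OF convex_interior[OF mesh_convex[OF K]] x0 x] .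
    have "grad p (midpoint x0 x) = grad v (midpoint x0 x)"
      by (rule grad_cong[OF open_interior m]) (simp add: p(2))
    then have "grad p (midpoint x0 x) = 0" using interior_eqD[OF g K m] by simp
    then show ?thesis using polys_2_props(1)[OF p(1), of x x0] by simp
  qed
  then show ?thesis using p(2) by (intro exI[of _ "p x0"]) simp
qed

text \<open>A Lagrange function with zero gradient is elementwise constant, hence zero on the open
  triangles since it lies in \<open>H10\<close>; the load cannot see it.\<close>

lemma lagrange_poisson_solvable:
  assumes l: "l \<in> {1, 2}" and f: "f \<in> L2 \<Omega>"
  shows "\<exists>w\<in>lagrange_space0 \<Omega> T l. \<forall>\<eta>\<in>lagrange_space0 \<Omega> T l. ip \<Omega> (grad w) (grad \<eta>) = ip \<Omega> f \<eta>"
proof (rule lagrange_riesz[OF l])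
  fix u v r s assume u: "u \<in> lagrange_space0 \<Omega> T l" and v: "v \<in> lagrange_space0 \<Omega> T l"
  show "ip \<Omega> f (\<lambda>x. r *\<^sub>R u x + s *\<^sub>R v x) = r * ip \<Omega> f u + s * ip \<Omega> f v"
    using ip_L2_comb_left[OF lagrange_space0D(2)[OF l u] lagrange_space0D(2)[OF l v] f, of r s]
    by (simp only: ip_commute)
next
  fix v assume v: "v \<in> lagrange_space0 \<Omega> T l" and g: "interior_eq T (grad v) (\<lambda>x. 0)"
  note vD = lagrange_space0D[OF l v]
  have "interior_eq T v (\<lambda>x. 0)" by (rule H10_pw_const_zero[OF vD(1) grad_zero_imp_const[OF vD(3) g]])
  then have "AE x in lebesgue_on \<Omega>. f x \<bullet> v x = 0" by (intro AE_domainI) (simp add: interior_eq_def)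
  then show "ip \<Omega> f v = 0" unfolding ip_def by (rule integral_eq_zero_AE)
qed

text \<open>Existence legitimizes the choice in \<open>lagrange_proj\<close>; the functional pairs
  gradients, so it vanishes on null vectors.\<close>

lemma lagrange_proj_props:
  assumes l: "l \<in> {1, 2}" and v: "v \<in> pw_polys T 2"
  shows "lagrange_proj \<Omega> T l v \<in> lagrange_space0 \<Omega> T l"
    "\<And>\<eta>. \<eta> \<in> lagrange_space0 \<Omega> T l \<Longrightarrow>
       ip \<Omega> (grad (lagrange_proj \<Omega> T l v)) (grad \<eta>) = ip \<Omega> (grad v) (grad \<eta>)"
proof -
  have g: "pwc T (grad u)" if "u \<in> pw_polys T 2" for u using pwaff_pwc[OF pwaff_pw_polys_2(1)[OF that]] .
  have "\<exists>p\<in>lagrange_space0 \<Omega> T l. \<forall>\<eta>\<in>lagrange_space0 \<Omega> T l. ip \<Omega> (grad p) (grad \<eta>) = ip \<Omega> (grad v) (grad \<eta>)"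
  proof (rule lagrange_riesz[OF l])
    fix u w r s assume u: "u \<in> lagrange_space0 \<Omega> T l" and w: "w \<in> lagrange_space0 \<Omega> T l"
    show "ip \<Omega> (grad v) (grad (\<lambda>x. r *\<^sub>R u x + s *\<^sub>R w x)) = r * ip \<Omega> (grad v) (grad u) + s * ip \<Omega> (grad v) (grad w)"
      using gradient_form_linear[OF lagrange_space0D(3)[OF l u] lagrange_space0D(3)[OF l w] g[OF v], of r s]
      by (simp only: ip_commute)
  next
    fix u assume u: "u \<in> lagrange_space0 \<Omega> T l" and z: "interior_eq T (grad u) (\<lambda>x. 0)"
    show "ip \<Omega> (grad v) (grad u) = 0" by (rule ip_zero_right[OF g[OF v] g[OF lagrange_space0D(3)[OF l u]] z])
  qed
  then have "\<exists>p. p \<in> lagrange_space0 \<Omega> T l \<and> (\<forall>\<eta>\<in>lagrange_space0 \<Omega> T l. ip \<Omega> (grad p) (grad \<eta>) = ip \<Omega> (grad v) (grad \<eta>))"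
    by blast
  from someI_ex[OF this] show "lagrange_proj \<Omega> T l v \<in> lagrange_space0 \<Omega> T l"
    "\<And>\<eta>. \<eta> \<in> lagrange_space0 \<Omega> T l \<Longrightarrow> ip \<Omega> (grad (lagrange_proj \<Omega> T l v)) (grad \<eta>) = ip \<Omega> (grad v) (grad \<eta>)"
    unfolding lagrange_proj_def by blast+
qed

text \<open>Test the Poisson problem with the projection of \<open>v\<close>, then test the
  projection with \<open>w\<close>. This trades the load for the gradient of \<open>w\<close>, the
  right-hand side of the first Morley problem.\<close>

lemma load_eq:
  assumes l: "l \<in> {1, 2}" and v: "v \<in> pw_polys T 2"
    and w: "w \<in> lagrange_space0 \<Omega> T l" "\<forall>\<eta>\<in>lagrange_space0 \<Omega> T l. ip \<Omega> (grad w) (grad \<eta>) = ip \<Omega> f \<eta>"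
  shows "ip \<Omega> f (lagrange_proj \<Omega> T l v) = ip \<Omega> (grad w) (grad v)"
  using bspec[OF w(2) lagrange_proj_props(1)[OF l v]] lagrange_proj_props(2)[OF l v w(1)]
    ip_commute[of \<Omega> "grad w" "grad (lagrange_proj \<Omega> T l v)"] ip_commute[of \<Omega> "grad w" "grad v"] by simp

text \<open>The Poisson and first Morley problems are solved by the Riesz principle, while the
  velocity is set to \<open>curl u\<close>. Only a pressure is then missing: the residual of the
  momentum equation vanishes on divergence-free fields, because these are curls and \<open>u\<close>
  solves the method.\<close>

lemma nitsche_imp_decoupled:
  assumes l: "l \<in> {1, 2}" and f: "f \<in> L2 \<Omega>"
    and sol: "mwx_nitsche_solution \<Omega> T l \<epsilon> \<sigma> f u"
  shows "\<exists>w z \<phi> p. decoupled_solution \<Omega> T l \<epsilon> \<sigma> f w z \<phi> p u"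
proof -
  have u: "u \<in> mwx_space0 \<Omega> T" and eq: "\<And>v. v \<in> mwx_space0 \<Omega> T \<Longrightarrow>
      \<epsilon>\<^sup>2 * a_form \<Omega> T \<sigma> u v + b_form \<Omega> u v = ip \<Omega> f (lagrange_proj \<Omega> T l v)"
    using sol unfolding mwx_nitsche_solution_def by blast+
  have g: "pwc T (grad v)" and c: "pwc T (curl v)" if "v \<in> pw_polys T 2" for v
    using pwaff_pwc[OF pwaff_pw_polys_2(1)[OF that]] pwaff_pwc[OF pwaff_pw_polys_2(2)[OF that]] .
  have a: "pwaff T \<psi>" if "\<psi> \<in> cr_space \<Omega> T" for \<psi> using that unfolding cr_space_iff by blast
  obtain w where w: "w \<in> lagrange_space0 \<Omega> T l" "\<forall>\<eta>\<in>lagrange_space0 \<Omega> T l. ip \<Omega> (grad w) (grad \<eta>) = ip \<Omega> f \<eta>"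
    using lagrange_poisson_solvable[OF l f] by blast
  note w2 = lagrange_space0D(3)[OF l w(1)]
  have "\<exists>z\<in>mwx_space0 \<Omega> T. \<forall>v\<in>mwx_space0 \<Omega> T. ip \<Omega> (grad z) (grad v) = ip \<Omega> (grad w) (grad v)"
  proof (rule gradient_riesz)
    show "mwx_space0 \<Omega> T \<noteq> {}" using u by blast
    show "mwx_space0 \<Omega> T \<subseteq> pw_polys T 2" using mwx_pw_polys by blast
    fix v v' r s assume v: "v \<in> mwx_space0 \<Omega> T" "v' \<in> mwx_space0 \<Omega> T"
    show "(\<lambda>x. r *\<^sub>R v x + s *\<^sub>R v' x) \<in> mwx_space0 \<Omega> T" by (rule mwx_space0_comb[OF v])
    show "ip \<Omega> (grad w) (grad (\<lambda>x. r *\<^sub>R v x + s *\<^sub>R v' x)) = r * ip \<Omega> (grad w) (grad v) + s * ip \<Omega> (grad w) (grad v')"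
      using gradient_form_linear[OF mwx_pw_polys[OF v(1)] mwx_pw_polys[OF v(2)] g[OF w2], of r s]
      by (simp only: ip_commute)
  next
    fix v assume v: "v \<in> mwx_space0 \<Omega> T" "interior_eq T (grad v) (\<lambda>x. 0)"
    show "ip \<Omega> (grad w) (grad v) = 0" by (rule ip_zero_right[OF g[OF w2] g[OF mwx_pw_polys[OF v(1)]] v(2)])
  qed
  then obtain z where z: "z \<in> mwx_space0 \<Omega> T" "\<And>v. v \<in> mwx_space0 \<Omega> T \<Longrightarrow> ip \<Omega> (curl z) (curl v) = ip \<Omega> (grad w) (grad v)"
    unfolding ip_curl by blast
  note z2 = mwx_pw_polys[OF z(1)] and u2 = mwx_pw_polys[OF u]
  note cu = curl_in_cr_space[OF u]
  \<comment> \<open>The residual that the pressure term has to balance.\<close>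
  define L where "L \<psi> = ip \<Omega> (curl z) \<psi> - ip \<Omega> (curl u) \<psi> - \<epsilon>\<^sup>2 * c_form \<Omega> T \<sigma> (curl u) \<psi>" for \<psi>
  have "\<exists>\<theta>\<in>cr_space \<Omega> T. \<forall>\<psi>\<in>cr_space \<Omega> T. ip \<Omega> (dvg \<theta>) (dvg \<psi>) = L \<psi>"
  proof (rule divergence_riesz)
    show "cr_space \<Omega> T \<noteq> {}" using cu by blast
    fix \<phi> \<psi> r s assume \<phi>: "\<phi> \<in> cr_space \<Omega> T" and \<psi>: "\<psi> \<in> cr_space \<Omega> T"
    have "ip \<Omega> (curl v) (\<lambda>x. r *\<^sub>R \<phi> x + s *\<^sub>R \<psi> x) = r * ip \<Omega> (curl v) \<phi> + s * ip \<Omega> (curl v) \<psi>"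
      if "v \<in> pw_polys T 2" for v
      by (rule ip_comb_right[OF pwaff_pwc[OF a[OF \<phi>]] pwaff_pwc[OF a[OF \<psi>]] c[OF that]])
    then show "L (\<lambda>x. r *\<^sub>R \<phi> x + s *\<^sub>R \<psi> x) = r * L \<phi> + s * L \<psi>"
      unfolding L_def c_form_comb[OF a[OF cu] a[OF \<phi>] a[OF \<psi>]] using z2 u2 by (simp add: algebra_simps)
  next
    fix \<psi> assume \<psi>: "\<psi> \<in> cr_space \<Omega> T" and d: "interior_eq T (dvg \<psi>) (\<lambda>x. 0)"
    obtain v where v: "v \<in> mwx_space0 \<Omega> T" "interior_eq T (curl v) \<psi>"
      using cr_divergence_free_is_curl[OF \<psi> d] by blast
    note v2 = mwx_pw_polys[OF v(1)]
    have i: "ip \<Omega> (curl y) \<psi> = ip \<Omega> (grad y) (grad v)" if "y \<in> pw_polys T 2" for y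
      using ip_cong[OF c[OF that] c[OF v2] interior_eq_refl v(2)] by (simp add: ip_curl)
    \<comment> \<open>The field and the curl agree only on open triangles;
      \<open>c_form_cong\<close> replaces the first argument, hence the detour through
      symmetry.\<close>
    have cf: "c_form \<Omega> T \<sigma> (curl u) \<psi> = a_form \<Omega> T \<sigma> u v"
      unfolding c_form_curl[OF u2 v2, symmetric] c_form_commute[of \<sigma> "curl u"]
      by (rule c_form_cong[OF a[OF curl_in_cr_space[OF v(1)]] a[OF cu] v(2), symmetric])
    show "L \<psi> = 0"
      unfolding L_def i[OF z2] i[OF u2] cf
      using eq[OF v(1)] load_eq[OF l v2 w] z(2)[OF v(1)] by (simp add: ip_curl b_form_def)
  qed
  then obtain \<theta> where \<theta>: "\<theta> \<in> cr_space \<Omega> T" "\<And>\<psi>. \<psi> \<in> cr_space \<Omega> T \<Longrightarrow> ip \<Omega> (dvg \<theta>) (dvg \<psi>) = L \<psi>" by blast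
  \<comment> \<open>The pressure is itself a divergence, so its zero mean is the divergence
    theorem.\<close>
  have "decoupled_solution \<Omega> T l \<epsilon> \<sigma> f w z (curl u) (dvg \<theta>) u"
    unfolding decoupled_solution_def
  proof (intro conjI ballI)
    show "dvg \<theta> \<in> pw_const_space0 \<Omega> T"
      using pwaff_derivs(1)[OF a[OF \<theta>(1)]] cr_divergence_mean[OF \<theta>(1)] by (simp add: pw_const_space0_def)
    show "ip \<Omega> (curl u) \<psi> + \<epsilon>\<^sup>2 * c_form \<Omega> T \<sigma> (curl u) \<psi> + ip \<Omega> (dvg \<psi>) (dvg \<theta>) = ip \<Omega> (curl z) \<psi>"
      if "\<psi> \<in> cr_space \<Omega> T" for \<psi>
      using \<theta>(2)[OF that] ip_commute[of \<Omega> "dvg \<psi>" "dvg \<theta>"] by (simp add: L_def)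
    show "ip \<Omega> (dvg (curl u)) q = 0" if "q \<in> pw_const_space0 \<Omega> T" for q
    proof (rule ip_zero_left)
      show "pwc T (dvg (curl u))" by (rule pwaff_derivs(2)[OF a[OF cu]])
      show "interior_eq T (dvg (curl u)) (\<lambda>x. 0)" by (rule dvg_curl[OF u2])
      show "pwc T q" using that unfolding pw_const_space0_def pw_polys_def polys_0
        by (intro pwc_constI) blast
    qed
  qed (use w z u cu in simp_all)
  then show ?thesis by blast
qed

text \<open>The constraint makes \<open>\<phi>\<close> a curl, the last equation identifies it with
  \<open>curl u\<close>, and testing the momentum equation with curls removes the pressure.\<close>

lemma decoupled_imp_nitsche:
  assumes l: "l \<in> {1, 2}" and sol: "decoupled_solution \<Omega> T l \<epsilon> \<sigma> f w z \<phi> p u"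
  shows "mwx_nitsche_solution \<Omega> T l \<epsilon> \<sigma> f u"
proof -
  have mem: "w \<in> lagrange_space0 \<Omega> T l" "z \<in> mwx_space0 \<Omega> T" "\<phi> \<in> cr_space \<Omega> T"
      "p \<in> pw_const_space0 \<Omega> T" "u \<in> mwx_space0 \<Omega> T"
    and ew: "\<forall>\<eta>\<in>lagrange_space0 \<Omega> T l. ip \<Omega> (grad w) (grad \<eta>) = ip \<Omega> f \<eta>"
    and ez: "\<And>v. v \<in> mwx_space0 \<Omega> T \<Longrightarrow> ip \<Omega> (curl z) (curl v) = ip \<Omega> (grad w) (grad v)"
    and e\<phi>: "\<And>\<psi>. \<psi> \<in> cr_space \<Omega> T \<Longrightarrow>
      ip \<Omega> \<phi> \<psi> + \<epsilon>\<^sup>2 * c_form \<Omega> T \<sigma> \<phi> \<psi> + ip \<Omega> (dvg \<psi>) p = ip \<Omega> (curl z) \<psi>"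
    and ediv: "\<And>q. q \<in> pw_const_space0 \<Omega> T \<Longrightarrow> ip \<Omega> (dvg \<phi>) q = 0"
    and eu: "\<And>\<eta>. \<eta> \<in> mwx_space0 \<Omega> T \<Longrightarrow> ip \<Omega> (curl u) (curl \<eta>) = ip \<Omega> \<phi> (curl \<eta>)"
    using sol unfolding decoupled_solution_def by blast+
  have c: "pwc T (curl v)" if "v \<in> pw_polys T 2" for v
    using pwaff_pwc[OF pwaff_pw_polys_2(2)[OF that]] .
  have a: "pwaff T \<psi>" if "\<psi> \<in> cr_space \<Omega> T" for \<psi> using that unfolding cr_space_iff by blast
  note u2 = mwx_pw_polys[OF mem(5)]
  \<comment> \<open>Having zero mean, the divergence of \<open>\<phi>\<close> may test its own
    constraint, so its square norm vanishes.\<close>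
  have "dvg \<phi> \<in> pw_const_space0 \<Omega> T"
    using pwaff_derivs(1)[OF a[OF mem(3)]] cr_divergence_mean[OF mem(3)] by (simp add: pw_const_space0_def)
  then have "interior_eq T (dvg \<phi>) (\<lambda>x. 0)"
    by (intro ip_zeroD pwaff_derivs(2)[OF a[OF mem(3)]] ediv)
  then obtain y where y: "y \<in> mwx_space0 \<Omega> T" "interior_eq T (curl y) \<phi>"
    using cr_divergence_free_is_curl[OF mem(3)] by blast
  note y2 = mwx_pw_polys[OF y(1)]
  \<comment> \<open>Testing the last equation with \<open>u - y\<close> itself gives a vanishing
    square norm of \<open>curl (u - y)\<close>.\<close>
  let ?d = "\<lambda>x. 1 *\<^sub>R u x + (-1) *\<^sub>R y x"
  have d: "?d \<in> mwx_space0 \<Omega> T" by (rule mwx_space0_comb[OF mem(5) y(1)])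
  note d2 = mwx_pw_polys[OF d]
  have "ip \<Omega> (curl ?d) (curl ?d) = ip \<Omega> (\<lambda>x. 1 *\<^sub>R curl u x + (-1) *\<^sub>R curl y x) (curl ?d)"
    by (rule ip_cong[OF c[OF d2] c[OF d2] comb_pw_polys_2(2)[OF u2 y2] interior_eq_refl])
  also have "\<dots> = 1 * ip \<Omega> (curl u) (curl ?d) + (-1) * ip \<Omega> (curl y) (curl ?d)"
    by (rule ip_comb_left[OF c[OF u2] c[OF y2] c[OF d2]])
  also have "ip \<Omega> (curl y) (curl ?d) = ip \<Omega> \<phi> (curl ?d)"
    by (rule ip_cong[OF c[OF y2] c[OF d2] y(2) interior_eq_refl])
  also have "1 * ip \<Omega> (curl u) (curl ?d) + (-1) * ip \<Omega> \<phi> (curl ?d) = 0" using eu[OF d] by simp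
  finally have "interior_eq T (curl ?d) (\<lambda>x. 0)" by (rule ip_zeroD[OF c[OF d2]])
  then have u\<phi>: "interior_eq T (curl u) \<phi>"
    using comb_pw_polys_2(2)[OF u2 y2, of 1 "-1"] y(2) unfolding interior_eq_def by simp
  show ?thesis unfolding mwx_nitsche_solution_def
  proof (intro conjI ballI)
    show "u \<in> mwx_space0 \<Omega> T" by (rule mem(5))
    fix v assume v: "v \<in> mwx_space0 \<Omega> T"
    note v2 = mwx_pw_polys[OF v] and cv = curl_in_cr_space[OF v]
    have "ip \<Omega> \<phi> (curl v) = b_form \<Omega> u v"
      using ip_cong[OF c[OF u2] c[OF v2] u\<phi> interior_eq_refl] by (simp add: b_form_def ip_curl)
    moreover have "c_form \<Omega> T \<sigma> \<phi> (curl v) = a_form \<Omega> T \<sigma> u v"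
      using c_form_cong[OF a[OF curl_in_cr_space[OF mem(5)]] a[OF cv] u\<phi>] c_form_curl[OF u2 v2] by simp
    moreover have "pwc T p" using mem(4) unfolding pw_const_space0_def pw_polys_def polys_0
      by (intro pwc_constI) blast
    then have "ip \<Omega> (dvg (curl v)) p = 0"
      using pwaff_derivs(2)[OF a[OF cv]] dvg_curl[OF v2] by (intro ip_zero_left)
    ultimately show "\<epsilon>\<^sup>2 * a_form \<Omega> T \<sigma> u v + b_form \<Omega> u v = ip \<Omega> f (lagrange_proj \<Omega> T l v)"
      using e\<phi>[OF cv] ez[OF v] load_eq[OF l v2 mem(1) ew] by simp
  qed
qed

end

theorem theorem5p6:
  fixes \<Omega> :: "(real^2) set" and T :: "(real^2) set set" and l :: nat
    and \<epsilon> \<sigma> :: real and f u :: "real^2 \<Rightarrow> real"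
  assumes "convex_polygon \<Omega>" and "mesh \<Omega> T" and "l \<in> {1, 2}"
    and "\<epsilon> > 0" and "\<sigma> > 0" and "f \<in> L2 \<Omega>"
  shows "mwx_nitsche_solution \<Omega> T l \<epsilon> \<sigma> f u \<longleftrightarrow>
         (\<exists>w z \<phi> p. decoupled_solution \<Omega> T l \<epsilon> \<sigma> f w z \<phi> p u)"
proof -
  interpret domain_mesh \<Omega> T using assms(1,2) by unfold_locales
  show ?thesis using nitsche_imp_decoupled[OF assms(3,6)] decoupled_imp_nitsche[OF assms(3)] by blast
qed

end
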